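(* Let $A\subset B$ be a unital inclusion of von Neumann algebras with normal faithful trace-states, and let $Z=(Z_1,\dots,Z_m)\in B_h^m$. Let $\Phi_Z:A_h^n\to B_h^{n+m}$ be the map defined by $\Phi_Z(Y_1,\dots,Y_n)=(Y_1,\dots,Y_n,Z_1,\dots,Z_m)$. If $\{Z_1,\dots,Z_m\}$ and $A$ are independent or freely independent in $(B,\beta)$, then $\Phi_Z$ is $\mathbb{R}$-cyclomorphic.
   Context: $(A,\alpha)$ and $(B,\beta)$ are von Neumann algebras with normal faithful trace-states, $\alpha=\beta|_A$. For a von Neumann algebra $M$, $M_h$ denotes its hermitian elements. Two sets are independent in $(B,\beta)$ if the unital subalgebras $B_1,B_2$ they generate commute and $\beta(b_1b_2)=\beta(b_1)\beta(b_2)$ for $b_i\in B_i$; freely independent is the usual freeness of the generated unital $*$-subalgebras. $\mathbb{C}_{\langle n\rangle}=\mathbb{C}\langle X_1,\dots,X_n\rangle$ is the ring of noncommutative polynomials, with partial cyclic derivatives the linear maps $\delta_j$ with $\delta_j1=0$, $\delta_jX_{i_1}\cdots X_{i_p}=\sum_{k:\,i_k=j}X_{i_{k+1}}\cdots X_{i_p}X_{i_1}\cdots X_{i_{k-1}}$, and $\delta P=(\delta_jP)_{1\le j\le n}$; $\delta\mathbb{C}_{\langle n\rangle}(Y)=\{((\delta_jP)(Y))_{j}:P\in\mathbb{C}_{\langle n\rangle}\}$. Let $(M,\tau),(N,\nu)$ be von Neumann algebras with normal faithful trace-states. A (Fréchet) differentiable map $f:\Omega\to\mathbb{R}$, $\Omega\subset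 M_h^n$ norm-open, is $\mathbb{R}$-cyclomorphic if for every $Y\in\Omega$ there is $T\in(L^1(M_h,\tau))^n$ in the $L^1$-norm closure of $\delta\mathbb{C}_{\langle n\rangle}(Y)\cap M_h^n$ such that $df[Y](K_1,\dots,K_n)=\sum_j\tau(T_jK_j)$ for all $K\in M_h^n$. A differentiable map $F:\Omega\to N_h^p$ is $\mathbb{R}$-cyclomorphic if for every $\mathbb{R}$-cyclomorphic map $f:\omega\to\mathbb{R}$, $\omega\subset N_h^p$ norm-open, the map $f\circ F:\Omega\cap F^{-1}(\omega)\to\mathbb{R}$ is $\mathbb{R}$-cyclomorphic. *)

theory Defs
  imports "HOL-Analysis.Analysis" "HOL-Library.Poly_Mapping"
begin

section \<open>Complex Hilbert spaces and their bounded operators\<close>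

text \<open>
  The norm and the real inner product are those of the underlying real Hilbert space.
  The complex inner product is linear in its first argument.
\<close>

class complex_hilbert_space = real_inner + complete_space +
  fixes scaleC :: "complex \<Rightarrow> 'a \<Rightarrow> 'a"  (infixr "*\<^sub>C" 75)
    and cinner :: "'a \<Rightarrow> 'a \<Rightarrow> complex"
  assumes scaleC_add_right: "c *\<^sub>C (x + y) = c *\<^sub>C x + c *\<^sub>C y"
    and scaleC_add_left: "(c + d) *\<^sub>C x = c *\<^sub>C x + d *\<^sub>C x"
    and scaleC_scaleC: "c *\<^sub>C d *\<^sub>C x = (c * d) *\<^sub>C x"
    and scaleR_scaleC: "r *\<^sub>R x = complex_of_real r *\<^sub>C x"
    and cinner_commute: "cinner x y = cnj (cinner y x)"
    and cinner_add_left: "cinner (x + y) z = cinner x z + cinner y z"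
    and cinner_scaleC_left: "cinner (c *\<^sub>C x) y = c * cinner x y"
    and inner_eq_Re_cinner: "x \<bullet> y = Re (cinner x y)"

text \<open>
  The type below contains all bounded \<^emph>\<open>real\<close>-linear operators; the elements of
  \<open>B(H)\<close> are those satisfying \<open>complex_linear\<close>.
\<close>

type_synonym 'h op = "'h \<Rightarrow>\<^sub>L 'h"

definition complex_linear :: "'h::complex_hilbert_space op \<Rightarrow> bool" where
  "complex_linear T \<longleftrightarrow>
     (\<forall>c x. blinfun_apply T (c *\<^sub>C x) = c *\<^sub>C blinfun_apply T x)"

definition op_scaleC :: "complex \<Rightarrow> 'h::complex_hilbert_space op \<Rightarrow> 'h op" where
  "op_scaleC c T = Blinfun (\<lambda>x. c *\<^sub>C blinfun_apply T x)"

definition op_adjoint :: "'h::complex_hilbert_space op \<Rightarrow> 'h op" where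
  "op_adjoint T =
     (THE S. \<forall>x y. cinner (blinfun_apply T x) y = cinner x (blinfun_apply S y))"

definition positive_op :: "'h::complex_hilbert_space op \<Rightarrow> bool" where
  "positive_op T \<longleftrightarrow>
     complex_linear T \<and> (\<forall>x. cinner (blinfun_apply T x) x \<in> \<real>\<^sub>\<ge>\<^sub>0)"

text \<open>The absolute value \<open>|T| = (T\<^sup>* T)\<^bsup>1/2\<^esup>\<close>.\<close>

definition op_abs :: "'h::complex_hilbert_space op \<Rightarrow> 'h op" where
  "op_abs T = (THE P. positive_op P \<and> P o\<^sub>L P = op_adjoint T o\<^sub>L T)"


section \<open>Von Neumann algebras with normal faithful trace-states\<close>

definition commutant :: "'h::complex_hilbert_space op set \<Rightarrow> 'h op set" where
  "commutant M = {T. complex_linear T \<and> (\<forall>S\<in>M. T o\<^sub>L S = S o\<^sub>L T)}"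

text \<open>
  Equality with the bicommutant makes \<open>M\<close> a subalgebra of \<open>B(H)\<close> containing the identity
  operator, which is therefore the common unit of all von Neumann algebras on \<open>H\<close>.
\<close>

definition von_neumann_algebra :: "'h::complex_hilbert_space op set \<Rightarrow> bool" where
  "von_neumann_algebra M \<longleftrightarrow>
     (\<forall>T\<in>M. op_adjoint T \<in> M) \<and> commutant (commutant M) = M"

definition hermitian_part :: "'h::complex_hilbert_space op set \<Rightarrow> 'h op set" where
  "hermitian_part M = {T\<in>M. op_adjoint T = T}"

definition state_on :: "'h::complex_hilbert_space op set \<Rightarrow> ('h op \<Rightarrow> complex) \<Rightarrow> bool" where
  "state_on M \<tau> \<longleftrightarrow>
     (\<forall>S\<in>M. \<forall>T\<in>M. \<tau> (S + T) = \<tau> S + \<tau> T) \<and>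
     (\<forall>c. \<forall>T\<in>M. \<tau> (op_scaleC c T) = c * \<tau> T) \<and>
     (\<forall>T\<in>M. \<tau> (op_adjoint T o\<^sub>L T) \<in> \<real>\<^sub>\<ge>\<^sub>0) \<and>
     \<tau> id_blinfun = 1"

definition tracial_on :: "'h::complex_hilbert_space op set \<Rightarrow> ('h op \<Rightarrow> complex) \<Rightarrow> bool" where
  "tracial_on M \<tau> \<longleftrightarrow> (\<forall>S\<in>M. \<forall>T\<in>M. \<tau> (S o\<^sub>L T) = \<tau> (T o\<^sub>L S))"

definition faithful_on :: "'h::complex_hilbert_space op set \<Rightarrow> ('h op \<Rightarrow> complex) \<Rightarrow> bool" where
  "faithful_on M \<tau> \<longleftrightarrow> (\<forall>T\<in>M. \<tau> (op_adjoint T o\<^sub>L T) = 0 \<longrightarrow> T = 0)"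

text \<open>
  Normality: whenever an upward directed set of positive elements has a least upper bound
  (for the operator order \<open>S \<le> T\<close> iff \<open>T - S\<close> is positive) in \<open>M\<close>, the state
  preserves it.
\<close>

definition normal_on :: "'h::complex_hilbert_space op set \<Rightarrow> ('h op \<Rightarrow> complex) \<Rightarrow> bool" where
  "normal_on M \<tau> \<longleftrightarrow>
     (\<forall>D T. D \<noteq> {} \<and> D \<subseteq> {S\<in>M. positive_op S} \<and>
        (\<forall>R\<in>D. \<forall>S\<in>D. \<exists>U\<in>D. positive_op (U - R) \<and> positive_op (U - S)) \<and>
        T \<in> M \<and> (\<forall>S\<in>D. positive_op (T - S)) \<and>
        (\<forall>U\<in>M. (\<forall>S\<in>D. positive_op (U - S)) \<longrightarrow> positive_op (U - T))
        \<longrightarrow> Re (\<tau> T) = (SUP S\<in>D. Re (\<tau> S)))"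

definition tracial_von_neumann_algebra ::
    "'h::complex_hilbert_space op set \<Rightarrow> ('h op \<Rightarrow> complex) \<Rightarrow> bool" where
  "tracial_von_neumann_algebra M \<tau> \<longleftrightarrow>
     von_neumann_algebra M \<and>
     state_on M \<tau> \<and> tracial_on M \<tau> \<and> faithful_on M \<tau> \<and> normal_on M \<tau>"


section \<open>Independence and freeness\<close>

definition unital_subalgebra :: "'h::complex_hilbert_space op set \<Rightarrow> bool" where
  "unital_subalgebra S \<longleftrightarrow> id_blinfun \<in> S \<and>
     (\<forall>T\<in>S. \<forall>U\<in>S. T + U \<in> S \<and> T o\<^sub>L U \<in> S) \<and> (\<forall>c. \<forall>T\<in>S. op_scaleC c T \<in> S)"

definition unital_star_subalgebra :: "'h::complex_hilbert_space op set \<Rightarrow> bool" where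
  "unital_star_subalgebra S \<longleftrightarrow> unital_subalgebra S \<and> (\<forall>T\<in>S. op_adjoint T \<in> S)"

definition independent_in ::
    "('h::complex_hilbert_space op \<Rightarrow> complex) \<Rightarrow> 'h op set \<Rightarrow> 'h op set \<Rightarrow> bool" where
  "independent_in \<beta> S T \<longleftrightarrow>
     (\<forall>b\<^sub>1 \<in> unital_subalgebra hull S. \<forall>b\<^sub>2 \<in> unital_subalgebra hull T.
        b\<^sub>1 o\<^sub>L b\<^sub>2 = b\<^sub>2 o\<^sub>L b\<^sub>1 \<and> \<beta> (b\<^sub>1 o\<^sub>L b\<^sub>2) = \<beta> b\<^sub>1 * \<beta> b\<^sub>2)"

definition op_prod :: "'h::complex_hilbert_space op list \<Rightarrow> 'h op" where
  "op_prod xs = foldr (o\<^sub>L) xs id_blinfun"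

text \<open>
  A pair \<open>(i, b)\<close> in the list below is a factor \<open>b\<close> taken from the first (\<open>i = True\<close>)
  or the second (\<open>i = False\<close>) generated subalgebra; neighbouring factors alternate.
\<close>

definition free_in ::
    "('h::complex_hilbert_space op \<Rightarrow> complex) \<Rightarrow> 'h op set \<Rightarrow> 'h op set \<Rightarrow> bool" where
  "free_in \<beta> S T \<longleftrightarrow>
     (\<forall>bs :: (bool \<times> 'h op) list.
        bs \<noteq> [] \<and> successively (\<lambda>p q. fst p \<noteq> fst q) bs \<and>
        (\<forall>(i, b) \<in> set bs. b \<in> unital_star_subalgebra hull (if i then S else T) \<and> \<beta> b = 0)
        \<longrightarrow> \<beta> (op_prod (map snd bs)) = 0)"


section \<open>Noncommutative polynomials and cyclic derivatives\<close>

text \<open>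
  The indeterminates are indexed by the finite type \<open>'n\<close>; a polynomial is a finitely
  supported family of coefficients indexed by words.  Only the linear structure is needed,
  since evaluation and the partial cyclic derivatives are linear and given on words.
\<close>

type_synonym 'n ncpoly = "'n list \<Rightarrow>\<^sub>0 complex"

definition cyclic_deriv :: "'n \<Rightarrow> 'n ncpoly \<Rightarrow> 'n ncpoly" where
  "cyclic_deriv j P =
     (\<Sum>w\<in>Poly_Mapping.keys P. \<Sum>k | k < length w \<and> w ! k = j.
        Poly_Mapping.single (drop (Suc k) w @ take k w) (Poly_Mapping.lookup P w))"

definition nc_eval :: "'h::complex_hilbert_space op ^ 'n \<Rightarrow> 'n ncpoly \<Rightarrow> 'h op" where
  "nc_eval Y P =
     (\<Sum>w\<in>Poly_Mapping.keys P.
        op_scaleC (Poly_Mapping.lookup P w) (op_prod (map (\<lambda>i. Y $ i) w)))"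

definition cyclic_gradients ::
    "'h::complex_hilbert_space op ^ 'n \<Rightarrow> ('h op ^ 'n) set" where
  "cyclic_gradients Y = range (\<lambda>P. \<chi> j. nc_eval Y (cyclic_deriv j P))"


section \<open>The space \<open>L\<^sup>1\<close>\<close>

text \<open>
  \<open>L1_space S \<tau>\<close> is the completion of \<open>S\<close> in the norm \<open>\<tau>(|x|)\<close>, as the set of
  equivalence classes of Cauchy sequences modulo null sequences.
\<close>

definition L1_norm :: "('h::complex_hilbert_space op \<Rightarrow> complex) \<Rightarrow> 'h op \<Rightarrow> real" where
  "L1_norm \<tau> x = Re (\<tau> (op_abs x))"

definition L1_Cauchy ::
    "'h::complex_hilbert_space op set \<Rightarrow> ('h op \<Rightarrow> complex) \<Rightarrow> (nat \<Rightarrow> 'h op) set" where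
  "L1_Cauchy S \<tau> = {X. range X \<subseteq> S \<and>
     (\<forall>e>0. \<exists>N. \<forall>i\<ge>N. \<forall>j\<ge>N. L1_norm \<tau> (X i - X j) < e)}"

definition L1_equiv ::
    "'h::complex_hilbert_space op set \<Rightarrow> ('h op \<Rightarrow> complex) \<Rightarrow>
       ((nat \<Rightarrow> 'h op) \<times> (nat \<Rightarrow> 'h op)) set" where
  "L1_equiv S \<tau> = {(X, X'). X \<in> L1_Cauchy S \<tau> \<and> X' \<in> L1_Cauchy S \<tau> \<and>
     (\<lambda>k. L1_norm \<tau> (X k - X' k)) \<longlonglongrightarrow> 0}"

definition L1_space ::
    "'h::complex_hilbert_space op set \<Rightarrow> ('h op \<Rightarrow> complex) \<Rightarrow> (nat \<Rightarrow> 'h op) set set" where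
  "L1_space S \<tau> = L1_Cauchy S \<tau> // L1_equiv S \<tau>"

definition L1_embed ::
    "'h::complex_hilbert_space op set \<Rightarrow> ('h op \<Rightarrow> complex) \<Rightarrow> 'h op \<Rightarrow> (nat \<Rightarrow> 'h op) set" where
  "L1_embed S \<tau> x = L1_equiv S \<tau> `` {\<lambda>_. x}"

definition L1_dist ::
    "('h::complex_hilbert_space op \<Rightarrow> complex) \<Rightarrow>
       (nat \<Rightarrow> 'h op) set \<Rightarrow> (nat \<Rightarrow> 'h op) set \<Rightarrow> real" where
  "L1_dist \<tau> T T' = lim (\<lambda>k. L1_norm \<tau> ((SOME X. X \<in> T) k - (SOME X. X \<in> T') k))"

text \<open>The extension of \<open>(x, K) \<mapsto> \<tau>(x K)\<close> to \<open>x\<close> in the completion.\<close>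

definition L1_trace ::
    "('h::complex_hilbert_space op \<Rightarrow> complex) \<Rightarrow> (nat \<Rightarrow> 'h op) set \<Rightarrow> 'h op \<Rightarrow> complex" where
  "L1_trace \<tau> T K = lim (\<lambda>k. \<tau> ((SOME X. X \<in> T) k o\<^sub>L K))"

definition L1_closure ::
    "'h::complex_hilbert_space op set \<Rightarrow> ('h op \<Rightarrow> complex) \<Rightarrow> ('h op ^ 'n) set \<Rightarrow>
       ((nat \<Rightarrow> 'h op) set ^ 'n) set" where
  "L1_closure S \<tau> G = {T. (\<forall>j. T $ j \<in> L1_space S \<tau>) \<and>
     (\<forall>e>0. \<exists>g\<in>G. (\<Sum>j\<in>UNIV. L1_dist \<tau> (T $ j) (L1_embed S \<tau> (g $ j))) < e)}"


section \<open>Cyclomorphic maps\<close>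

definition hermitian_tuples :: "'h::complex_hilbert_space op set \<Rightarrow> ('h op ^ 'n) set" where
  "hermitian_tuples M = {Y. \<forall>j. Y $ j \<in> hermitian_part M}"

text \<open>
  \<open>D\<close> is the Frechet derivative at \<open>Y\<close> of \<open>F\<close>, where \<open>F\<close> is defined on a relatively open
  subset \<open>\<Omega>\<close> of the linear subspace \<open>V\<close>.  In contrast to \<open>has_derivative\<close>, the derivative
  is only required to be linear and bounded on \<open>V\<close>: for a vector-valued map it need not
  extend to a bounded linear map on the ambient space.
\<close>

definition frechet_derivative_in ::
    "'a::real_normed_vector set \<Rightarrow> 'a set \<Rightarrow> ('a \<Rightarrow> 'b::real_normed_vector) \<Rightarrow>
       ('a \<Rightarrow> 'b) \<Rightarrow> 'a \<Rightarrow> bool" where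
  "frechet_derivative_in V \<Omega> F D Y \<longleftrightarrow>
     (\<forall>K\<in>V. \<forall>L\<in>V. D (K + L) = D K + D L) \<and>
     (\<forall>r. \<forall>K\<in>V. D (r *\<^sub>R K) = r *\<^sub>R D K) \<and>
     (\<exists>C. \<forall>K\<in>V. norm (D K) \<le> C * norm K) \<and>
     ((\<lambda>X. (F X - F Y - D (X - Y)) /\<^sub>R norm (X - Y)) \<longlongrightarrow> 0) (at Y within \<Omega>)"

definition cyclomorphic_function ::
    "'h::complex_hilbert_space op set \<Rightarrow> ('h op \<Rightarrow> complex) \<Rightarrow>
       ('h op ^ 'n) set \<Rightarrow> ('h op ^ 'n \<Rightarrow> real) \<Rightarrow> bool" where
  "cyclomorphic_function M \<tau> \<Omega> f \<longleftrightarrow>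
     openin (top_of_set (hermitian_tuples M)) \<Omega> \<and>
     (\<forall>Y\<in>\<Omega>. \<exists>D. frechet_derivative_in (hermitian_tuples M) \<Omega> f D Y \<and>
        (\<exists>T \<in> L1_closure (hermitian_part M) \<tau> (cyclic_gradients Y \<inter> hermitian_tuples M).
           \<forall>K\<in>hermitian_tuples M.
             complex_of_real (D K) = (\<Sum>j\<in>UNIV. L1_trace \<tau> (T $ j) (K $ j))))"

definition cyclomorphic_map ::
    "'h::complex_hilbert_space op set \<Rightarrow> ('h op \<Rightarrow> complex) \<Rightarrow>
     'k::complex_hilbert_space op set \<Rightarrow> ('k op \<Rightarrow> complex) \<Rightarrow>
       ('h op ^ 'n) set \<Rightarrow> ('h op ^ 'n \<Rightarrow> 'k op ^ 'p) \<Rightarrow> bool" where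
  "cyclomorphic_map M \<tau> N \<nu> \<Omega> F \<longleftrightarrow>
     openin (top_of_set (hermitian_tuples M)) \<Omega> \<and>
     F ` \<Omega> \<subseteq> hermitian_tuples N \<and>
     (\<forall>Y\<in>\<Omega>. \<exists>D. frechet_derivative_in (hermitian_tuples M) \<Omega> F D Y) \<and>
     (\<forall>\<omega> f. cyclomorphic_function N \<nu> \<omega> f \<longrightarrow>
        cyclomorphic_function M \<tau> (\<Omega> \<inter> F -` \<omega>) (f \<circ> F))"

definition append_tuple :: "'a ^ 'm \<Rightarrow> 'a ^ 'n \<Rightarrow> 'a ^ ('n + 'm)" where
  "append_tuple Z Y = (\<chi> k. case k of Inl i \<Rightarrow> Y $ i | Inr j \<Rightarrow> Z $ j)"

end

theory Submission
  imports Defs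
begin

text \<open>
  The set of functions \<open>\<phi>\<close> on \<open>A\<^sup>n\<close> whose derivative at a fixed \<open>Y\<close> is
  \<open>K \<mapsto> \<Sum>\<^sub>j \<beta>((\<delta>\<^sub>j Q)(Y) K\<^sub>j)\<close> for some polynomial \<open>Q\<close> is an algebra which, by traciality,
  contains \<open>X \<mapsto> \<beta>(w(X))\<close> for every word \<open>w\<close>.  Independence or freeness expresses the mixed
  traces \<open>X \<mapsto> \<beta>(P(X, Z))\<close> through such functions.  Differentiating, the conditional expectations
  onto \<open>A\<close> of the first \<open>n\<close> entries of the cyclic gradient \<open>(\<delta>P)(Y, Z)\<close> form a cyclic gradient
  \<open>(\<delta>Q)(Y)\<close>.  Conditional expectation contracts the \<open>L\<^sup>1\<close>-norm, because
  \<open>\<tau>(|x|) = sup \<tau>(x K)\<close> over the hermitian \<open>K\<close> in the unit ball, and so the statement survives the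
  passage to \<open>L\<^sup>1\<close>-closures.
\<close>

section \<open>Complex Hilbert spaces and adjoints\<close>

text \<open>The derivative of \<open>f \<circ> append_tuple Z\<close> at Y in direction K is that of
  f at (Y, Z) in direction (K, 0), so only the first n entries of a gradient matter, and only
  through their traces against A. The difficulty is that one polynomial Q has to serve all n entries
  at once. Taking the conditional expectation of each word in each entry separately would give
  expressions in Y with traces as coefficients and no evident reason to form a cyclic gradient.
  Hence the scalar function X \<mapsto> \<beta>(P(X, Z)) is rewritten first and differentiated
  afterwards, which yields a single Q for all directions. Y is fixed because the coefficients in the
  rewriting vary with X; the product rule at Y turns their values into constants of Q. No
  conditional expectation is constructed as a map: h stands for that of g when \<beta>(h K) =
  \<beta>(g K) for all K in A, and faithfulness makes such an h hermitian if g is. For the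
  contraction, the K that nearly attains the norm of x is found in the bicommutant of x, hence in A
  if x is; this is why square roots and inverses are built with control of commutation.\<close>

instance complex_hilbert_space \<subseteq> banach ..

lemma cinner_add_right:
  "cinner (x::'a::complex_hilbert_space) (y + z) = cinner x y + cinner x z"
  by (metis cinner_add_left cinner_commute complex_cnj_add)

lemma cinner_scaleC_right:
  "cinner (x::'a::complex_hilbert_space) (c *\<^sub>C y) = cnj c * cinner x y"
  by (metis cinner_scaleC_left cinner_commute complex_cnj_mult)

lemma scaleC_zero_left [simp]: "0 *\<^sub>C (x::'a::complex_hilbert_space) = 0"
  using scaleR_scaleC[of 0 x] by simp

lemma scaleC_minus_left: "(- c) *\<^sub>C x = - (c *\<^sub>C (x::'a::complex_hilbert_space))"
  using scaleC_add_left[of c "- c" x] by (simp add: add_eq_0_iff)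

lemma cinner_self: "cinner (x::'a::complex_hilbert_space) x = complex_of_real ((norm x)\<^sup>2)"
proof (rule complex_eqI)
  show "Re (cinner x x) = Re (complex_of_real ((norm x)\<^sup>2))"
    by (simp add: inner_eq_Re_cinner[symmetric] power2_norm_eq_inner)
  have "Im (cinner x x) = - Im (cinner x x)"
    using arg_cong[OF cinner_commute[of x x], of Im] by simp
  then show "Im (cinner x x) = Im (complex_of_real ((norm x)\<^sup>2))"
    by simp
qed

lemma cinner_diff_left:
  "cinner ((x::'a::complex_hilbert_space) - y) z = cinner x z - cinner y z"
  by (metis add_diff_cancel_right' cinner_add_left diff_add_cancel)

lemma cinner_diff_right:
  "cinner (x::'a::complex_hilbert_space) (y - z) = cinner x y - cinner x z"
  by (metis add_diff_cancel_right' cinner_add_right diff_add_cancel)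

text \<open>Antilinearity in the second argument turns the imaginary part into a real inner product.
  Complex identities can thus be checked on the real inner product alone.\<close>

lemma cinner_eq_Complex: "cinner (x::'a::complex_hilbert_space) y = Complex (x \<bullet> y) (x \<bullet> (\<i> *\<^sub>C y))"
  by (rule complex_eqI) (simp_all add: inner_eq_Re_cinner cinner_scaleC_right)

lemma norm_scaleC: "norm (c *\<^sub>C (x::'a::complex_hilbert_space)) = cmod c * norm x"
proof -
  have "complex_of_real ((norm (c *\<^sub>C x))\<^sup>2) = c * cnj c * cinner x x"
    by (simp only: cinner_self[symmetric] cinner_scaleC_left cinner_scaleC_right) (simp add: mult_ac)
  also have "\<dots> = complex_of_real ((cmod c * norm x)\<^sup>2)"
    by (simp add: cinner_self complex_norm_square power_mult_distrib del: complex_cnj_mult)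
      (metis complex_norm_square of_real_power)
  finally have "(norm (c *\<^sub>C x))\<^sup>2 = (cmod c * norm x)\<^sup>2"
    using of_real_eq_iff by blast
  then show ?thesis
    by simp
qed

lemma scaleC_scaleR_commute:
  "c *\<^sub>C (r *\<^sub>R (x::'a::complex_hilbert_space)) = r *\<^sub>R (c *\<^sub>C x)"
  by (simp add: scaleR_scaleC scaleC_scaleC mult.commute)

lemma bounded_linear_scaleC: "bounded_linear (\<lambda>x::'a::complex_hilbert_space. c *\<^sub>C x)"
  by (rule bounded_linear_intro[where K="cmod c"])
    (simp_all add: scaleC_add_right scaleC_scaleR_commute norm_scaleC mult.commute)

lemma scaleC_diff_right:
  "c *\<^sub>C (x - y) = c *\<^sub>C x - c *\<^sub>C (y::'a::complex_hilbert_space)"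
  by (rule linear_diff[OF bounded_linear.linear[OF bounded_linear_scaleC]])

lemma scaleC_zero_right [simp]: "c *\<^sub>C (0::'a::complex_hilbert_space) = 0"
  by (rule linear_0[OF bounded_linear.linear[OF bounded_linear_scaleC]])

lemma scaleC_one [simp]: "1 *\<^sub>C (x::'a::complex_hilbert_space) = x"
  using scaleR_scaleC[of 1 x] by simp

lemma cinner_ext:
  assumes "\<And>z. cinner x z = cinner (y::'a::complex_hilbert_space) z"
  shows "x = y"
proof -
  have "(x - y) \<bullet> (x - y) = 0"
    using assms by (metis inner_diff_left inner_eq_Re_cinner cancel_comm_monoid_add_class.diff_cancel)
  then show ?thesis
    by simp
qed

text \<open>The representing vector minimises \<open>|x|\<^sup>2 - 2 f x\<close>; minimising sequences are Cauchy by the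
  parallelogram law.\<close>

lemma riesz_representation:
  fixes f :: "'a::{real_inner, banach} \<Rightarrow> real"
  assumes "bounded_linear f"
  obtains y where "\<And>x. f x = x \<bullet> y"
proof -
  interpret f: bounded_linear f by fact
  define g where "g x = (norm x)\<^sup>2 - 2 * f x" for x
  obtain K where K: "\<And>x. \<bar>f x\<bar> \<le> norm x * K"
    using f.bounded by auto
  have lower: "g x \<ge> - K\<^sup>2" for x
  proof -
    have "g x \<ge> (norm x)\<^sup>2 - 2 * (norm x * K)"
      using K[of x] unfolding g_def by linarith
    moreover have "0 \<le> (norm x - K)\<^sup>2"
      by simp
    ultimately show ?thesis
      by (simp add: power2_diff)
  qed
  define m where "m = (INF x. g x)"
  have bdd: "bdd_below (range g)"
    by (rule bdd_belowI[where m="- K\<^sup>2"]) (use lower in auto)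
  have m_le: "m \<le> g x" for x
    unfolding m_def by (rule cINF_lower[OF bdd]) simp
  have "\<exists>x. g x < m + e" if "e > 0" for e
    using cInf_lessD[of "range g" "m + e"] that unfolding m_def by auto
  then have "\<exists>x. g x < m + 1 / real (Suc n)" for n
    by simp
  then obtain X where X: "\<And>n. g (X n) < m + 1 / real (Suc n)"
    by metis
  have par: "(norm (x - y))\<^sup>2 = 2 * g x + 2 * g y - 4 * g ((1/2) *\<^sub>R (x + y))" for x y
    unfolding g_def by (simp add: f.add f.scaleR power2_norm_eq_inner inner_add inner_diff
        inner_commute algebra_simps)
  have dist: "(norm (X i - X j))\<^sup>2 < 2 / real (Suc i) + 2 / real (Suc j)" for i j
    using par[of "X i" "X j"] X[of i] X[of j] m_le[of "(1/2) *\<^sub>R (X i + X j)"] by linarith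
  have "Cauchy X"
  proof (rule CauchyI)
    fix e :: real assume e: "0 < e"
    obtain N where N: "4 / e\<^sup>2 < real N"
      using reals_Archimedean2 by blast
    have "norm (X i - X j) < e" if "i \<ge> N" "j \<ge> N" for i j
    proof -
      have "N > 0"
        using N e by (metis divide_nonneg_nonneg le_numeral_extra(3) less_le_not_le of_nat_0
            order_less_le_trans zero_le_numeral zero_le_power2 gr0I)
      then have "2 / real (Suc i) \<le> 2 / real N" "2 / real (Suc j) \<le> 2 / real N"
        using that by (auto intro!: divide_left_mono)
      moreover have "4 / real N < e\<^sup>2"
        using N e \<open>N > 0\<close> by (simp add: field_simps)
      ultimately have "(norm (X i - X j))\<^sup>2 < e\<^sup>2"
        using dist[of i j] by linarith
      then show ?thesis
        using e by (simp add: power_less_imp_less_base)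
    qed
    then show "\<exists>M. \<forall>i\<ge>M. \<forall>j\<ge>M. norm (X i - X j) < e"
      by blast
  qed
  then obtain y where y: "X \<longlonglongrightarrow> y"
    using Cauchy_convergent_iff convergent_def by blast
  have "(\<lambda>n. g (X n)) \<longlonglongrightarrow> g y"
    unfolding g_def by (intro tendsto_intros f.tendsto y)
  moreover have "(\<lambda>n. m + 1 / real (Suc n)) \<longlonglongrightarrow> m + 0"
    by (intro tendsto_intros LIMSEQ_Suc[OF lim_1_over_n])
  ultimately have "g y \<le> m + 0"
    by (rule LIMSEQ_le) (use X less_imp_le in blast)
  then have min: "g y \<le> g x" for x
    using m_le[of x] by simp
  have "f x = x \<bullet> y" for x
  proof (cases "x = 0")
    case False
    \<comment> \<open>This t minimises the quadratic polynomial
      \<open>t \<mapsto> g (y + t *\<^sub>R x)\<close>; minimality at t = 0 then forces its linear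
      coefficient to vanish.\<close>
    define t where "t = (f x - x \<bullet> y) / (x \<bullet> x)"
    have "g (y + t *\<^sub>R x) = g y + t\<^sup>2 * (x \<bullet> x) - 2 * t * (f x - x \<bullet> y)"
      unfolding g_def by (simp add: f.add f.scaleR power2_norm_eq_inner inner_add inner_commute
          power2_eq_square[of t] algebra_simps)
    moreover have "t\<^sup>2 * (x \<bullet> x) = t * (f x - x \<bullet> y)"
      using False by (simp add: t_def power2_eq_square)
    ultimately have "t * (f x - x \<bullet> y) \<le> 0"
      using min[of "y + t *\<^sub>R x"] by linarith
    then have "(f x - x \<bullet> y)\<^sup>2 / (x \<bullet> x) \<le> 0"
      by (simp add: t_def power2_eq_square)
    then show ?thesis
      using False by (simp add: divide_le_0_iff) (metis inner_gt_zero_iff not_le)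
  qed simp
  then show ?thesis
    using that by blast
qed

section \<open>Complex-linear operators and their adjoints\<close>

lemma complex_linearD:
  "complex_linear T \<Longrightarrow> blinfun_apply T (c *\<^sub>C x) = c *\<^sub>C blinfun_apply T x"
  by (simp add: complex_linear_def)

lemma op_scaleC_apply [simp]: "blinfun_apply (op_scaleC c T) x = c *\<^sub>C blinfun_apply T x"
  unfolding op_scaleC_def
  by (subst bounded_linear_Blinfun_apply)
    (auto intro: bounded_linear_compose[OF bounded_linear_scaleC] blinfun.bounded_linear_right)

text \<open>Riesz representation applies to the real functionals
  \<open>x \<mapsto> T x \<bullet> y\<close> and yields a real adjoint. Its defining identity at
  \<open>\<i> *\<^sub>C x\<close>, with T complex-linear, supplies the missing imaginary
  part.\<close>

lemma op_adjoint_ex: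
  fixes T :: "'h::complex_hilbert_space op"
  assumes "complex_linear T"
  obtains S :: "'h op" where "complex_linear S"
    "\<And>x y. cinner (blinfun_apply T x) y = cinner x (blinfun_apply S y)"
proof -
  have "\<exists>z. \<forall>x. blinfun_apply T x \<bullet> y = x \<bullet> z" for y
  proof -
    have "bounded_linear (\<lambda>x. blinfun_apply T x \<bullet> y)"
      by (rule bounded_linear_compose[OF bounded_linear_inner_left blinfun.bounded_linear_right])
    from riesz_representation[OF this] show ?thesis
      by metis
  qed
  then obtain s where s: "\<And>x y. blinfun_apply T x \<bullet> y = x \<bullet> s y"
    by metis
  have ci: "cinner (blinfun_apply T x) y = cinner x (s y)" for x y
  proof (rule complex_eqI)
    show "Re (cinner (blinfun_apply T x) y) = Re (cinner x (s y))"
      using s[of x y] by (simp add: inner_eq_Re_cinner)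
    have "Re (cinner (blinfun_apply T (\<i> *\<^sub>C x)) y) = Re (cinner (\<i> *\<^sub>C x) (s y))"
      using s[of "\<i> *\<^sub>C x" y] by (simp add: inner_eq_Re_cinner)
    then show "Im (cinner (blinfun_apply T x) y) = Im (cinner x (s y))"
      by (simp add: complex_linearD[OF assms] cinner_scaleC_left)
  qed
  have ext: "s y = z" if "\<And>x. cinner (blinfun_apply T x) y = cinner x z" for y z
    by (rule cinner_ext) (metis ci that cinner_commute)
  have add: "s (x + y) = s x + s y" for x y
    by (rule ext) (simp add: cinner_add_right ci)
  have scaleC: "s (c *\<^sub>C x) = c *\<^sub>C s x" for c x
    by (rule ext) (simp add: cinner_scaleC_right ci)
  have bound: "norm (s y) \<le> norm y * norm T" for y
  proof -
    have "(norm (s y))\<^sup>2 = blinfun_apply T (s y) \<bullet> y"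
      by (simp add: power2_norm_eq_inner s)
    also have "\<dots> \<le> norm (blinfun_apply T (s y)) * norm y"
      by (rule norm_cauchy_schwarz)
    also have "\<dots> \<le> norm T * norm (s y) * norm y"
      by (intro mult_right_mono norm_blinfun) simp
    finally have "norm (s y) * norm (s y) \<le> norm (s y) * (norm y * norm T)"
      by (simp add: power2_eq_square mult_ac)
    then show ?thesis
      by (cases "norm (s y) = 0") (auto simp: mult_le_cancel_left_pos)
  qed
  have "bounded_linear s"
    by (rule bounded_linear_intro[OF add _ bound]) (simp add: scaleR_scaleC scaleC)
  then have "blinfun_apply (Blinfun s) = s"
    by (rule bounded_linear_Blinfun_apply)
  with that[of "Blinfun s"] show ?thesis
    by (simp add: complex_linear_def scaleC ci)
qed

lemma op_adjoint_eqI: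
  assumes "\<And>x y. cinner (blinfun_apply T x) y = cinner x (blinfun_apply S y)"
  shows "op_adjoint T = S"
  unfolding op_adjoint_def
proof (rule the_equality)
  fix U assume *: "\<forall>x y. cinner (blinfun_apply T x) y = cinner x (blinfun_apply U y)"
  show "U = S"
    by (rule blinfun_eqI, rule cinner_ext) (metis * assms cinner_commute)
qed (use assms in blast)

lemma op_adjoint:
  assumes "complex_linear T"
  shows "cinner (blinfun_apply T x) y = cinner x (blinfun_apply (op_adjoint T) y)"
  by (rule op_adjoint_ex[OF assms]) (metis op_adjoint_eqI)

lemma complex_linear_adjoint: "complex_linear T \<Longrightarrow> complex_linear (op_adjoint T)"
  by (metis op_adjoint_ex op_adjoint_eqI)

lemma op_adjoint':
  assumes "complex_linear T"
  shows "cinner (blinfun_apply (op_adjoint T) x) y = cinner x (blinfun_apply T y)"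
  by (metis op_adjoint[OF assms] cinner_commute)

lemma complex_linear_id [simp]: "complex_linear id_blinfun"
  and complex_linear_0 [simp]: "complex_linear 0"
  and complex_linear_add: "complex_linear S \<Longrightarrow> complex_linear T \<Longrightarrow> complex_linear (S + T)"
  and complex_linear_diff: "complex_linear S \<Longrightarrow> complex_linear T \<Longrightarrow> complex_linear (S - T)"
  and complex_linear_comp: "complex_linear S \<Longrightarrow> complex_linear T \<Longrightarrow> complex_linear (S o\<^sub>L T)"
  and complex_linear_scaleR: "complex_linear T \<Longrightarrow> complex_linear (r *\<^sub>R T)"
  and complex_linear_scaleC: "complex_linear T \<Longrightarrow> complex_linear (op_scaleC c T)"
  by (simp_all add: complex_linear_def blinfun.bilinear_simps scaleC_add_right scaleC_diff_right
      scaleC_scaleR_commute scaleC_scaleC mult.commute)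

lemma op_adjoint_add:
  "complex_linear S \<Longrightarrow> complex_linear T \<Longrightarrow> op_adjoint (S + T) = op_adjoint S + op_adjoint T"
  by (rule op_adjoint_eqI) (simp add: op_adjoint blinfun.bilinear_simps cinner_add_left cinner_add_right)

lemma op_adjoint_comp:
  "complex_linear S \<Longrightarrow> complex_linear T \<Longrightarrow> op_adjoint (S o\<^sub>L T) = op_adjoint T o\<^sub>L op_adjoint S"
  by (rule op_adjoint_eqI) (simp add: op_adjoint)

lemma op_adjoint_scaleC:
  "complex_linear T \<Longrightarrow> op_adjoint (op_scaleC c T) = op_scaleC (cnj c) (op_adjoint T)"
  by (rule op_adjoint_eqI) (simp add: op_adjoint cinner_scaleC_left cinner_scaleC_right)

lemma op_adjoint_adjoint: "complex_linear T \<Longrightarrow> op_adjoint (op_adjoint T) = T"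
  by (rule op_adjoint_eqI) (simp add: op_adjoint')

lemma op_scaleC_of_real: "op_scaleC (complex_of_real r) T = r *\<^sub>R T"
  by (rule blinfun_eqI) (simp add: scaleR_scaleC blinfun.bilinear_simps)

lemma op_adjoint_scaleR: "complex_linear T \<Longrightarrow> op_adjoint (r *\<^sub>R T) = r *\<^sub>R op_adjoint T"
  using op_adjoint_scaleC[of T "complex_of_real r"] by (simp add: op_scaleC_of_real)

lemma op_adjoint_diff:
  "complex_linear S \<Longrightarrow> complex_linear T \<Longrightarrow> op_adjoint (S - T) = op_adjoint S - op_adjoint T"
  by (rule op_adjoint_eqI) (simp add: op_adjoint blinfun.bilinear_simps cinner_diff_left cinner_diff_right)

lemma norm_op_adjoint_le: "complex_linear T \<Longrightarrow> norm (op_adjoint T) \<le> norm T"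
proof (rule norm_blinfun_bound)
  fix y assume T: "complex_linear T"
  let ?s = "blinfun_apply (op_adjoint T) y"
  have "(norm ?s)\<^sup>2 = blinfun_apply T ?s \<bullet> y"
    using op_adjoint[OF T, of ?s y] by (simp add: power2_norm_eq_inner inner_eq_Re_cinner)
  also have "\<dots> \<le> norm (blinfun_apply T ?s) * norm y"
    by (rule norm_cauchy_schwarz)
  also have "\<dots> \<le> norm T * norm ?s * norm y"
    by (intro mult_right_mono norm_blinfun) simp
  finally have "norm ?s * norm ?s \<le> norm ?s * (norm T * norm y)"
    by (simp add: power2_eq_square mult_ac)
  then show "norm ?s \<le> norm T * norm y"
    by (cases "norm ?s = 0") (auto simp: mult_le_cancel_left_pos)
qed simp

section \<open>Square roots and inverses of positive operators\<close>

lemmas comp_add_left = bounded_bilinear.add_left[OF bounded_bilinear_blinfun_compose]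
  and comp_add_right = bounded_bilinear.add_right[OF bounded_bilinear_blinfun_compose]
  and comp_diff_left = bounded_bilinear.diff_left[OF bounded_bilinear_blinfun_compose]
  and comp_diff_right = bounded_bilinear.diff_right[OF bounded_bilinear_blinfun_compose]
  and comp_scaleR_left = bounded_bilinear.scaleR_left[OF bounded_bilinear_blinfun_compose]
  and comp_scaleR_right = bounded_bilinear.scaleR_right[OF bounded_bilinear_blinfun_compose]

lemmas comp_bilinear = comp_add_left comp_add_right comp_diff_left comp_diff_right
  comp_scaleR_left comp_scaleR_right

lemma comp_zero_left [simp]: "0 o\<^sub>L T = 0"
  by (rule bounded_bilinear.zero_left[OF bounded_bilinear_blinfun_compose])

lemma comp_zero_right [simp]: "T o\<^sub>L 0 = 0"
  by (rule bounded_bilinear.zero_right[OF bounded_bilinear_blinfun_compose])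

lemma comp_assoc: "(R o\<^sub>L S) o\<^sub>L T = R o\<^sub>L (S o\<^sub>L T)"
  by (rule blinfun_eqI) simp

lemma comp_id_left [simp]: "id_blinfun o\<^sub>L T = T"
  and comp_id_right [simp]: "T o\<^sub>L id_blinfun = T"
  by (rule blinfun_eqI, simp)+

text \<open>Complex linearity is part of the notion because the operator type also contains maps
  that are only real-linear, for which the definite description in \<open>op_adjoint\<close> may
  denote nothing.\<close>

definition self_adjoint :: "'h::complex_hilbert_space op \<Rightarrow> bool" where
  "self_adjoint T \<longleftrightarrow> complex_linear T \<and> op_adjoint T = T"

lemma self_adjoint_inner:
  "self_adjoint T \<Longrightarrow> blinfun_apply T x \<bullet> y = x \<bullet> blinfun_apply T y"
  unfolding self_adjoint_def by (metis inner_eq_Re_cinner op_adjoint)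

lemma self_adjointI:
  assumes "complex_linear T" "\<And>x y. blinfun_apply T x \<bullet> y = x \<bullet> blinfun_apply T y"
  shows "self_adjoint T"
  unfolding self_adjoint_def
proof
  show "op_adjoint T = T"
    by (rule op_adjoint_eqI) (simp add: cinner_eq_Complex assms(2) complex_linearD[OF assms(1)])
qed fact

lemma self_adjoint_complex_linear: "self_adjoint T \<Longrightarrow> complex_linear T"
  by (simp add: self_adjoint_def)

lemma self_adjoint_id [simp]: "self_adjoint id_blinfun"
  and self_adjoint_0 [simp]: "self_adjoint 0"
  and self_adjoint_add: "self_adjoint S \<Longrightarrow> self_adjoint T \<Longrightarrow> self_adjoint (S + T)"
  and self_adjoint_diff: "self_adjoint S \<Longrightarrow> self_adjoint T \<Longrightarrow> self_adjoint (S - T)"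
  and self_adjoint_scaleR: "self_adjoint T \<Longrightarrow> self_adjoint (r *\<^sub>R T)"
  by (auto intro!: self_adjointI complex_linear_add complex_linear_diff complex_linear_scaleR
      simp: blinfun.bilinear_simps inner_add inner_diff self_adjoint_inner self_adjoint_complex_linear)

lemma self_adjoint_comp:
  "self_adjoint S \<Longrightarrow> self_adjoint T \<Longrightarrow> S o\<^sub>L T = T o\<^sub>L S \<Longrightarrow> self_adjoint (S o\<^sub>L T)"
  by (simp add: self_adjoint_def complex_linear_comp op_adjoint_comp)

text \<open>A complex-linear operator with real quadratic form is self-adjoint by polarisation:
  \<open>x + y\<close> gives symmetry of the imaginary part, and replacing x by
  \<open>\<i> *\<^sub>C x\<close> carries it to the real part. From here on positivity is a matter
  of the real inner product.\<close>

lemma positive_op_iff: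
  "positive_op T \<longleftrightarrow> self_adjoint T \<and> (\<forall>x. 0 \<le> blinfun_apply T x \<bullet> x)"
proof
  assume "positive_op T"
  then have T: "complex_linear T" and nn: "\<And>x. 0 \<le> Re (cinner (blinfun_apply T x) x)"
    and im: "\<And>x. Im (cinner (blinfun_apply T x) x) = 0"
    by (auto simp: positive_op_def complex_nonneg_Reals_iff)
  have *: "Im (cinner (blinfun_apply T x) y) = Im (cinner x (blinfun_apply T y))" for x y
  proof -
    have "Im (cinner (blinfun_apply T x) y) + Im (cinner (blinfun_apply T y) x) = 0"
      using im[of "x + y"] im[of x] im[of y]
      by (simp add: blinfun.bilinear_simps cinner_add_left cinner_add_right)
    moreover have "Im (cinner (blinfun_apply T y) x) = - Im (cinner x (blinfun_apply T y))"
      using arg_cong[OF cinner_commute, of Im] by simp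
    ultimately show ?thesis
      by simp
  qed
  have "self_adjoint T"
  proof (rule self_adjointI[OF T])
    fix x y
    show "blinfun_apply T x \<bullet> y = x \<bullet> blinfun_apply T y"
      using *[of "\<i> *\<^sub>C x" y]
      by (simp add: complex_linearD[OF T] cinner_scaleC_left inner_eq_Re_cinner)
  qed
  with nn show "self_adjoint T \<and> (\<forall>x. 0 \<le> blinfun_apply T x \<bullet> x)"
    by (simp add: inner_eq_Re_cinner)
next
  assume *: "self_adjoint T \<and> (\<forall>x. 0 \<le> blinfun_apply T x \<bullet> x)"
  have "Im (cinner (blinfun_apply T x) x) = 0" for x
  proof -
    have "cinner (blinfun_apply T x) x = cnj (cinner (blinfun_apply T x) x)"
      using * by (metis cinner_commute op_adjoint self_adjoint_def)
    then show ?thesis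
      by (metis Reals_cnj_iff complex_is_Real_iff)
  qed
  then show "positive_op T"
    using * by (auto simp: positive_op_def complex_nonneg_Reals_iff self_adjoint_complex_linear
        inner_eq_Re_cinner)
qed

lemma positive_op_self_adjoint: "positive_op T \<Longrightarrow> self_adjoint T"
  and positive_op_inner: "positive_op T \<Longrightarrow> 0 \<le> blinfun_apply T x \<bullet> x"
  by (simp_all add: positive_op_iff)

lemma positive_op_scaleR: "positive_op T \<Longrightarrow> 0 \<le> r \<Longrightarrow> positive_op (r *\<^sub>R T)"
  and positive_op_add: "positive_op S \<Longrightarrow> positive_op T \<Longrightarrow> positive_op (S + T)"
  and positive_op_id [simp]: "positive_op id_blinfun"
  by (simp_all add: positive_op_iff self_adjoint_scaleR self_adjoint_add blinfun.bilinear_simps inner_add)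

lemma positive_square: "self_adjoint T \<Longrightarrow> positive_op (T o\<^sub>L T)"
  by (simp add: positive_op_iff self_adjoint_comp) (metis inner_ge_zero self_adjoint_inner)

lemma norm_id_minus_positive:
  assumes "self_adjoint T"
  shows "positive_op (norm T *\<^sub>R id_blinfun - T)"
  unfolding positive_op_iff
proof (intro conjI allI)
  fix x
  have "blinfun_apply T x \<bullet> x \<le> norm (blinfun_apply T x) * norm x"
    by (rule norm_cauchy_schwarz)
  also have "\<dots> \<le> norm T * norm x * norm x"
    by (intro mult_right_mono norm_blinfun) simp
  finally show "0 \<le> blinfun_apply (norm T *\<^sub>R id_blinfun - T) x \<bullet> x"
    by (simp add: blinfun.bilinear_simps inner_diff dot_square_norm power2_eq_square)
qed (simp add: assms self_adjoint_diff self_adjoint_scaleR)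

text \<open>From \<open>T (c - T)\<^sup>2 + (c - T) T\<^sup>2 = c T (c - T)\<close>.\<close>

lemma norm_le_of_positive:
  assumes T: "positive_op T" and cT: "positive_op (c *\<^sub>R id_blinfun - T)" and "0 \<le> c"
  shows "norm T \<le> c"
proof (rule norm_blinfun_bound)
  fix v
  let ?Tv = "blinfun_apply T v"
  note sa = self_adjoint_inner[OF positive_op_self_adjoint[OF T]]
  have le: "blinfun_apply T u \<bullet> u \<le> c * (u \<bullet> u)" for u
    using positive_op_inner[OF cT, of u] by (simp add: blinfun.bilinear_simps inner_diff)
  have "0 \<le> blinfun_apply T (c *\<^sub>R v - ?Tv) \<bullet> (c *\<^sub>R v - ?Tv)"
    by (rule positive_op_inner[OF T])
  also have "\<dots> = c * (c * (?Tv \<bullet> v)) - 2 * c * (?Tv \<bullet> ?Tv) + blinfun_apply T ?Tv \<bullet> ?Tv"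
    by (simp add: blinfun.bilinear_simps inner_diff sa algebra_simps)
  also have "\<dots> \<le> c * (c * (?Tv \<bullet> v)) - c * (?Tv \<bullet> ?Tv)"
    using le[of ?Tv] by simp
  finally have *: "c * (?Tv \<bullet> ?Tv) \<le> c * (c * (?Tv \<bullet> v))"
    by simp
  have "?Tv \<bullet> ?Tv \<le> c * c * (v \<bullet> v)"
  proof (cases "c = 0")
    case True
    \<comment> \<open>For c = 0 the inequality above says nothing. The form of T is then at most 0
      at v and at \<open>T v\<close>, and its value at \<open>v - T v\<close> leaves
      \<open>T v \<bullet> T v \<le> 0\<close>.\<close>
    have "0 \<le> blinfun_apply T (v - ?Tv) \<bullet> (v - ?Tv)"
      by (rule positive_op_inner[OF T])
    also have "\<dots> = ?Tv \<bullet> v - 2 * (?Tv \<bullet> ?Tv) + blinfun_apply T ?Tv \<bullet> ?Tv"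
      by (simp add: blinfun.bilinear_simps inner_diff sa algebra_simps)
    finally show ?thesis
      using le[of ?Tv] le[of v] True by simp
  next
    case False
    then have "?Tv \<bullet> ?Tv \<le> c * (?Tv \<bullet> v)"
      using * \<open>0 \<le> c\<close> by simp
    also have "\<dots> \<le> c * (c * (v \<bullet> v))"
      using le \<open>0 \<le> c\<close> by (intro mult_left_mono)
    finally show ?thesis
      by simp
  qed
  then have "(norm ?Tv)\<^sup>2 \<le> (c * norm v)\<^sup>2"
    by (simp add: power2_norm_eq_inner power_mult_distrib power2_eq_square[of c])
  then show "norm ?Tv \<le> c * norm v"
    using \<open>0 \<le> c\<close> by (auto intro: power2_le_imp_le)
qed fact

text \<open>For self-adjoint a this is a commutative real algebra, closed under norm limits, which
  contains a and lies in every von Neumann algebra containing a. Membership in it plays the part of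
  being a function of a.\<close>

definition sa_bicommutant :: "'h::complex_hilbert_space op \<Rightarrow> 'h op set" where
  "sa_bicommutant a =
     {T. self_adjoint T \<and> (\<forall>S. complex_linear S \<and> S o\<^sub>L a = a o\<^sub>L S \<longrightarrow> S o\<^sub>L T = T o\<^sub>L S)}"

lemma sa_bicommutant_self_adjoint: "T \<in> sa_bicommutant a \<Longrightarrow> self_adjoint T"
  by (simp add: sa_bicommutant_def)

lemma sa_bicommutant_self: "self_adjoint a \<Longrightarrow> a \<in> sa_bicommutant a"
  by (simp add: sa_bicommutant_def)

lemma sa_bicommutant_commute:
  assumes "S \<in> sa_bicommutant a" "T \<in> sa_bicommutant a" "self_adjoint a"
  shows "S o\<^sub>L T = T o\<^sub>L S"
  using assms unfolding sa_bicommutant_def mem_Collect_eq by (metis self_adjoint_complex_linear)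

lemma sa_bicommutant_mono: "b \<in> sa_bicommutant a \<Longrightarrow> sa_bicommutant b \<subseteq> sa_bicommutant a"
  by (auto simp: sa_bicommutant_def)

lemma sa_bicommutant_id [simp]: "id_blinfun \<in> sa_bicommutant a"
  and sa_bicommutant_0 [simp]: "0 \<in> sa_bicommutant a"
  and sa_bicommutant_add:
    "S \<in> sa_bicommutant a \<Longrightarrow> T \<in> sa_bicommutant a \<Longrightarrow> S + T \<in> sa_bicommutant a"
  and sa_bicommutant_diff:
    "S \<in> sa_bicommutant a \<Longrightarrow> T \<in> sa_bicommutant a \<Longrightarrow> S - T \<in> sa_bicommutant a"
  and sa_bicommutant_scaleR: "T \<in> sa_bicommutant a \<Longrightarrow> r *\<^sub>R T \<in> sa_bicommutant a"
  by (auto simp: sa_bicommutant_def comp_bilinear self_adjoint_add self_adjoint_diff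
      self_adjoint_scaleR)

lemma sa_bicommutant_comp:
  assumes "S \<in> sa_bicommutant a" "T \<in> sa_bicommutant a" "self_adjoint a"
  shows "S o\<^sub>L T \<in> sa_bicommutant a"
proof -
  have "U o\<^sub>L (S o\<^sub>L T) = (S o\<^sub>L T) o\<^sub>L U" if "complex_linear U" "U o\<^sub>L a = a o\<^sub>L U" for U
    using that assms(1,2) unfolding sa_bicommutant_def mem_Collect_eq by (metis comp_assoc)
  then show ?thesis
    using assms sa_bicommutant_commute[OF assms]
    by (auto simp: sa_bicommutant_def intro: self_adjoint_comp)
qed

lemma sa_bicommutant_limit:
  assumes "\<And>n. X n \<in> sa_bicommutant a" and lim: "X \<longlonglongrightarrow> T"
  shows "T \<in> sa_bicommutant a"
proof -
  have ap: "(\<lambda>n. blinfun_apply (X n) x) \<longlonglongrightarrow> blinfun_apply T x" for x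
    by (intro tendsto_intros lim)
  have sa: "self_adjoint (X n)" for n
    using assms(1) by (rule sa_bicommutant_self_adjoint)
  have "complex_linear T"
    unfolding complex_linear_def
  proof (intro allI)
    fix c x
    have "(\<lambda>n. blinfun_apply (X n) (c *\<^sub>C x)) \<longlonglongrightarrow> c *\<^sub>C blinfun_apply T x"
      unfolding complex_linearD[OF self_adjoint_complex_linear[OF sa]]
      by (intro bounded_linear.tendsto[OF bounded_linear_scaleC] ap)
    then show "blinfun_apply T (c *\<^sub>C x) = c *\<^sub>C blinfun_apply T x"
      using ap LIMSEQ_unique by blast
  qed
  moreover have "blinfun_apply T x \<bullet> y = x \<bullet> blinfun_apply T y" for x y
  proof -
    have "(\<lambda>n. blinfun_apply (X n) x \<bullet> y) \<longlonglongrightarrow> x \<bullet> blinfun_apply T y"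
      unfolding self_adjoint_inner[OF sa] by (intro tendsto_intros ap)
    moreover have "(\<lambda>n. blinfun_apply (X n) x \<bullet> y) \<longlonglongrightarrow> blinfun_apply T x \<bullet> y"
      by (intro tendsto_intros ap)
    ultimately show ?thesis
      using LIMSEQ_unique by blast
  qed
  moreover have "S o\<^sub>L T = T o\<^sub>L S" if "complex_linear S" "S o\<^sub>L a = a o\<^sub>L S" for S
  proof -
    have "(\<lambda>n. X n o\<^sub>L S) \<longlonglongrightarrow> (T o\<^sub>L S)"
      by (intro bounded_bilinear.tendsto[OF bounded_bilinear_blinfun_compose] lim tendsto_const)
    moreover have "(\<lambda>n. S o\<^sub>L X n) \<longlonglongrightarrow> (S o\<^sub>L T)"
      by (intro bounded_bilinear.tendsto[OF bounded_bilinear_blinfun_compose] lim tendsto_const)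
    moreover have "S o\<^sub>L X n = X n o\<^sub>L S" for n
      using assms(1) that by (simp add: sa_bicommutant_def)
    ultimately show ?thesis
      using LIMSEQ_unique by auto
  qed
  ultimately show ?thesis
    by (auto simp: sa_bicommutant_def intro: self_adjointI)
qed

text \<open>Majorant principle behind both operator iterations below, the one for square roots and
  the Neumann series: telescoping bounds distances in s by distances in t.\<close>

lemma convergent_dominated_increments:
  fixes s :: "nat \<Rightarrow> 'a::banach" and t :: "nat \<Rightarrow> real"
  assumes "convergent t" and inc: "\<And>n. norm (s (Suc n) - s n) \<le> t (Suc n) - t n"
  shows "convergent s"
proof -
  have le: "norm (s n - s m) \<le> t n - t m" if "m \<le> n" for m n
    using that
  proof (induction n rule: dec_induct)
    case (step n)
    have "norm (s (Suc n) - s m) \<le> norm (s (Suc n) - s n) + norm (s n - s m)"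
      using norm_triangle_ineq[of "s (Suc n) - s n" "s n - s m"] by simp
    then show ?case
      using step.IH inc[of n] by linarith
  qed simp
  have "Cauchy s"
  proof (rule CauchyI)
    fix e :: real assume "e > 0"
    then obtain M where M: "\<And>m n. m \<ge> M \<Longrightarrow> n \<ge> M \<Longrightarrow> norm (t m - t n) < e"
      using CauchyD[OF convergent_Cauchy[OF assms(1)]] by blast
    have "norm (s m - s n) < e" if "m \<ge> M" "n \<ge> M" for m n
    proof (cases "m \<le> n")
      case True
      then show ?thesis
        using le[of m n] M[OF that(2,1)] by (simp add: norm_minus_commute)
    next
      case False
      then show ?thesis
        using le[of n m] M[OF that] by simp
    qed
    then show "\<exists>M. \<forall>m\<ge>M. \<forall>n\<ge>M. norm (s m - s n) < e"
      by blast
  qed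
  then show ?thesis
    by (rule Cauchy_convergent)
qed

text \<open>The iteration \<open>s \<mapsto> (b + s\<^sup>2) / 2\<close> with \<open>b = 1 - a\<close> converges to \<open>1 - a\<^bsup>1/2\<^esup>\<close>: its increments are
  dominated by those of the scalar iteration with \<open>b = 1\<close>.\<close>

lemma contraction_sqrt_ex:
  assumes a: "positive_op a" and a1: "positive_op (id_blinfun - a)"
  obtains p where "p \<in> sa_bicommutant a" "positive_op p" "p o\<^sub>L p = a"
proof -
  define b where "b = id_blinfun - a"
  have sa: "self_adjoint a"
    using a by (rule positive_op_self_adjoint)
  have b: "b \<in> sa_bicommutant a"
    unfolding b_def by (intro sa_bicommutant_diff sa_bicommutant_id sa_bicommutant_self sa)
  have nb: "norm b \<le> 1"
    by (rule norm_le_of_positive) (use a a1 in \<open>simp_all add: b_def\<close>)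
  define s where "s = rec_nat 0 (\<lambda>_ s. (1/2) *\<^sub>R (b + (s o\<^sub>L s)))"
  define t :: "nat \<Rightarrow> real" where "t = rec_nat 0 (\<lambda>_ t. (1/2) * (1 + t * t))"
  have s: "s 0 = 0" "\<And>n. s (Suc n) = (1/2) *\<^sub>R (b + (s n o\<^sub>L s n))"
    and t: "t 0 = 0" "\<And>n. t (Suc n) = (1/2) * (1 + t n * t n)"
    by (simp_all add: s_def t_def)
  have s_mem: "s n \<in> sa_bicommutant a" for n
    by (induction n) (auto simp: s intro!: sa_bicommutant_scaleR sa_bicommutant_add b
        sa_bicommutant_comp sa)
  have t01: "0 \<le> t n \<and> t n \<le> 1" for n
    by (induction n) (auto simp: t intro: mult_le_one)
  have t_inc: "t n \<le> t (Suc n)" for n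
    using zero_le_square[of "1 - t n"] by (simp add: t algebra_simps)
  have conv_t: "convergent t"
  proof (rule Bseq_mono_convergent)
    show "Bseq t"
      using t01 by (intro BseqI'[where K=1]) simp
    show "\<forall>m n. m \<le> n \<longrightarrow> t m \<le> t n"
      using lift_Suc_mono_le[of t, OF t_inc] by blast
  qed
  have ns: "norm (s n) \<le> t n" for n
  proof (induction n)
    case (Suc n)
    have "norm (s n o\<^sub>L s n) \<le> norm (s n) * norm (s n)"
      by (rule norm_blinfun_compose)
    also have "\<dots> \<le> t n * t n"
      using Suc t01 by (intro mult_mono) auto
    finally have "norm (b + (s n o\<^sub>L s n)) \<le> 1 + t n * t n"
      using nb norm_triangle_ineq[of b "s n o\<^sub>L s n"] by linarith
    then show ?case
      by (simp add: s t)
  qed (simp add: s t)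
  have inc: "norm (s (Suc n) - s n) \<le> t (Suc n) - t n" for n
  proof (induction n)
    case 0
    then show ?case using nb by (simp add: s t)
  next
    case (Suc n)
    \<comment> \<open>All iterates commute, so the difference of two squares factors; the scalar
      iteration satisfies the same factorisation, which closes the induction.\<close>
    have "s (Suc (Suc n)) - s (Suc n) = (1/2) *\<^sub>R ((s (Suc n) + s n) o\<^sub>L (s (Suc n) - s n))"
      using sa_bicommutant_commute[OF s_mem[of n] s_mem[of "Suc n"] sa]
      by (simp add: s(2)[of "Suc n"] s(2)[of n] comp_add_left comp_diff_right
          flip: scaleR_diff_right)
    then have "norm (s (Suc (Suc n)) - s (Suc n)) \<le> (1/2) * (norm (s (Suc n) + s n) * norm (s (Suc n) - s n))"
      using norm_blinfun_compose[of "s (Suc n) + s n" "s (Suc n) - s n"] by simp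
    also have "\<dots> \<le> (1/2) * ((t (Suc n) + t n) * (t (Suc n) - t n))"
      using Suc norm_triangle_ineq[of "s (Suc n)" "s n"] ns[of n] ns[of "Suc n"] t01
      by (intro mult_left_mono mult_mono) (auto intro: order_trans)
    also have "\<dots> = t (Suc (Suc n)) - t (Suc n)"
      by (simp add: t(2)[of "Suc n"] t(2)[of n] algebra_simps)
    finally show ?case .
  qed
  obtain q where q: "s \<longlonglongrightarrow> q"
    using convergent_dominated_increments[OF conv_t inc] by (auto simp: convergent_def)
  have q_mem: "q \<in> sa_bicommutant a"
    using s_mem q by (rule sa_bicommutant_limit)
  have nq: "norm q \<le> 1"
  proof (rule Lim_norm_ubound[OF _ q])
    have "norm (s n) \<le> 1" for n
      using ns[of n] t01[of n] by linarith
    then show "\<forall>\<^sub>F n in sequentially. norm (s n) \<le> 1"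
      by simp
  qed simp
  have "(\<lambda>n. s (Suc n)) \<longlonglongrightarrow> (1/2) *\<^sub>R (b + (q o\<^sub>L q))"
    unfolding s(2)
    by (intro tendsto_intros bounded_bilinear.tendsto[OF bounded_bilinear_blinfun_compose] q)
  then have "q = (1/2) *\<^sub>R (b + (q o\<^sub>L q))"
    using LIMSEQ_unique LIMSEQ_Suc[OF q] by blast
  then have "2 *\<^sub>R q = 2 *\<^sub>R ((1/2) *\<^sub>R (b + (q o\<^sub>L q)))"
    by (rule arg_cong)
  also have "\<dots> = b + (q o\<^sub>L q)"
    by simp
  finally have fix_q: "2 *\<^sub>R q = b + (q o\<^sub>L q)" .
  show ?thesis
  proof
    show p: "id_blinfun - q \<in> sa_bicommutant a"
      by (intro sa_bicommutant_diff sa_bicommutant_id q_mem)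
    have "positive_op ((1 - norm q) *\<^sub>R id_blinfun + (norm q *\<^sub>R id_blinfun - q))"
      using nq by (intro positive_op_add positive_op_scaleR positive_op_id norm_id_minus_positive
          sa_bicommutant_self_adjoint[OF q_mem]) simp
    then show "positive_op (id_blinfun - q)"
      by (simp add: algebra_simps)
    \<comment> \<open>The fixed point equation \<open>2 q = b + q\<^sup>2\<close> rearranges to
      \<open>(1 - q)\<^sup>2 = 1 - b\<close>.\<close>
    show "(id_blinfun - q) o\<^sub>L (id_blinfun - q) = a"
      using fix_q by (simp add: comp_bilinear b_def algebra_simps scaleR_2)
  qed
qed

lemma positive_sqrt_ex:
  assumes a: "positive_op a"
  obtains p where "p \<in> sa_bicommutant a" "positive_op p" "p o\<^sub>L p = a"
proof -
  \<comment> \<open>Scaling by 1/c reduces to the contractive case: \<open>c - a\<close> is the sum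
    of the positive operators \<open>norm a - a\<close> and 1, and the summand 1 keeps c positive
    when a = 0.\<close>
  define c where "c = norm a + 1"
  have c: "c > 0"
    by (simp add: c_def add_nonneg_pos)
  have sa: "self_adjoint a"
    using a by (rule positive_op_self_adjoint)
  have "positive_op ((1/c) *\<^sub>R ((norm a *\<^sub>R id_blinfun - a) + id_blinfun))"
    using c by (intro positive_op_scaleR positive_op_add norm_id_minus_positive sa) simp_all
  moreover have "(1/c) *\<^sub>R ((norm a *\<^sub>R id_blinfun - a) + id_blinfun)
      = (1/c) *\<^sub>R (c *\<^sub>R id_blinfun - a)"
    by (simp add: c_def algebra_simps)
  moreover have "\<dots> = id_blinfun - (1/c) *\<^sub>R a"
    using c by (simp add: scaleR_diff_right)
  ultimately have "positive_op (id_blinfun - (1/c) *\<^sub>R a)"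
    by simp
  then obtain p where p: "p \<in> sa_bicommutant ((1/c) *\<^sub>R a)" "positive_op p" "p o\<^sub>L p = (1/c) *\<^sub>R a"
    using contraction_sqrt_ex[of "(1/c) *\<^sub>R a"] positive_op_scaleR[OF a, of "1/c"] c by auto
  show ?thesis
  proof
    have "p \<in> sa_bicommutant a"
      using p(1) sa_bicommutant_mono[of "(1/c) *\<^sub>R a" a] sa_bicommutant_scaleR sa_bicommutant_self[OF sa]
      by blast
    then show "sqrt c *\<^sub>R p \<in> sa_bicommutant a"
      by (rule sa_bicommutant_scaleR)
    show "positive_op (sqrt c *\<^sub>R p)"
      using p(2) c by (intro positive_op_scaleR) simp_all
    show "(sqrt c *\<^sub>R p) o\<^sub>L (sqrt c *\<^sub>R p) = a"
      using c by (simp add: comp_bilinear p(3))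
  qed
qed

text \<open>For commuting roots, \<open>(p + q)(p - q) = 0\<close> makes the forms of p and q vanish
  on the range of \<open>d = p - q\<close>; hence \<open>d\<^sup>2 = 0\<close>, and d = 0 as d is
  self-adjoint. In general both roots are compared with the root in the bicommutant of their common
  square, which commutes with each of them.\<close>

lemma positive_sqrt_unique:
  assumes p: "positive_op p" and q: "positive_op q" and eq: "p o\<^sub>L p = q o\<^sub>L q"
  shows "p = q"
proof -
  have p_sqrt_unique: "p = q" if p: "positive_op p" and q: "positive_op q"
    and eq: "p o\<^sub>L p = q o\<^sub>L q" and comm: "p o\<^sub>L q = q o\<^sub>L p" for p q :: "'a op"
  proof (rule blinfun_eqI)
    fix w
    define d where "d = p - q"
    define v where "v = blinfun_apply d w"
    have sd: "self_adjoint d"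
      unfolding d_def by (intro self_adjoint_diff positive_op_self_adjoint p q)
    have "(p + q) o\<^sub>L d = 0"
      by (simp add: d_def comp_bilinear eq comm)
    then have "blinfun_apply (p + q) v = 0"
      unfolding v_def by (metis blinfun_apply_blinfun_compose zero_blinfun.rep_eq)
    then have "blinfun_apply p v \<bullet> v + blinfun_apply q v \<bullet> v = 0"
      by (metis blinfun.add_left inner_add_left inner_zero_left)
    then have zero: "blinfun_apply p v \<bullet> v = 0" "blinfun_apply q v \<bullet> v = 0"
      using positive_op_inner[OF p, of v] positive_op_inner[OF q, of v] by linarith+
    \<comment> \<open>The form of r at v is the squared norm of \<open>s v\<close> for a square root
      s of r, so where the form vanishes r does too.\<close>
    have ker: "blinfun_apply r v = 0" if r: "positive_op r" and "blinfun_apply r v \<bullet> v = 0" for r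
    proof -
      obtain s where s: "positive_op s" "s o\<^sub>L s = r"
        using positive_sqrt_ex[OF r] by blast
      have "blinfun_apply s v \<bullet> blinfun_apply s v = blinfun_apply r v \<bullet> v"
        using self_adjoint_inner[OF positive_op_self_adjoint[OF s(1)]] s(2) by auto
      then have "blinfun_apply s v = 0"
        using that(2) by simp
      then show ?thesis
        using s(2) by auto
    qed
    have "blinfun_apply d v = 0"
      by (simp add: d_def blinfun.diff_left ker[OF p zero(1)] ker[OF q zero(2)])
    then have "v \<bullet> v = 0"
      unfolding v_def using self_adjoint_inner[OF sd] by (metis inner_zero_left)
    then show "blinfun_apply p w = blinfun_apply q w"
      by (simp add: v_def d_def blinfun.diff_left)
  qed
  obtain r where r: "r \<in> sa_bicommutant (p o\<^sub>L p)" "positive_op r" "r o\<^sub>L r = p o\<^sub>L p"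
    using positive_sqrt_ex[OF positive_square[OF positive_op_self_adjoint[OF p]]] by blast
  have "u = r" if u: "positive_op u" "u o\<^sub>L u = p o\<^sub>L p" for u
  proof (rule p_sqrt_unique[OF u(1) r(2)])
    have "u o\<^sub>L (p o\<^sub>L p) = (p o\<^sub>L p) o\<^sub>L u"
      by (metis comp_assoc u(2))
    then show "u o\<^sub>L r = r o\<^sub>L u"
      using r(1) u(1) by (auto simp: sa_bicommutant_def positive_op_iff self_adjoint_complex_linear)
  qed (simp add: u r)
  then show ?thesis
    using p q eq by metis
qed

text \<open>Existence and uniqueness of square roots give the definite description in
  \<open>op_abs\<close> its meaning; membership in the bicommutant keeps |x| inside every von
  Neumann algebra that contains x.\<close>

lemma op_abs_self_adjoint:
  assumes x: "self_adjoint x"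
  shows "op_abs x \<in> sa_bicommutant x" "positive_op (op_abs x)" "op_abs x o\<^sub>L op_abs x = x o\<^sub>L x"
proof -
  obtain p where p: "p \<in> sa_bicommutant (x o\<^sub>L x)" "positive_op p" "p o\<^sub>L p = x o\<^sub>L x"
    using positive_sqrt_ex[OF positive_square[OF x]] by blast
  have "op_abs x = p"
    unfolding op_abs_def
    by (rule the_equality) (use x p in \<open>auto simp: self_adjoint_def intro: positive_sqrt_unique\<close>)
  moreover have "p \<in> sa_bicommutant x"
    using p(1) sa_bicommutant_mono sa_bicommutant_comp sa_bicommutant_self x by blast
  ultimately show "op_abs x \<in> sa_bicommutant x" "positive_op (op_abs x)"
    "op_abs x o\<^sub>L op_abs x = x o\<^sub>L x"
    using p by simp_all
qed

text \<open>Neumann series: with \<open>c = norm q + e\<close>, the operator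
  \<open>b = 1 - q/c\<close> lies between 0 and \<open>\<theta> = 1 - e/c < 1\<close>, so the powers
  of b sum to c times the inverse of q. The partial sums stay in the bicommutant of q, and so does
  the limit.\<close>

lemma positive_inverse_ex:
  assumes q: "positive_op (q - e *\<^sub>R id_blinfun)" and e: "e > 0"
  obtains r where "r \<in> sa_bicommutant q" "q o\<^sub>L r = id_blinfun"
proof -
  have sq: "self_adjoint q"
    using self_adjoint_add[OF positive_op_self_adjoint[OF q] self_adjoint_scaleR[of _ e]]
      self_adjoint_id by fastforce
  define c where "c = norm q + e"
  have c: "c > 0" "e \<le> c"
    using e by (simp_all add: c_def add_nonneg_pos)
  define b where "b = id_blinfun - (1/c) *\<^sub>R q"
  define \<theta> where "\<theta> = 1 - e / c"
  have \<theta>: "0 \<le> \<theta>" "\<theta> < 1"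
    using c e by (simp_all add: \<theta>_def)
  have "positive_op ((1/c) *\<^sub>R ((norm q *\<^sub>R id_blinfun - q) + e *\<^sub>R id_blinfun))"
    using c e by (intro positive_op_scaleR positive_op_add norm_id_minus_positive sq) simp_all
  moreover have "(1/c) *\<^sub>R ((norm q *\<^sub>R id_blinfun - q) + e *\<^sub>R id_blinfun)
      = (1/c) *\<^sub>R (c *\<^sub>R id_blinfun - q)"
    by (simp add: c_def algebra_simps)
  moreover have "\<dots> = b"
    using c by (simp add: scaleR_diff_right b_def)
  ultimately have b_pos: "positive_op b"
    by simp
  have "\<theta> *\<^sub>R id_blinfun - b = (1/c) *\<^sub>R (q - e *\<^sub>R id_blinfun)"
    by (simp add: \<theta>_def b_def algebra_simps)
  then have "positive_op (\<theta> *\<^sub>R id_blinfun - b)"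
    using positive_op_scaleR[OF q, of "1/c"] c by simp
  then have nb: "norm b \<le> \<theta>"
    using norm_le_of_positive b_pos \<theta>(1) by blast
  have b: "b \<in> sa_bicommutant q"
    unfolding b_def by (intro sa_bicommutant_diff sa_bicommutant_scaleR sa_bicommutant_id
        sa_bicommutant_self sq)
  define s where "s = rec_nat 0 (\<lambda>_ s. id_blinfun + (b o\<^sub>L s))"
  have s: "s 0 = 0" "\<And>n. s (Suc n) = id_blinfun + (b o\<^sub>L s n)"
    by (simp_all add: s_def)
  have s_mem: "s n \<in> sa_bicommutant q" for n
    by (induction n) (auto simp: s intro!: sa_bicommutant_add b sa_bicommutant_comp sq)
  have inc: "norm (s (Suc n) - s n) \<le> (\<Sum>k<Suc n. \<theta> ^ k) - (\<Sum>k<n. \<theta> ^ k)" for n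
  proof (induction n)
    case 0
    show ?case
      by (simp add: s(1) s(2)[of 0] norm_blinfun_id_le)
  next
    case (Suc n)
    have "s (Suc (Suc n)) - s (Suc n) = b o\<^sub>L (s (Suc n) - s n)"
      by (simp add: s(2)[of "Suc n"] s(2)[of n] comp_bilinear)
    then have "norm (s (Suc (Suc n)) - s (Suc n)) \<le> norm b * norm (s (Suc n) - s n)"
      by (simp add: norm_blinfun_compose)
    also have "\<dots> \<le> \<theta> * \<theta> ^ n"
      using nb Suc \<theta> by (intro mult_mono) auto
    finally show ?case
      by simp
  qed
  have "convergent (\<lambda>n. \<Sum>k<n. \<theta> ^ k)"
    using \<theta> by (simp add: summable_geometric flip: summable_iff_convergent)
  then obtain u where u: "s \<longlonglongrightarrow> u"
    using convergent_dominated_increments[of "\<lambda>n. \<Sum>k<n. \<theta> ^ k" s] inc by (auto simp: convergent_def)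
  have u_mem: "u \<in> sa_bicommutant q"
    using s_mem u by (rule sa_bicommutant_limit)
  have "(\<lambda>n. s (Suc n)) \<longlonglongrightarrow> id_blinfun + (b o\<^sub>L u)"
    unfolding s(2)
    by (intro tendsto_intros bounded_bilinear.tendsto[OF bounded_bilinear_blinfun_compose] u)
  then have "u = id_blinfun + (b o\<^sub>L u)"
    using LIMSEQ_unique LIMSEQ_Suc[OF u] by blast
  then have "q o\<^sub>L ((1/c) *\<^sub>R u) = id_blinfun"
    by (simp add: b_def comp_bilinear algebra_simps)
  with that[of "(1/c) *\<^sub>R u"] u_mem show ?thesis
    by (simp add: sa_bicommutant_scaleR)
qed

section \<open>The trace and the \<open>L\<^sup>1\<close>-norm\<close>

text \<open>With r the inverse of \<open>|x| + e\<close>, the operator \<open>x r\<close> replaces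
  the sign of x from the polar decomposition: it is a contraction, and its product with x misses |x|
  only by \<open>e |x| r\<close>, where \<open>0 \<le> |x| r \<le> 1\<close>.\<close>

lemma positive_commuting_resolvent:
  assumes x: "self_adjoint x" and e: "0 < e"
  obtains r where "r \<in> sa_bicommutant x" "(op_abs x + e *\<^sub>R id_blinfun) o\<^sub>L r = id_blinfun"
    "positive_op (op_abs x o\<^sub>L r)" "positive_op (id_blinfun - (op_abs x o\<^sub>L r))"
    "norm (x o\<^sub>L r) \<le> 1"
    "x o\<^sub>L (x o\<^sub>L r) = op_abs x - e *\<^sub>R (op_abs x o\<^sub>L r)"
proof -
  define p where "p = op_abs x"
  define q where "q = p + e *\<^sub>R id_blinfun"
  note p = op_abs_self_adjoint[OF x, folded p_def]
  have q_mem: "q \<in> sa_bicommutant x"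
    unfolding q_def by (intro sa_bicommutant_add p sa_bicommutant_scaleR sa_bicommutant_id)
  obtain r where r: "r \<in> sa_bicommutant q" "q o\<^sub>L r = id_blinfun"
    using positive_inverse_ex[of q e] p(2) e by (auto simp: q_def)
  have r_mem: "r \<in> sa_bicommutant x"
    using r(1) sa_bicommutant_mono q_mem by blast
  have pr: "p o\<^sub>L r \<in> sa_bicommutant x"
    by (intro sa_bicommutant_comp p r_mem x)
  have pr_eq: "p o\<^sub>L r = id_blinfun - e *\<^sub>R r"
    using r(2) by (simp add: q_def comp_bilinear algebra_simps)
  define w where "w v = blinfun_apply r v" for v
  \<comment> \<open>All forms and norms below are evaluated at \<open>w v\<close>, the preimage of v
    under \<open>|x| + e\<close>, where they become visibly nonnegative.\<close>
  have v: "v = blinfun_apply p (w v) + e *\<^sub>R w v" for v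
    using arg_cong[OF r(2), of "\<lambda>T. blinfun_apply T v"]
    by (simp add: q_def w_def blinfun.bilinear_simps)
  note psa = self_adjoint_inner[OF positive_op_self_adjoint[OF p(2)]]
    and pos = positive_op_inner[OF p(2)]
  show ?thesis
  proof
    show "r \<in> sa_bicommutant x" by fact
    show "(op_abs x + e *\<^sub>R id_blinfun) o\<^sub>L r = id_blinfun"
      using r(2) by (simp add: q_def p_def)
    have "0 \<le> blinfun_apply (p o\<^sub>L r) v \<bullet> v" for v
    proof -
      have "blinfun_apply (p o\<^sub>L r) v \<bullet> v = blinfun_apply p (w v) \<bullet> (blinfun_apply p (w v) + e *\<^sub>R w v)"
        using v[of v] by (simp add: w_def)
      also have "\<dots> = blinfun_apply p (w v) \<bullet> blinfun_apply p (w v) + e * (blinfun_apply p (w v) \<bullet> w v)"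
        by (simp add: inner_add)
      finally show ?thesis
        using pos[of "w v"] e by simp
    qed
    then show "positive_op (op_abs x o\<^sub>L r)"
      using sa_bicommutant_self_adjoint[OF pr] by (simp add: positive_op_iff p_def)
    have "0 \<le> blinfun_apply (e *\<^sub>R r) v \<bullet> v" for v
    proof -
      have "blinfun_apply r v \<bullet> v = w v \<bullet> (blinfun_apply p (w v) + e *\<^sub>R w v)"
        using v[of v] by (simp add: w_def)
      also have "\<dots> = blinfun_apply p (w v) \<bullet> w v + e * (w v \<bullet> w v)"
        by (simp add: inner_add inner_commute)
      finally show ?thesis
        using pos[of "w v"] e by (simp add: blinfun.bilinear_simps)
    qed
    then have "positive_op (e *\<^sub>R r)"
      using self_adjoint_scaleR[OF sa_bicommutant_self_adjoint[OF r_mem]] by (simp add: positive_op_iff)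
    then show "positive_op (id_blinfun - (op_abs x o\<^sub>L r))"
      using pr_eq by (simp add: p_def)
    show "norm (x o\<^sub>L r) \<le> 1"
    proof (rule norm_blinfun_bound)
      fix v
      have "(norm (blinfun_apply (x o\<^sub>L r) v))\<^sup>2 = blinfun_apply (x o\<^sub>L x) (w v) \<bullet> w v"
        by (simp add: power2_norm_eq_inner w_def self_adjoint_inner[OF x])
      also have "\<dots> = (norm (blinfun_apply p (w v)))\<^sup>2"
        by (simp add: power2_norm_eq_inner psa flip: p(3))
      also have "\<dots> \<le> (norm v)\<^sup>2"
      proof -
        have "(norm (blinfun_apply p (w v) + e *\<^sub>R w v))\<^sup>2
            = (norm (blinfun_apply p (w v)))\<^sup>2 + 2 * e * (blinfun_apply p (w v) \<bullet> w v) + e\<^sup>2 * (w v \<bullet> w v)"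
          unfolding power2_norm_eq_inner power2_eq_square[of e]
          by (simp add: inner_add inner_commute algebra_simps)
        moreover have "0 \<le> 2 * e * (blinfun_apply p (w v) \<bullet> w v)" "0 \<le> e\<^sup>2 * (w v \<bullet> w v)"
          using e pos[of "w v"] by simp_all
        ultimately show ?thesis
          using v[of v] by simp
      qed
      finally show "norm (blinfun_apply (x o\<^sub>L r) v) \<le> 1 * norm v"
        by simp
    qed simp
    have "x o\<^sub>L (x o\<^sub>L r) = p o\<^sub>L (p o\<^sub>L r)"
      using p(3) by (metis comp_assoc)
    also have "\<dots> = p - e *\<^sub>R (p o\<^sub>L r)"
      by (subst pr_eq) (simp add: comp_bilinear)
    finally show "x o\<^sub>L (x o\<^sub>L r) = op_abs x - e *\<^sub>R (op_abs x o\<^sub>L r)"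
      by (simp add: p_def)
  qed
qed

locale tracial_vna =
  fixes M :: "'h::complex_hilbert_space op set" and \<tau> :: "'h op \<Rightarrow> complex"
  assumes tracial_vna: "tracial_von_neumann_algebra M \<tau>"
begin

section \<open>Algebraic closure and positivity of the trace in a tracial von Neumann
  algebra\<close>

lemma M_adjoint: "T \<in> M \<Longrightarrow> op_adjoint T \<in> M"
  and M_bicommutant: "commutant (commutant M) = M"
  and \<tau>_add: "S \<in> M \<Longrightarrow> T \<in> M \<Longrightarrow> \<tau> (S + T) = \<tau> S + \<tau> T"
  and \<tau>_scaleC: "T \<in> M \<Longrightarrow> \<tau> (op_scaleC c T) = c * \<tau> T"
  and \<tau>_square: "T \<in> M \<Longrightarrow> \<tau> (op_adjoint T o\<^sub>L T) \<in> \<real>\<^sub>\<ge>\<^sub>0"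
  and \<tau>_id [simp]: "\<tau> id_blinfun = 1"
  and \<tau>_commute: "S \<in> M \<Longrightarrow> T \<in> M \<Longrightarrow> \<tau> (S o\<^sub>L T) = \<tau> (T o\<^sub>L S)"
  and \<tau>_faithful: "T \<in> M \<Longrightarrow> \<tau> (op_adjoint T o\<^sub>L T) = 0 \<Longrightarrow> T = 0"
  using tracial_vna
  by (auto simp: tracial_von_neumann_algebra_def von_neumann_algebra_def state_on_def
      tracial_on_def faithful_on_def)

lemma mem_M_iff: "T \<in> M \<longleftrightarrow> complex_linear T \<and> (\<forall>S\<in>commutant M. T o\<^sub>L S = S o\<^sub>L T)"
  using M_bicommutant unfolding commutant_def[of "commutant M"] by blast

lemma M_linear: "T \<in> M \<Longrightarrow> complex_linear T"
  by (simp add: mem_M_iff)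

lemma M_id [simp]: "id_blinfun \<in> M"
  and M_0 [simp]: "0 \<in> M"
  and M_add: "S \<in> M \<Longrightarrow> T \<in> M \<Longrightarrow> S + T \<in> M"
  and M_diff: "S \<in> M \<Longrightarrow> T \<in> M \<Longrightarrow> S - T \<in> M"
  and M_scaleR: "T \<in> M \<Longrightarrow> r *\<^sub>R T \<in> M"
  unfolding mem_M_iff
  by (auto simp: comp_bilinear complex_linear_add complex_linear_diff complex_linear_scaleR)

lemma M_comp: "S \<in> M \<Longrightarrow> T \<in> M \<Longrightarrow> S o\<^sub>L T \<in> M"
  unfolding mem_M_iff by (metis complex_linear_comp comp_assoc)

lemma M_scaleC:
  assumes "T \<in> M"
  shows "op_scaleC c T \<in> M"
proof -
  have "op_scaleC c T o\<^sub>L S = S o\<^sub>L op_scaleC c T" if S: "S \<in> commutant M" for S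
  proof (rule blinfun_eqI)
    fix x
    have TS: "T o\<^sub>L S = S o\<^sub>L T"
      using assms S unfolding mem_M_iff by blast
    have "blinfun_apply (op_scaleC c T o\<^sub>L S) x = c *\<^sub>C blinfun_apply (S o\<^sub>L T) x"
      by (simp flip: TS)
    also have "\<dots> = blinfun_apply (S o\<^sub>L op_scaleC c T) x"
      using S by (simp add: commutant_def complex_linearD)
    finally show "blinfun_apply (op_scaleC c T o\<^sub>L S) x = blinfun_apply (S o\<^sub>L op_scaleC c T) x" .
  qed
  then show ?thesis
    using assms complex_linear_scaleC M_linear unfolding mem_M_iff[of "op_scaleC c T"] by blast
qed

lemma M_sum: "(\<And>i. i \<in> I \<Longrightarrow> f i \<in> M) \<Longrightarrow> sum f I \<in> M"
  by (induction I rule: infinite_finite_induct) (auto intro: M_add)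

lemma M_op_prod: "set xs \<subseteq> M \<Longrightarrow> op_prod xs \<in> M"
  by (induction xs) (auto simp: op_prod_def intro: M_comp)

lemma \<tau>_scaleR: "T \<in> M \<Longrightarrow> \<tau> (r *\<^sub>R T) = complex_of_real r * \<tau> T"
  using \<tau>_scaleC[of T "complex_of_real r"] by (simp add: op_scaleC_of_real)

lemma \<tau>_0 [simp]: "\<tau> 0 = 0"
  using \<tau>_scaleR[of 0 0] by simp

lemma \<tau>_diff: "S \<in> M \<Longrightarrow> T \<in> M \<Longrightarrow> \<tau> (S - T) = \<tau> S - \<tau> T"
  using \<tau>_add[of "S - T" T] by (simp add: M_diff)

lemma \<tau>_sum: "(\<And>i. i \<in> I \<Longrightarrow> f i \<in> M) \<Longrightarrow> \<tau> (sum f I) = (\<Sum>i\<in>I. \<tau> (f i))"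
  by (induction I rule: infinite_finite_induct) (simp_all add: \<tau>_add M_sum)

lemma hermitian_part_iff: "T \<in> hermitian_part M \<longleftrightarrow> T \<in> M \<and> self_adjoint T"
  by (auto simp: hermitian_part_def self_adjoint_def M_linear)

lemma hermitian_part_M: "T \<in> hermitian_part M \<Longrightarrow> T \<in> M"
  by (simp add: hermitian_part_def)

lemma hermitian_part_0 [simp]: "0 \<in> hermitian_part M"
  and hermitian_part_add:
    "S \<in> hermitian_part M \<Longrightarrow> T \<in> hermitian_part M \<Longrightarrow> S + T \<in> hermitian_part M"
  and hermitian_part_diff:
    "S \<in> hermitian_part M \<Longrightarrow> T \<in> hermitian_part M \<Longrightarrow> S - T \<in> hermitian_part M"
  and hermitian_part_scaleR: "T \<in> hermitian_part M \<Longrightarrow> r *\<^sub>R T \<in> hermitian_part M"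
  by (auto simp: hermitian_part_iff M_add M_diff M_scaleR self_adjoint_add self_adjoint_diff
      self_adjoint_scaleR)

text \<open>Elements of the commutant of M commute with x and therefore with its bicommutant.
  Consequently roots, absolute values and inverses formed from x stay in M.\<close>

lemma sa_bicommutant_hermitian_part:
  assumes "x \<in> hermitian_part M"
  shows "sa_bicommutant x \<subseteq> hermitian_part M"
proof
  fix T assume T: "T \<in> sa_bicommutant x"
  have "T o\<^sub>L S = S o\<^sub>L T" if "S \<in> commutant M" for S
  proof -
    have "complex_linear S" "S o\<^sub>L x = x o\<^sub>L S"
      using that assms by (auto simp: commutant_def hermitian_part_def)
    then show ?thesis
      using T unfolding sa_bicommutant_def by simp
  qed
  then show "T \<in> hermitian_part M"
    using sa_bicommutant_self_adjoint[OF T]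
    by (auto simp: hermitian_part_iff mem_M_iff self_adjoint_complex_linear)
qed

text \<open>A state is assumed nonnegative only on \<open>T\<^sup>* T\<close>; the square root of x,
  which again lies in M, brings x into that form.\<close>

lemma \<tau>_positive:
  assumes "x \<in> M" "positive_op x"
  shows "0 \<le> Re (\<tau> x)" "Im (\<tau> x) = 0"
proof -
  obtain r where r: "r \<in> sa_bicommutant x" "r o\<^sub>L r = x"
    using positive_sqrt_ex[OF assms(2)] by blast
  have "r \<in> hermitian_part M"
    using r(1) sa_bicommutant_hermitian_part assms positive_op_self_adjoint hermitian_part_iff
    by blast
  then have "\<tau> x \<in> \<real>\<^sub>\<ge>\<^sub>0"
    using \<tau>_square[of r] r(2) by (simp add: hermitian_part_def)
  then show "0 \<le> Re (\<tau> x)" "Im (\<tau> x) = 0"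
    by (auto simp: complex_nonneg_Reals_iff)
qed

lemma \<tau>_mono:
  assumes "x \<in> M" "y \<in> M" "positive_op (y - x)"
  shows "Re (\<tau> x) \<le> Re (\<tau> y)"
  using \<tau>_positive(1)[of "y - x"] assms by (simp add: M_diff \<tau>_diff)

lemma \<tau>_hermitian:
  assumes "x \<in> hermitian_part M"
  shows "Im (\<tau> x) = 0" "\<bar>Re (\<tau> x)\<bar> \<le> norm x"
proof -
  have sa: "self_adjoint x" and x: "x \<in> M"
    using assms by (auto simp: hermitian_part_iff)
  have n: "positive_op (norm x *\<^sub>R id_blinfun - x)"
    by (rule norm_id_minus_positive[OF sa])
  have n': "positive_op (x - (- norm x) *\<^sub>R id_blinfun)"
    using norm_id_minus_positive[OF self_adjoint_scaleR[OF sa, of "-1"]]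
    by (simp add: add.commute)
  show "Im (\<tau> x) = 0"
    using \<tau>_positive(2)[OF _ n] x by (simp add: M_diff M_scaleR \<tau>_diff \<tau>_scaleR)
  have "Re (\<tau> x) \<le> norm x"
    using \<tau>_mono[OF _ _ n] x by (simp add: M_scaleR \<tau>_scaleR)
  moreover have "- norm x \<le> Re (\<tau> x)"
    using \<tau>_mono[OF _ _ n'] x M_scaleR[OF M_id, of "- norm x"] \<tau>_scaleR[OF M_id, of "- norm x"] by simp
  ultimately show "\<bar>Re (\<tau> x)\<bar> \<le> norm x"
    by simp
qed

lemma hermitian_decomposition:
  assumes "T \<in> M"
  obtains x y where "x \<in> hermitian_part M" "y \<in> hermitian_part M" "T = x + op_scaleC \<i> y"
    "op_adjoint T = x - op_scaleC \<i> y" "norm x \<le> norm T" "norm y \<le> norm T"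
proof -
  note [simp] = M_linear[OF assms] complex_linear_adjoint complex_linear_scaleC
    complex_linear_add complex_linear_diff complex_linear_scaleR
  define x where "x = (1/2) *\<^sub>R (T + op_adjoint T)"
  define y where "y = (1/2) *\<^sub>R op_scaleC (- \<i>) (T - op_adjoint T)"
  have norm_op_scaleC: "norm (op_scaleC c S) \<le> cmod c * norm S" for c and S :: "'h op"
    by (rule norm_blinfun_bound) (simp_all add: norm_scaleC mult_left_mono norm_blinfun mult.assoc)
  show ?thesis
  proof
    show "x \<in> hermitian_part M"
      unfolding x_def hermitian_part_def mem_Collect_eq
      by (auto intro!: M_scaleR M_add M_adjoint assms simp: op_adjoint_scaleR op_adjoint_add
          op_adjoint_adjoint add.commute)
    have "op_adjoint y = (1/2) *\<^sub>R op_scaleC \<i> (op_adjoint T - T)"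
      by (simp add: y_def op_adjoint_scaleR op_adjoint_scaleC op_adjoint_diff op_adjoint_adjoint)
    also have "\<dots> = y"
      unfolding y_def
      by (rule blinfun_eqI) (simp add: blinfun.bilinear_simps scaleC_diff_right scaleC_minus_left)
    finally show "y \<in> hermitian_part M"
      unfolding hermitian_part_def mem_Collect_eq
      by (auto simp: y_def intro!: M_scaleR M_scaleC M_diff M_adjoint assms)
    have "op_scaleC \<i> y = (1/2) *\<^sub>R (T - op_adjoint T)"
      unfolding y_def
      by (rule blinfun_eqI) (simp add: blinfun.bilinear_simps scaleC_scaleC scaleC_scaleR_commute)
    then show "T = x + op_scaleC \<i> y" "op_adjoint T = x - op_scaleC \<i> y"
      by (simp_all add: x_def scaleR_add_right scaleR_diff_right flip: scaleR_add_left)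
    have le: "norm (op_adjoint T) \<le> norm T"
      by (rule norm_op_adjoint_le) simp
    show "norm x \<le> norm T"
      using norm_triangle_ineq[of T "op_adjoint T"] le by (simp add: x_def)
    show "norm y \<le> norm T"
      using norm_op_scaleC[of "- \<i>" "T - op_adjoint T"] norm_triangle_ineq4[of T "op_adjoint T"] le
      by (simp add: y_def)
  qed
qed

lemma \<tau>_adjoint:
  assumes "T \<in> M"
  shows "\<tau> (op_adjoint T) = cnj (\<tau> T)"
proof -
  obtain x y where xy: "x \<in> hermitian_part M" "y \<in> hermitian_part M" "T = x + op_scaleC \<i> y"
    "op_adjoint T = x - op_scaleC \<i> y"
    using hermitian_decomposition[OF assms] by metis
  have "\<tau> (x + op_scaleC \<i> y) = \<tau> x + \<i> * \<tau> y" "\<tau> (x - op_scaleC \<i> y) = \<tau> x - \<i> * \<tau> y"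
    using xy(1,2) by (simp_all add: \<tau>_add \<tau>_diff \<tau>_scaleC M_scaleC hermitian_part_M)
  then show ?thesis
    unfolding xy(3,4)[symmetric]
    using \<tau>_hermitian(1)[OF xy(1)] \<tau>_hermitian(1)[OF xy(2)] by (simp add: complex_eq_iff)
qed

text \<open>The factor 2 comes from bounding the real and imaginary parts separately. Some constant
  is all that differentiating under the trace requires.\<close>

lemma \<tau>_bounded:
  assumes "T \<in> M"
  shows "cmod (\<tau> T) \<le> 2 * norm T"
proof -
  obtain x y where xy: "x \<in> hermitian_part M" "y \<in> hermitian_part M" "T = x + op_scaleC \<i> y"
    "norm x \<le> norm T" "norm y \<le> norm T"
    using hermitian_decomposition[OF assms] by metis
  have "\<tau> T = \<tau> x + \<i> * \<tau> y"
    unfolding xy(3) using xy(1,2) by (simp add: \<tau>_add \<tau>_scaleC M_scaleC hermitian_part_M)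
  moreover have "cmod (\<tau> x) \<le> norm T" "cmod (\<tau> y) \<le> norm T"
    using \<tau>_hermitian[OF xy(1)] \<tau>_hermitian[OF xy(2)] xy(4,5) by (simp_all add: cmod_eq_Re)
  ultimately show ?thesis
    using norm_triangle_ineq[of "\<tau> x" "\<i> * \<tau> y"] by (simp add: norm_mult)
qed

text \<open>Taking adjoints exchanges the two factors, and the trace does not see the
  exchange.\<close>

lemma \<tau>_comp_hermitian_real:
  assumes "x \<in> hermitian_part M" "y \<in> hermitian_part M"
  shows "Im (\<tau> (x o\<^sub>L y)) = 0"
proof -
  have "op_adjoint (x o\<^sub>L y) = y o\<^sub>L x"
    using assms by (simp add: hermitian_part_def op_adjoint_comp M_linear)
  then have "\<tau> (x o\<^sub>L y) = cnj (\<tau> (x o\<^sub>L y))"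
    using \<tau>_adjoint[of "x o\<^sub>L y"] \<tau>_commute[of x y] assms by (simp add: M_comp hermitian_part_M)
  then show ?thesis
    by (metis Reals_cnj_iff complex_is_Real_iff)
qed

text \<open>With \<open>q = |x| + e\<close>, \<open>\<rho> = q\<^bsup>1/2\<^esup>\<close> and \<open>s = x q\<^bsup>-1\<^esup>\<close> one has \<open>x = \<rho> s \<rho>\<close>;
  expand \<open>\<tau>((s \<rho> - \<rho> K)\<^sup>* (s \<rho> - \<rho> K)) \<ge> 0\<close> and let \<open>e\<close> tend to zero.\<close>

lemma trace_le_L1_norm:
  assumes x: "x \<in> hermitian_part M" and K: "K \<in> hermitian_part M" and nK: "norm K \<le> 1"
  shows "Re (\<tau> (x o\<^sub>L K)) \<le> L1_norm \<tau> x"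
proof -
  have "Re (\<tau> (x o\<^sub>L K)) \<le> Re (\<tau> (op_abs x)) + e" if e: "e > 0" for e
  proof -
    have sx: "self_adjoint x" and sK: "self_adjoint K" and xM: "x \<in> M" and KM: "K \<in> M"
      using x K by (auto simp: hermitian_part_iff)
    define p where "p = op_abs x"
    define q where "q = p + e *\<^sub>R id_blinfun"
    note p = op_abs_self_adjoint[OF sx, folded p_def]
    obtain r where r: "r \<in> sa_bicommutant x" "q o\<^sub>L r = id_blinfun" "positive_op (p o\<^sub>L r)"
      "x o\<^sub>L (x o\<^sub>L r) = p - e *\<^sub>R (p o\<^sub>L r)"
      using positive_commuting_resolvent[OF sx e] unfolding p_def q_def by metis
    have q: "q \<in> sa_bicommutant x"
      unfolding q_def by (intro sa_bicommutant_add p sa_bicommutant_scaleR sa_bicommutant_id)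
    have "positive_op q"
      unfolding q_def using e by (intro positive_op_add p positive_op_scaleR positive_op_id) simp
    then obtain \<rho> where "\<rho> \<in> sa_bicommutant q" and \<rho>\<rho>: "\<rho> o\<^sub>L \<rho> = q"
      using positive_sqrt_ex by metis
    then have \<rho>: "\<rho> \<in> sa_bicommutant x"
      using sa_bicommutant_mono q by blast
    define s where "s = x o\<^sub>L r"
    have s: "s \<in> sa_bicommutant x"
      unfolding s_def by (intro sa_bicommutant_comp sa_bicommutant_self r sx)
    note comm = sa_bicommutant_commute[OF _ _ sx]
    have in_M: "T \<in> M" if "T \<in> sa_bicommutant x" for T
      using that sa_bicommutant_hermitian_part[OF x] hermitian_part_M by blast
    have adj: "op_adjoint T = T" if "T \<in> sa_bicommutant x" for T
      using sa_bicommutant_self_adjoint[OF that] by (simp add: self_adjoint_def)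
    note M = in_M[OF p(1)] in_M[OF q] in_M[OF \<rho>] in_M[OF s] in_M[OF r(1)] KM xM
      M_comp M_diff M_add M_scaleR M_adjoint
    have rq: "r o\<^sub>L q = id_blinfun"
      using comm[OF r(1) q] r(2) by simp
    have x_eq: "\<rho> o\<^sub>L (s o\<^sub>L \<rho>) = x"
    proof -
      have "\<rho> o\<^sub>L (s o\<^sub>L \<rho>) = s o\<^sub>L (\<rho> o\<^sub>L \<rho>)"
        by (metis comm[OF \<rho> s] comp_assoc)
      also have "\<dots> = x"
        by (simp add: \<rho>\<rho> s_def comp_assoc rq)
      finally show ?thesis .
    qed
    have ss: "\<rho> o\<^sub>L (s o\<^sub>L (s o\<^sub>L \<rho>)) = p - e *\<^sub>R (p o\<^sub>L r)"
    proof -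
      have "\<rho> o\<^sub>L (s o\<^sub>L (s o\<^sub>L \<rho>)) = s o\<^sub>L x"
        by (metis comm[OF \<rho> s] comp_assoc x_eq)
      also have "\<dots> = x o\<^sub>L (x o\<^sub>L r)"
        using comm[OF s sa_bicommutant_self[OF sx]] by (simp add: s_def)
      finally show ?thesis
        by (simp add: r(4))
    qed
    define u where "u = (s o\<^sub>L \<rho>) - (\<rho> o\<^sub>L K)"
    have "op_adjoint u = (\<rho> o\<^sub>L s) - (K o\<^sub>L \<rho>)"
      using sK M_linear[OF M(3)] M_linear[OF M(4)] M_linear[OF M(6)]
      by (simp add: u_def op_adjoint_diff op_adjoint_comp complex_linear_comp adj[OF \<rho>] adj[OF s]
          self_adjoint_def)
    then have "op_adjoint u o\<^sub>L u = (p - e *\<^sub>R (p o\<^sub>L r)) - (x o\<^sub>L K) - ((K o\<^sub>L x) - (K o\<^sub>L (q o\<^sub>L K)))"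
      unfolding ss[symmetric] x_eq[symmetric] \<rho>\<rho>[symmetric]
      by (simp add: u_def comp_bilinear comp_assoc)
    then have "\<tau> (op_adjoint u o\<^sub>L u) = \<tau> p - e * \<tau> (p o\<^sub>L r) - \<tau> (x o\<^sub>L K) - \<tau> (K o\<^sub>L x) + \<tau> (K o\<^sub>L (q o\<^sub>L K))"
      by (simp add: \<tau>_diff \<tau>_scaleR M)
    moreover have "0 \<le> Re (\<tau> (op_adjoint u o\<^sub>L u))"
      using \<tau>_square[of u] by (simp add: u_def M complex_nonneg_Reals_iff)
    moreover have "0 \<le> e * Re (\<tau> (p o\<^sub>L r))"
      using \<tau>_positive(1)[OF _ r(3)] e by (simp add: M)
    moreover have "\<tau> (K o\<^sub>L x) = \<tau> (x o\<^sub>L K)"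
      by (rule \<tau>_commute) (simp_all add: M)
    \<comment> \<open>Traciality rewrites \<open>\<tau>(K q K)\<close> as
      \<open>\<tau>(\<rho> K\<^sup>2 \<rho>)\<close>, and \<open>K\<^sup>2 \<le> 1\<close> gives
      \<open>\<rho> K\<^sup>2 \<rho> \<le> \<rho>\<^sup>2 = q\<close>.\<close>
    moreover have "Re (\<tau> (K o\<^sub>L (q o\<^sub>L K))) \<le> Re (\<tau> p) + e"
    proof -
      have "\<tau> (K o\<^sub>L (q o\<^sub>L K)) = \<tau> ((K o\<^sub>L \<rho>) o\<^sub>L (\<rho> o\<^sub>L K))"
        by (simp add: \<rho>\<rho>[symmetric] comp_assoc)
      also have "\<dots> = \<tau> ((\<rho> o\<^sub>L K) o\<^sub>L (K o\<^sub>L \<rho>))"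
        by (rule \<tau>_commute) (simp_all add: M)
      finally have 1: "\<tau> (K o\<^sub>L (q o\<^sub>L K)) = \<tau> ((\<rho> o\<^sub>L K) o\<^sub>L (K o\<^sub>L \<rho>))" .
      have "positive_op (q - ((\<rho> o\<^sub>L K) o\<^sub>L (K o\<^sub>L \<rho>)))"
        unfolding positive_op_iff
      proof (intro conjI allI)
        note s\<rho> = sa_bicommutant_self_adjoint[OF \<rho>]
        have "op_adjoint ((\<rho> o\<^sub>L K) o\<^sub>L (K o\<^sub>L \<rho>)) = (\<rho> o\<^sub>L K) o\<^sub>L (K o\<^sub>L \<rho>)"
          using sK s\<rho> by (simp add: self_adjoint_def op_adjoint_comp complex_linear_comp)
        then show "self_adjoint (q - ((\<rho> o\<^sub>L K) o\<^sub>L (K o\<^sub>L \<rho>)))"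
          using sa_bicommutant_self_adjoint[OF q] sK s\<rho>
          by (intro self_adjoint_diff) (auto simp: self_adjoint_def complex_linear_comp)
        fix v
        let ?w = "blinfun_apply \<rho> v"
        have "blinfun_apply ((\<rho> o\<^sub>L K) o\<^sub>L (K o\<^sub>L \<rho>)) v \<bullet> v = (norm (blinfun_apply K ?w))\<^sup>2"
          by (simp add: power2_norm_eq_inner self_adjoint_inner[OF s\<rho>] self_adjoint_inner[OF sK])
        also have "\<dots> \<le> (1 * norm ?w)\<^sup>2"
          using norm_blinfun[of K ?w] mult_right_mono[OF nK norm_ge_zero[of ?w]]
          by (intro power_mono) simp_all
        also have "\<dots> = blinfun_apply q v \<bullet> v"
          by (simp add: power2_norm_eq_inner self_adjoint_inner[OF s\<rho>] flip: \<rho>\<rho>)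
        finally show "0 \<le> blinfun_apply (q - ((\<rho> o\<^sub>L K) o\<^sub>L (K o\<^sub>L \<rho>))) v \<bullet> v"
          by (simp add: blinfun.diff_left inner_diff_left)
      qed
      then have "Re (\<tau> ((\<rho> o\<^sub>L K) o\<^sub>L (K o\<^sub>L \<rho>))) \<le> Re (\<tau> q)"
        by (rule \<tau>_mono[rotated 2]) (simp_all add: M)
      also have "Re (\<tau> q) = Re (\<tau> p) + e"
        by (simp add: q_def \<tau>_add \<tau>_scaleR M)
      finally show ?thesis
        by (simp add: 1)
    qed
    ultimately show ?thesis
      using e by (simp add: p_def)
  qed
  then show ?thesis
    unfolding L1_norm_def by (rule field_le_epsilon)
qed

text \<open>The witness is the regularised sign \<open>x r\<close>, at a loss of
  \<open>e \<tau>(|x| r) \<le> e\<close>. Since it lies in the bicommutant of x, it belongs to the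
  smaller algebra whenever x does, and \<open>L1_norm_contraction\<close> rests on this.\<close>

lemma L1_norm_attained:
  assumes x: "x \<in> hermitian_part M" and e: "0 < e"
  obtains K where "K \<in> sa_bicommutant x" "norm K \<le> 1" "L1_norm \<tau> x - e \<le> Re (\<tau> (x o\<^sub>L K))"
proof -
  have sx: "self_adjoint x"
    using x by (auto simp: hermitian_part_iff)
  obtain r where r: "r \<in> sa_bicommutant x" "positive_op (id_blinfun - (op_abs x o\<^sub>L r))"
    "norm (x o\<^sub>L r) \<le> 1" "x o\<^sub>L (x o\<^sub>L r) = op_abs x - e *\<^sub>R (op_abs x o\<^sub>L r)"
    using positive_commuting_resolvent[OF sx e] by metis
  have in_M: "T \<in> M" if "T \<in> sa_bicommutant x" for T
    using that sa_bicommutant_hermitian_part[OF x] hermitian_part_M by blast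
  note M = in_M[OF r(1)] in_M[OF op_abs_self_adjoint(1)[OF sx]] M_comp M_scaleR
  have "Re (\<tau> (op_abs x o\<^sub>L r)) \<le> 1"
    using \<tau>_mono[OF _ _ r(2)] by (simp add: M)
  then have "e * Re (\<tau> (op_abs x o\<^sub>L r)) \<le> e"
    using e by simp
  then have "L1_norm \<tau> x - e \<le> Re (\<tau> (x o\<^sub>L (x o\<^sub>L r)))"
    unfolding r(4) L1_norm_def by (simp add: \<tau>_diff \<tau>_scaleR M)
  with that[of "x o\<^sub>L r"] r show ?thesis
    by (simp add: sa_bicommutant_comp sa_bicommutant_self sx)
qed

lemma trace_comp_le_L1_norm:
  assumes x: "x \<in> hermitian_part M" and K: "K \<in> hermitian_part M"
  shows "cmod (\<tau> (x o\<^sub>L K)) \<le> norm K * L1_norm \<tau> x"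
proof (cases "K = 0")
  case True
  then show ?thesis
    by simp
next
  case False
  have "Re (\<tau> (x o\<^sub>L (r *\<^sub>R K))) \<le> L1_norm \<tau> x" if "\<bar>r\<bar> = 1 / norm K" for r
    using that False by (intro trace_le_L1_norm x hermitian_part_scaleR K) simp
  from this[of "1 / norm K"] this[of "- (1 / norm K)"] False
  have "\<bar>Re (\<tau> (x o\<^sub>L K))\<bar> \<le> norm K * L1_norm \<tau> x"
    using x K by (simp add: comp_bilinear \<tau>_scaleR[of _ "_ / _"] \<tau>_scaleR[of _ "- _"] \<tau>_scaleR
        M_comp hermitian_part_M field_simps abs_le_iff del: scaleR_minus_left)
  then show ?thesis
    using \<tau>_comp_hermitian_real[OF x K] by (simp add: cmod_eq_Re)
qed

section \<open>Norm properties of \<tau>(|x|) on hermitian elements\<close>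

lemma L1_norm_nonneg: "x \<in> hermitian_part M \<Longrightarrow> 0 \<le> L1_norm \<tau> x"
  using trace_le_L1_norm[of x 0] by simp

text \<open>The operator absolute value is not subadditive in general. The trace norm is, by
  duality: a K that nearly attains it for x + y can be tested on x and on y separately.\<close>

lemma L1_norm_triangle:
  assumes x: "x \<in> hermitian_part M" and y: "y \<in> hermitian_part M"
  shows "L1_norm \<tau> (x + y) \<le> L1_norm \<tau> x + L1_norm \<tau> y"
proof (rule field_le_epsilon)
  fix e :: real assume e: "0 < e"
  have xy: "x + y \<in> hermitian_part M"
    using x y by (rule hermitian_part_add)
  obtain K where K: "K \<in> sa_bicommutant (x + y)" "norm K \<le> 1"
    "L1_norm \<tau> (x + y) - e \<le> Re (\<tau> ((x + y) o\<^sub>L K))"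
    using L1_norm_attained[OF xy e] by blast
  have KM: "K \<in> hermitian_part M"
    using K(1) sa_bicommutant_hermitian_part[OF xy] by blast
  have "\<tau> ((x + y) o\<^sub>L K) = \<tau> (x o\<^sub>L K) + \<tau> (y o\<^sub>L K)"
    using x y KM by (simp add: comp_add_left \<tau>_add M_comp hermitian_part_M)
  then show "L1_norm \<tau> (x + y) \<le> L1_norm \<tau> x + L1_norm \<tau> y + e"
    using K(3) trace_le_L1_norm[OF x KM K(2)] trace_le_L1_norm[OF y KM K(2)] by simp
qed

lemma L1_norm_commute:
  assumes "x \<in> hermitian_part M" "y \<in> hermitian_part M"
  shows "L1_norm \<tau> (x - y) = L1_norm \<tau> (y - x)"
proof -
  have "op_adjoint (x - y) o\<^sub>L (x - y) = op_adjoint (y - x) o\<^sub>L (y - x)"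
    using hermitian_part_diff[OF assms] hermitian_part_diff[OF assms(2,1)]
    by (simp add: hermitian_part_def comp_bilinear)
  then show ?thesis
    by (simp add: L1_norm_def op_abs_def)
qed

lemma L1_norm_diff_triangle:
  assumes "x \<in> hermitian_part M" "y \<in> hermitian_part M" "z \<in> hermitian_part M"
  shows "L1_norm \<tau> (x - z) \<le> L1_norm \<tau> (x - y) + L1_norm \<tau> (y - z)"
  using L1_norm_triangle[of "x - y" "y - z"] assms by (simp add: hermitian_part_diff)

lemma L1_norm_0 [simp]: "L1_norm \<tau> 0 = 0"
proof (rule antisym)
  show "L1_norm \<tau> 0 \<le> 0"
  proof (rule field_le_epsilon)
    fix e :: real assume "0 < e"
    from L1_norm_attained[OF hermitian_part_0 this] show "L1_norm \<tau> 0 \<le> 0 + e"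
      by (metis add_0 comp_zero_left
          diff_le_eq \<tau>_0 zero_complex.sel(1))
  qed
qed (simp add: L1_norm_nonneg)

end

section \<open>The \<open>L\<^sup>1\<close>-completion\<close>

context tracial_vna
begin

abbreviation L1_class :: "(nat \<Rightarrow> 'h op) \<Rightarrow> (nat \<Rightarrow> 'h op) set" where
  "L1_class X \<equiv> L1_equiv (hermitian_part M) \<tau> `` {X}"

lemma trace_comp_diff_le:
  assumes "x \<in> hermitian_part M" "y \<in> hermitian_part M" "K \<in> hermitian_part M"
  shows "dist (\<tau> (x o\<^sub>L K)) (\<tau> (y o\<^sub>L K)) \<le> norm K * L1_norm \<tau> (x - y)"
  using trace_comp_le_L1_norm[OF hermitian_part_diff[OF assms(1,2)] assms(3)] assms
  by (simp add: comp_diff_left \<tau>_diff M_comp hermitian_part_M dist_norm)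

lemma L1_norm_quadrilateral:
  assumes "a \<in> hermitian_part M" "b \<in> hermitian_part M" "c \<in> hermitian_part M" "d \<in> hermitian_part M"
  shows "dist (L1_norm \<tau> (a - b)) (L1_norm \<tau> (c - d)) \<le> L1_norm \<tau> (a - c) + L1_norm \<tau> (b - d)"
  using L1_norm_diff_triangle[OF assms(1,3,2)] L1_norm_diff_triangle[OF assms(3,4,2)]
    L1_norm_diff_triangle[OF assms(3,1,4)] L1_norm_diff_triangle[OF assms(1,2,4)]
    L1_norm_commute[OF assms(1,3)] L1_norm_commute[OF assms(2,4)]
  by (simp add: dist_real_def abs_le_iff)

lemma L1_CauchyD: "X \<in> L1_Cauchy (hermitian_part M) \<tau> \<Longrightarrow> X k \<in> hermitian_part M"
  by (auto simp: L1_Cauchy_def)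

lemma L1_Cauchy_tail:
  assumes "X \<in> L1_Cauchy (hermitian_part M) \<tau>" "e > 0"
  obtains N where "\<And>i j. i \<ge> N \<Longrightarrow> j \<ge> N \<Longrightarrow> L1_norm \<tau> (X i - X j) < e"
proof -
  have "\<exists>N. \<forall>i\<ge>N. \<forall>j\<ge>N. L1_norm \<tau> (X i - X j) < e"
    using assms by (simp add: L1_Cauchy_def)
  then show ?thesis
    using that by blast
qed

lemma L1_Cauchy_const: "x \<in> hermitian_part M \<Longrightarrow> (\<lambda>_. x) \<in> L1_Cauchy (hermitian_part M) \<tau>"
  by (simp add: L1_Cauchy_def)

lemma L1_equiv_refl: "X \<in> L1_Cauchy (hermitian_part M) \<tau> \<Longrightarrow> X \<in> L1_class X"
  by (simp add: L1_equiv_def)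

text \<open>\<open>L1_trace\<close> and \<open>L1_dist\<close> work with a representative picked by
  Hilbert choice; this relates the pick to a given sequence.\<close>

lemma L1_class_rep:
  assumes "X \<in> L1_Cauchy (hermitian_part M) \<tau>"
  shows "(SOME R. R \<in> L1_class X) \<in> L1_Cauchy (hermitian_part M) \<tau>"
    "(\<lambda>k. L1_norm \<tau> (X k - (SOME R. R \<in> L1_class X) k)) \<longlonglongrightarrow> 0"
proof -
  have "(SOME R. R \<in> L1_class X) \<in> L1_class X"
    by (rule someI[where P="\<lambda>R. R \<in> L1_class X"]) (rule L1_equiv_refl[OF assms])
  then show "(SOME R. R \<in> L1_class X) \<in> L1_Cauchy (hermitian_part M) \<tau>"
    "(\<lambda>k. L1_norm \<tau> (X k - (SOME R. R \<in> L1_class X) k)) \<longlonglongrightarrow> 0"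
    by (auto simp: L1_equiv_def)
qed

text \<open>\<open>lim\<close> is informative only for convergent sequences, so the pairings of the
  chosen representative are first shown to be Cauchy. The limit then passes to X because the two
  sequences differ by an \<open>L\<^sup>1\<close>-null sequence.\<close>

lemma L1_trace_tendsto:
  assumes X: "X \<in> L1_Cauchy (hermitian_part M) \<tau>" and K: "K \<in> hermitian_part M"
  shows "(\<lambda>k. \<tau> (X k o\<^sub>L K)) \<longlonglongrightarrow> L1_trace \<tau> (L1_class X) K"
proof -
  define R where "R = (SOME R. R \<in> L1_class X)"
  note R = L1_class_rep[OF X, folded R_def]
  have "Cauchy (\<lambda>k. \<tau> (R k o\<^sub>L K))"
  proof (rule metric_CauchyI)
    fix e :: real assume e: "e > 0"
    \<comment> \<open>The added 1 covers K = 0.\<close>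
    have "e / (norm K + 1) > 0"
      using e by (simp add: add_nonneg_pos)
    then obtain N where N: "\<And>i j. i \<ge> N \<Longrightarrow> j \<ge> N \<Longrightarrow> L1_norm \<tau> (R i - R j) < e / (norm K + 1)"
      using L1_Cauchy_tail[OF R(1)] by metis
    have "dist (\<tau> (R i o\<^sub>L K)) (\<tau> (R j o\<^sub>L K)) < e" if "i \<ge> N" "j \<ge> N" for i j
    proof -
      have "dist (\<tau> (R i o\<^sub>L K)) (\<tau> (R j o\<^sub>L K)) \<le> norm K * L1_norm \<tau> (R i - R j)"
        by (intro trace_comp_diff_le L1_CauchyD R K)
      also have "\<dots> \<le> (norm K + 1) * L1_norm \<tau> (R i - R j)"
        by (intro mult_right_mono L1_norm_nonneg hermitian_part_diff L1_CauchyD R) simp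
      also have "\<dots> < e"
        using N[OF that] by (simp add: pos_less_divide_eq add_nonneg_pos mult.commute)
      finally show ?thesis .
    qed
    then show "\<exists>N. \<forall>m\<ge>N. \<forall>n\<ge>N. dist (\<tau> (R m o\<^sub>L K)) (\<tau> (R n o\<^sub>L K)) < e"
      by blast
  qed
  then have lim: "(\<lambda>k. \<tau> (R k o\<^sub>L K)) \<longlonglongrightarrow> L1_trace \<tau> (L1_class X) K"
    unfolding L1_trace_def R_def[symmetric] by (simp add: Cauchy_convergent convergent_LIMSEQ_iff[symmetric])
  have "(\<lambda>k. dist (\<tau> (X k o\<^sub>L K)) (\<tau> (R k o\<^sub>L K))) \<longlonglongrightarrow> 0"
  proof (rule tendsto_sandwich[OF _ _ tendsto_const])
    show "(\<lambda>k. norm K * L1_norm \<tau> (X k - R k)) \<longlonglongrightarrow> 0"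
      by (intro tendsto_mult_right_zero R)
    show "\<forall>\<^sub>F k in sequentially. dist (\<tau> (X k o\<^sub>L K)) (\<tau> (R k o\<^sub>L K)) \<le> norm K * L1_norm \<tau> (X k - R k)"
      by (intro always_eventually allI trace_comp_diff_le L1_CauchyD X R K)
  qed simp
  then show ?thesis
    unfolding dist_norm by (rule Lim_transform[OF lim tendsto_norm_zero_cancel])
qed

lemma L1_dist_tendsto:
  assumes X: "X \<in> L1_Cauchy (hermitian_part M) \<tau>" and Y: "Y \<in> L1_Cauchy (hermitian_part M) \<tau>"
  shows "(\<lambda>k. L1_norm \<tau> (X k - Y k)) \<longlonglongrightarrow> L1_dist \<tau> (L1_class X) (L1_class Y)"
proof -
  define R where "R = (SOME R. R \<in> L1_class X)"
  define S where "S = (SOME R. R \<in> L1_class Y)"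
  note R = L1_class_rep[OF X, folded R_def] and S = L1_class_rep[OF Y, folded S_def]
  have "Cauchy (\<lambda>k. L1_norm \<tau> (R k - S k))"
  proof (rule metric_CauchyI)
    fix e :: real assume e: "e > 0"
    obtain N where N: "\<And>i j. i \<ge> N \<Longrightarrow> j \<ge> N \<Longrightarrow> L1_norm \<tau> (R i - R j) < e / 2"
      using L1_Cauchy_tail[OF R(1) half_gt_zero[OF e]] by metis
    obtain N' where N': "\<And>i j. i \<ge> N' \<Longrightarrow> j \<ge> N' \<Longrightarrow> L1_norm \<tau> (S i - S j) < e / 2"
      using L1_Cauchy_tail[OF S(1) half_gt_zero[OF e]] by metis
    have "dist (L1_norm \<tau> (R i - S i)) (L1_norm \<tau> (R j - S j)) < e"
      if "i \<ge> max N N'" "j \<ge> max N N'" for i j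
      using L1_norm_quadrilateral[of "R i" "S i" "R j" "S j"] N[of i j] N'[of i j] that
        L1_CauchyD[OF R(1)] L1_CauchyD[OF S(1)] by simp
    then show "\<exists>N. \<forall>m\<ge>N. \<forall>n\<ge>N. dist (L1_norm \<tau> (R m - S m)) (L1_norm \<tau> (R n - S n)) < e"
      by blast
  qed
  then have lim: "(\<lambda>k. L1_norm \<tau> (R k - S k)) \<longlonglongrightarrow> L1_dist \<tau> (L1_class X) (L1_class Y)"
    unfolding L1_dist_def R_def[symmetric] S_def[symmetric]
    by (simp add: Cauchy_convergent convergent_LIMSEQ_iff[symmetric])
  have "(\<lambda>k. dist (L1_norm \<tau> (X k - Y k)) (L1_norm \<tau> (R k - S k))) \<longlonglongrightarrow> 0"
  proof (rule tendsto_sandwich[OF _ _ tendsto_const])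
    show "(\<lambda>k. L1_norm \<tau> (X k - R k) + L1_norm \<tau> (Y k - S k)) \<longlonglongrightarrow> 0"
      using tendsto_add[OF R(2) S(2)] by simp
    show "\<forall>\<^sub>F k in sequentially. dist (L1_norm \<tau> (X k - Y k)) (L1_norm \<tau> (R k - S k))
        \<le> L1_norm \<tau> (X k - R k) + L1_norm \<tau> (Y k - S k)"
      by (intro always_eventually allI L1_norm_quadrilateral L1_CauchyD X Y R S)
  qed simp
  then show ?thesis
    unfolding dist_norm by (rule Lim_transform[OF lim tendsto_norm_zero_cancel])
qed

lemma L1_dist_nonneg:
  assumes "X \<in> L1_Cauchy (hermitian_part M) \<tau>" "Y \<in> L1_Cauchy (hermitian_part M) \<tau>"
  shows "0 \<le> L1_dist \<tau> (L1_class X) (L1_class Y)"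
  by (rule LIMSEQ_le_const[OF L1_dist_tendsto[OF assms]])
    (use assms in \<open>auto intro: L1_norm_nonneg hermitian_part_diff L1_CauchyD\<close>)

end

text \<open>The K that nearly attains the norm of y lies in A, where the pairings with y and x
  agree, and it is an admissible test element for x in B.\<close>

lemma L1_norm_contraction:
  assumes A: "tracial_vna A \<alpha>" and B: "tracial_vna B \<beta>"
    and sub: "hermitian_part A \<subseteq> hermitian_part B"
    and y: "y \<in> hermitian_part A" and x: "x \<in> hermitian_part B"
    and eq: "\<And>K. K \<in> hermitian_part A \<Longrightarrow> \<alpha> (y o\<^sub>L K) = \<beta> (x o\<^sub>L K)"
  shows "L1_norm \<alpha> y \<le> L1_norm \<beta> x"
proof (rule field_le_epsilon)
  interpret A: tracial_vna A \<alpha> by fact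
  interpret B: tracial_vna B \<beta> by fact
  fix e :: real assume "0 < e"
  then obtain K where K: "K \<in> sa_bicommutant y" "norm K \<le> 1" "L1_norm \<alpha> y - e \<le> Re (\<alpha> (y o\<^sub>L K))"
    using A.L1_norm_attained[OF y] by blast
  have "K \<in> hermitian_part A"
    using K(1) A.sa_bicommutant_hermitian_part[OF y] by blast
  then show "L1_norm \<alpha> y \<le> L1_norm \<beta> x + e"
    using K(3) eq B.trace_le_L1_norm[OF x _ K(2)] sub by fastforce
qed

text \<open>If every \<open>g \<in> G'\<close> has a conditional expectation in \<open>G\<close>, so does the closure.\<close>

lemma L1_closure_transfer:
  fixes G :: "('h::complex_hilbert_space op ^ 'n) set" and G' :: "('h op ^ 'k) set" and \<iota> :: "'n \<Rightarrow> 'k"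
  assumes A: "tracial_vna A \<alpha>" and B: "tracial_vna B \<beta>"
    and sub: "hermitian_part A \<subseteq> hermitian_part B"
    and G: "G \<subseteq> hermitian_tuples A" and G': "G' \<subseteq> hermitian_tuples B"
    and proj: "\<And>g. g \<in> G' \<Longrightarrow>
      \<exists>h\<in>G. \<forall>j. \<forall>K\<in>hermitian_part A. \<alpha> (h $ j o\<^sub>L K) = \<beta> (g $ \<iota> j o\<^sub>L K)"
    and T: "T \<in> L1_closure (hermitian_part B) \<beta> G'"
  obtains T' where "T' \<in> L1_closure (hermitian_part A) \<alpha> G"
    "\<And>j K. K \<in> hermitian_part A \<Longrightarrow> L1_trace \<alpha> (T' $ j) K = L1_trace \<beta> (T $ \<iota> j) K"
proof -
  interpret A: tracial_vna A \<alpha> by fact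
  interpret B: tracial_vna B \<beta> by fact
  have "\<exists>X. X \<in> L1_Cauchy (hermitian_part B) \<beta> \<and> T $ k = B.L1_class X" for k
  proof -
    have "T $ k \<in> L1_space (hermitian_part B) \<beta>"
      using T by (simp add: L1_closure_def)
    then show ?thesis
      unfolding L1_space_def by (elim quotientE) blast
  qed
  then obtain X where X: "\<And>k. X k \<in> L1_Cauchy (hermitian_part B) \<beta>"
    and T_eq: "\<And>k. T $ k = B.L1_class (X k)"
    by metis
  have "\<exists>g\<in>G'. (\<Sum>k\<in>UNIV. L1_dist \<beta> (T $ k) (L1_embed (hermitian_part B) \<beta> (g $ k))) < 1 / real (Suc i)"
    for i
    using T unfolding L1_closure_def by simp
  then obtain g where g: "\<And>i. g i \<in> G'"
    and sum_lt: "\<And>i. (\<Sum>k\<in>UNIV. L1_dist \<beta> (T $ k) (L1_embed (hermitian_part B) \<beta> (g i $ k))) < 1 / real (Suc i)"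
    by metis
  obtain h where h: "\<And>i. h i \<in> G"
    and hg: "\<And>i j K. K \<in> hermitian_part A \<Longrightarrow> \<alpha> (h i $ j o\<^sub>L K) = \<beta> (g i $ \<iota> j o\<^sub>L K)"
    using proj[OF g] by metis
  have g_herm: "g i $ k \<in> hermitian_part B" for i k
    using g G' by (auto simp: hermitian_tuples_def)
  have h_herm: "h i $ j \<in> hermitian_part A" for i j
    using h G by (auto simp: hermitian_tuples_def)
  define d where "d i k = L1_dist \<beta> (B.L1_class (X k)) (B.L1_class (\<lambda>_. g i $ k))" for i k
  have d_lim: "(\<lambda>n. L1_norm \<beta> (X k n - g i $ k)) \<longlonglongrightarrow> d i k" for i k
    unfolding d_def by (intro B.L1_dist_tendsto X B.L1_Cauchy_const g_herm)
  have d_less: "d i k < 1 / real (Suc i)" for i k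
  proof -
    have "d i k \<le> (\<Sum>k\<in>UNIV. d i k)"
      by (rule member_le_sum)
        (auto simp: d_def intro!: B.L1_dist_nonneg X B.L1_Cauchy_const g_herm)
    then show ?thesis
      using sum_lt[of i] by (simp add: d_def T_eq L1_embed_def)
  qed
  \<comment> \<open>The \<open>g i\<close> are within \<open>1 / Suc i\<close> of T and hence Cauchy
    at an explicit rate. The contraction hands this rate to the \<open>h i\<close>, which therefore
    define an element T' of the completion themselves.\<close>
  have gg: "L1_norm \<beta> (g i $ k - g l $ k) \<le> 1 / real (Suc i) + 1 / real (Suc l)" for i l k
  proof -
    have "L1_norm \<beta> (g i $ k - g l $ k) \<le> d i k + d l k"
    proof (rule LIMSEQ_le_const[OF tendsto_add[OF d_lim d_lim]], intro exI allI impI)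
      fix n
      have "L1_norm \<beta> (g i $ k - g l $ k) \<le> L1_norm \<beta> (g i $ k - X k n) + L1_norm \<beta> (X k n - g l $ k)"
        by (intro B.L1_norm_diff_triangle g_herm B.L1_CauchyD X)
      then show "L1_norm \<beta> (g i $ k - g l $ k) \<le> L1_norm \<beta> (X k n - g i $ k) + L1_norm \<beta> (X k n - g l $ k)"
        using B.L1_norm_commute[OF g_herm[of i k] B.L1_CauchyD[OF X[of k], of n]] by simp
    qed
    then show ?thesis
      using d_less[of i k] d_less[of l k] by linarith
  qed
  have hh: "L1_norm \<alpha> (h i $ j - h l $ j) \<le> 1 / real (Suc i) + 1 / real (Suc l)" for i l j
  proof -
    have "L1_norm \<alpha> (h i $ j - h l $ j) \<le> L1_norm \<beta> (g i $ \<iota> j - g l $ \<iota> j)"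
    proof (rule L1_norm_contraction[OF A B sub])
      show "\<alpha> ((h i $ j - h l $ j) o\<^sub>L K) = \<beta> ((g i $ \<iota> j - g l $ \<iota> j) o\<^sub>L K)"
        if K: "K \<in> hermitian_part A" for K
      proof -
        have "K \<in> hermitian_part B"
          using K sub by blast
        then show ?thesis
          using K by (simp add: comp_diff_left A.\<tau>_diff B.\<tau>_diff A.M_comp B.M_comp hg
              A.hermitian_part_M[OF h_herm] B.hermitian_part_M[OF g_herm]
              A.hermitian_part_M B.hermitian_part_M)
      qed
    qed (intro A.hermitian_part_diff B.hermitian_part_diff h_herm g_herm)+
    then show ?thesis
      using gg[of i "\<iota> j" l] by linarith
  qed
  have inv_small: "\<exists>N. \<forall>i\<ge>N. c / real (Suc i) < e" if "e > 0" for c e :: real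
  proof -
    have "(\<lambda>i. c / real (Suc i)) \<longlonglongrightarrow> 0"
      by (rule LIMSEQ_Suc[OF lim_const_over_n])
    from order_tendstoD(2)[OF this that] show ?thesis
      by (simp add: eventually_sequentially)
  qed
  have h_Cauchy: "(\<lambda>i. h i $ j) \<in> L1_Cauchy (hermitian_part A) \<alpha>" for j
    unfolding L1_Cauchy_def mem_Collect_eq
  proof (intro conjI allI impI)
    show "range (\<lambda>i. h i $ j) \<subseteq> hermitian_part A"
      using h_herm by blast
    fix e :: real assume "e > 0"
    then obtain N where N: "\<And>i. i \<ge> N \<Longrightarrow> 1 / real (Suc i) < e / 2"
      using inv_small[of "e / 2" 1] by auto
    have "L1_norm \<alpha> (h i $ j - h l $ j) < e" if "i \<ge> N" "l \<ge> N" for i l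
      using hh[of i j l] N[OF that(1)] N[OF that(2)] by linarith
    then show "\<exists>N. \<forall>i\<ge>N. \<forall>l\<ge>N. L1_norm \<alpha> (h i $ j - h l $ j) < e"
      by blast
  qed
  define T' where "T' = (\<chi> j. A.L1_class (\<lambda>i. h i $ j))"
  show ?thesis
  proof
    have "\<exists>f\<in>G. (\<Sum>j\<in>UNIV. L1_dist \<alpha> (T' $ j) (L1_embed (hermitian_part A) \<alpha> (f $ j))) < e"
      if e: "e > 0" for e
    proof -
      obtain i where i: "real CARD('n) / real (Suc i) < e"
        using inv_small[OF e] by blast
      have "L1_dist \<alpha> (T' $ j) (L1_embed (hermitian_part A) \<alpha> (h i $ j)) \<le> 1 / real (Suc i)" for j
      proof -
        have "(\<lambda>n. 1 / real (Suc n) + 1 / real (Suc i)) \<longlonglongrightarrow> 0 + 1 / real (Suc i)"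
          by (intro tendsto_intros LIMSEQ_Suc[OF lim_1_over_n])
        moreover have "(\<lambda>n. L1_norm \<alpha> (h n $ j - h i $ j))
            \<longlonglongrightarrow> L1_dist \<alpha> (T' $ j) (L1_embed (hermitian_part A) \<alpha> (h i $ j))"
          unfolding T'_def vec_lambda_beta L1_embed_def
          by (rule A.L1_dist_tendsto[OF h_Cauchy A.L1_Cauchy_const[OF h_herm]])
        ultimately have "L1_dist \<alpha> (T' $ j) (L1_embed (hermitian_part A) \<alpha> (h i $ j)) \<le> 0 + 1 / real (Suc i)"
          using hh by (intro LIMSEQ_le) blast+
        then show ?thesis
          by simp
      qed
      then have "(\<Sum>j\<in>UNIV. L1_dist \<alpha> (T' $ j) (L1_embed (hermitian_part A) \<alpha> (h i $ j)))
          \<le> (\<Sum>j\<in>(UNIV::'n set). 1 / real (Suc i))"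
        by (intro sum_mono)
      also have "\<dots> < e"
        using i by simp
      finally show ?thesis
        using h by blast
    qed
    moreover have "T' $ j \<in> L1_space (hermitian_part A) \<alpha>" for j
      using h_Cauchy by (auto simp: T'_def L1_space_def intro: quotientI)
    ultimately show "T' \<in> L1_closure (hermitian_part A) \<alpha> G"
      by (auto simp: L1_closure_def)
  next
    fix j K assume K: "K \<in> hermitian_part A"
    then have KB: "K \<in> hermitian_part B"
      using sub by blast
    have "(\<lambda>i. \<beta> (g i $ \<iota> j o\<^sub>L K)) \<longlonglongrightarrow> L1_trace \<alpha> (T' $ j) K"
      using A.L1_trace_tendsto[OF h_Cauchy K] by (simp add: T'_def hg[OF K])
    moreover have "(\<lambda>i. \<beta> (g i $ \<iota> j o\<^sub>L K)) \<longlonglongrightarrow> L1_trace \<beta> (T $ \<iota> j) K"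
    proof (rule metric_tendsto_imp_tendsto[where f="\<lambda>i. norm K / real (Suc i)" and a=0])
      show "(\<lambda>i. norm K / real (Suc i)) \<longlonglongrightarrow> 0"
        by (rule LIMSEQ_Suc[OF lim_const_over_n])
      have "dist (\<beta> (g i $ \<iota> j o\<^sub>L K)) (L1_trace \<beta> (T $ \<iota> j) K) \<le> norm K / real (Suc i)" for i
      proof -
        have "dist (\<beta> (g i $ \<iota> j o\<^sub>L K)) (L1_trace \<beta> (T $ \<iota> j) K) \<le> norm K * d i (\<iota> j)"
        proof (rule LIMSEQ_le)
          show "(\<lambda>n. dist (\<beta> (g i $ \<iota> j o\<^sub>L K)) (\<beta> (X (\<iota> j) n o\<^sub>L K)))
              \<longlonglongrightarrow> dist (\<beta> (g i $ \<iota> j o\<^sub>L K)) (L1_trace \<beta> (T $ \<iota> j) K)"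
            unfolding T_eq by (intro tendsto_intros B.L1_trace_tendsto X KB)
          show "(\<lambda>n. norm K * L1_norm \<beta> (X (\<iota> j) n - g i $ \<iota> j)) \<longlonglongrightarrow> norm K * d i (\<iota> j)"
            by (intro tendsto_intros d_lim)
          show "\<exists>N. \<forall>n\<ge>N. dist (\<beta> (g i $ \<iota> j o\<^sub>L K)) (\<beta> (X (\<iota> j) n o\<^sub>L K))
              \<le> norm K * L1_norm \<beta> (X (\<iota> j) n - g i $ \<iota> j)"
            using B.trace_comp_diff_le[OF B.L1_CauchyD[OF X] g_herm KB] by (simp add: dist_commute)
        qed
        also have "\<dots> \<le> norm K * (1 / real (Suc i))"
          using d_less[of i "\<iota> j"] by (intro mult_left_mono) auto
        finally show ?thesis
          by simp
      qed
      then show "\<forall>\<^sub>F i in sequentially. dist (\<beta> (g i $ \<iota> j o\<^sub>L K)) (L1_trace \<beta> (T $ \<iota> j) K)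
          \<le> dist (norm K / real (Suc i)) 0"
        by simp
    qed
    ultimately show "L1_trace \<alpha> (T' $ j) K = L1_trace \<beta> (T $ \<iota> j) K"
      by (rule LIMSEQ_unique)
  qed
qed

section \<open>Derivatives of traces of noncommutative polynomials\<close>

lemma op_prod_Nil [simp]: "op_prod [] = id_blinfun"
  and op_prod_Cons [simp]: "op_prod (x # xs) = x o\<^sub>L op_prod xs"
  by (simp_all add: op_prod_def)

lemma op_prod_append [simp]: "op_prod (xs @ ys) = op_prod xs o\<^sub>L op_prod ys"
  by (induction xs) (simp_all add: comp_assoc)

lemma op_scaleC_0 [simp]: "op_scaleC 0 T = 0"
  by (rule blinfun_eqI) simp

lemma op_scaleC_1 [simp]: "op_scaleC 1 T = T"
  by (rule blinfun_eqI) simp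

lemma op_scaleC_add_left: "op_scaleC (a + b) T = op_scaleC a T + op_scaleC b T"
  by (rule blinfun_eqI) (simp add: scaleC_add_left blinfun.bilinear_simps)

lemma op_scaleC_comp_left: "op_scaleC c S o\<^sub>L T = op_scaleC c (S o\<^sub>L T)"
  by (rule blinfun_eqI) simp

lemma op_scaleC_comp_right: "complex_linear S \<Longrightarrow> S o\<^sub>L op_scaleC c T = op_scaleC c (S o\<^sub>L T)"
  by (rule blinfun_eqI) (simp add: complex_linearD)

abbreviation word_eval :: "'h::complex_hilbert_space op ^ 'n \<Rightarrow> 'n list \<Rightarrow> 'h op" where
  "word_eval X w \<equiv> op_prod (map (\<lambda>i. X $ i) w)"

lemma nc_eval_superset:
  assumes "finite S" "Poly_Mapping.keys P \<subseteq> S"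
  shows "nc_eval X P = (\<Sum>w\<in>S. op_scaleC (Poly_Mapping.lookup P w) (word_eval X w))"
  unfolding nc_eval_def
  by (rule sum.mono_neutral_left) (use assms in \<open>auto simp: in_keys_iff\<close>)

lemma nc_eval_zero [simp]: "nc_eval X 0 = 0"
  by (simp add: nc_eval_def)

lemma nc_eval_add: "nc_eval X (P + Q) = nc_eval X P + nc_eval X Q"
proof -
  let ?S = "Poly_Mapping.keys P \<union> Poly_Mapping.keys Q"
  have "Poly_Mapping.keys (P + Q) \<subseteq> ?S"
    by (rule Poly_Mapping.keys_add)
  then show ?thesis
    by (simp add: nc_eval_superset[of ?S] lookup_add op_scaleC_add_left sum.distrib)
qed

lemma nc_eval_sum: "nc_eval X (sum P I) = (\<Sum>i\<in>I. nc_eval X (P i))"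
  by (induction I rule: infinite_finite_induct) (simp_all add: nc_eval_add)

lemma nc_eval_single: "nc_eval X (Poly_Mapping.single w c) = op_scaleC c (word_eval X w)"
  by (simp add: nc_eval_def)

lemma word_eval_derivative:
  "((\<lambda>t. word_eval (X + t *\<^sub>R K) w) has_vector_derivative
    (\<Sum>k<length w. word_eval X (take k w) o\<^sub>L (K $ (w ! k) o\<^sub>L word_eval X (drop (Suc k) w)))) (at 0)"
proof (induction w)
  case (Cons i w)
  have "((\<lambda>t. X $ i + t *\<^sub>R (K $ i)) has_vector_derivative 0 + (0 *\<^sub>R 0 + 1 *\<^sub>R (K $ i))) (at 0)"
    by (intro has_vector_derivative_add has_vector_derivative_const has_vector_derivative_scaleR
        DERIV_ident)
  then have "((\<lambda>t. (X + t *\<^sub>R K) $ i) has_vector_derivative K $ i) (at 0)"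
    by simp
  from bounded_bilinear.has_vector_derivative[OF bounded_bilinear_blinfun_compose this Cons.IH]
  have "((\<lambda>t. (X + t *\<^sub>R K) $ i o\<^sub>L word_eval (X + t *\<^sub>R K) w) has_vector_derivative
      (K $ i o\<^sub>L word_eval X w) +
      (\<Sum>k<length w. X $ i o\<^sub>L (word_eval X (take k w) o\<^sub>L (K $ (w ! k) o\<^sub>L word_eval X (drop (Suc k) w)))))
      (at 0)"
    by (simp add: bounded_bilinear.sum_right[OF bounded_bilinear_blinfun_compose] add.commute)
  then show ?case
    by (simp add: sum.lessThan_Suc_shift comp_assoc del: sum.lessThan_Suc)
qed simp

context tracial_vna
begin

text \<open>Entries need not be hermitian: \<open>gradient_expectation\<close> tests in all
  directions from A, and \<open>hermitian_expectation\<close> uses this at the adjoint of a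
  difference not yet known to vanish.\<close>

definition tuples :: "('h op ^ 'n) set" where
  "tuples = {X. \<forall>j. X $ j \<in> M}"

lemma tuplesD: "X \<in> tuples \<Longrightarrow> X $ j \<in> M"
  by (simp add: tuples_def)

lemma tuples_add_scaleR: "X \<in> tuples \<Longrightarrow> K \<in> tuples \<Longrightarrow> X + t *\<^sub>R K \<in> tuples"
  by (simp add: tuples_def M_add M_scaleR)

lemma word_eval_M: "X \<in> tuples \<Longrightarrow> word_eval X w \<in> M"
  by (rule M_op_prod) (auto simp: tuples_def)

lemma nc_eval_M: "X \<in> tuples \<Longrightarrow> nc_eval X P \<in> M"
  unfolding nc_eval_def by (intro M_sum M_scaleC word_eval_M)

text \<open>\<tau> is linear and bounded on M only, not on the ambient operator space, so the
  difference quotients are estimated inside M by \<open>\<tau>_bounded\<close>.\<close>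

lemma \<tau>_derivative:
  assumes F: "(F has_vector_derivative F') (at a)" and M: "\<And>t. F t \<in> M" "F' \<in> M"
  shows "((\<lambda>t. \<tau> (F t)) has_vector_derivative \<tau> F') (at a)"
proof -
  have lim: "((\<lambda>t. norm (F t - F a - (t - a) *\<^sub>R F') / norm (t - a)) \<longlongrightarrow> 0) (at a)"
    using F by (simp add: has_vector_derivative_def has_derivative_iff_norm)
  have "((\<lambda>t. norm (\<tau> (F t) - \<tau> (F a) - (t - a) *\<^sub>R \<tau> F') / norm (t - a)) \<longlongrightarrow> 0) (at a)"
  proof (rule tendsto_sandwich[OF _ _ tendsto_const])
    show "((\<lambda>t. 2 * (norm (F t - F a - (t - a) *\<^sub>R F') / norm (t - a))) \<longlongrightarrow> 0) (at a)"
      using tendsto_mult_right_zero[OF lim] by simp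
    have "norm (\<tau> (F t) - \<tau> (F a) - (t - a) *\<^sub>R \<tau> F') / norm (t - a)
        \<le> 2 * (norm (F t - F a - (t - a) *\<^sub>R F') / norm (t - a))" for t
    proof -
      have "\<tau> (F t) - \<tau> (F a) - (t - a) *\<^sub>R \<tau> F' = \<tau> (F t - F a - (t - a) *\<^sub>R F')"
        by (simp only: \<tau>_diff \<tau>_scaleR M M_diff M_scaleR scaleR_conv_of_real)
      also have "norm \<dots> \<le> 2 * norm (F t - F a - (t - a) *\<^sub>R F')"
        by (intro \<tau>_bounded M_diff M_scaleR M)
      finally show ?thesis
        by (simp add: divide_right_mono)
    qed
    then show "\<forall>\<^sub>F t in at a. norm (\<tau> (F t) - \<tau> (F a) - (t - a) *\<^sub>R \<tau> F') / norm (t - a)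
        \<le> 2 * (norm (F t - F a - (t - a) *\<^sub>R F') / norm (t - a))"
      by simp
  qed simp
  then show ?thesis
    by (simp add: has_vector_derivative_def has_derivative_iff_norm bounded_linear_scaleR_left)
qed

text \<open>This is the derivative at X of the scalar function X \<mapsto> \<tau>(P(X)) in direction
  K, by \<open>trace_nc_eval_derivative\<close>.\<close>

definition gradient_pairing :: "'h op ^ 'n \<Rightarrow> 'n ncpoly \<Rightarrow> 'h op ^ 'n \<Rightarrow> complex" where
  "gradient_pairing X P K = (\<Sum>j\<in>UNIV. \<tau> (nc_eval X (cyclic_deriv j P) o\<^sub>L K $ j))"

text \<open>The trace rotates \<open>drop (Suc k) w @ take k w\<close> back around the k-th letter,
  which turns the cyclic derivative into the Leibniz rule; letting j vary collects all positions k.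
  The set S is left free so that polynomials with different supports can be summed over the same
  words.\<close>

lemma gradient_pairing_words:
  assumes X: "X \<in> tuples" and K: "K \<in> tuples"
    and S: "finite S" "Poly_Mapping.keys P \<subseteq> S"
  shows "gradient_pairing X P K = (\<Sum>w\<in>S. Poly_Mapping.lookup P w *
    (\<Sum>k<length w. \<tau> (word_eval X (take k w) o\<^sub>L (K $ (w ! k) o\<^sub>L word_eval X (drop (Suc k) w)))))"
proof -
  define c where "c = Poly_Mapping.lookup P"
  define g where "g w k = \<tau> (word_eval X (take k w) o\<^sub>L (K $ (w ! k) o\<^sub>L word_eval X (drop (Suc k) w)))"
    for w k
  note M = word_eval_M[OF X] tuplesD[OF K] M_comp M_scaleC M_sum
  have "\<tau> (nc_eval X (cyclic_deriv j P) o\<^sub>L K $ j)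
      = (\<Sum>w\<in>Poly_Mapping.keys P. c w * (\<Sum>k | k \<in> {..<length w} \<and> w ! k = j. g w k))" for j
  proof -
    have "\<tau> (nc_eval X (cyclic_deriv j P) o\<^sub>L K $ j)
        = (\<Sum>w\<in>Poly_Mapping.keys P. \<Sum>k | k < length w \<and> w ! k = j.
            \<tau> (op_scaleC (c w) (word_eval X (drop (Suc k) w @ take k w)) o\<^sub>L K $ j))"
      unfolding cyclic_deriv_def nc_eval_sum nc_eval_single
      by (simp add: bounded_bilinear.sum_left[OF bounded_bilinear_blinfun_compose] \<tau>_sum M c_def
          del: map_append op_prod_append)
    also have "\<dots> = (\<Sum>w\<in>Poly_Mapping.keys P. \<Sum>k | k < length w \<and> w ! k = j. c w * g w k)"
    proof (intro sum.cong refl)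
      fix w k assume "k \<in> {k. k < length w \<and> w ! k = j}"
      then have j: "w ! k = j"
        by simp
      have "\<tau> (word_eval X (drop (Suc k) w) o\<^sub>L (word_eval X (take k w) o\<^sub>L K $ j)) = g w k"
        unfolding g_def j by (subst \<tau>_commute) (simp_all add: M comp_assoc)
      then show "\<tau> (op_scaleC (c w) (word_eval X (drop (Suc k) w @ take k w)) o\<^sub>L K $ j) = c w * g w k"
        by (simp add: op_scaleC_comp_left \<tau>_scaleC M comp_assoc)
    qed
    finally show ?thesis
      by (simp add: sum_distrib_left)
  qed
  then have "gradient_pairing X P K
      = (\<Sum>j\<in>UNIV. \<Sum>w\<in>Poly_Mapping.keys P. c w * (\<Sum>k | k \<in> {..<length w} \<and> w ! k = j. g w k))"
    by (simp add: gradient_pairing_def)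
  also have "\<dots> = (\<Sum>w\<in>Poly_Mapping.keys P. c w * (\<Sum>j\<in>UNIV. \<Sum>k | k \<in> {..<length w} \<and> w ! k = j. g w k))"
    by (subst sum.swap) (simp add: sum_distrib_left)
  also have "\<dots> = (\<Sum>w\<in>Poly_Mapping.keys P. c w * (\<Sum>k<length w. g w k))"
    by (intro sum.cong refl arg_cong2[where f="(*)"] sum.group) auto
  also have "\<dots> = (\<Sum>w\<in>S. c w * (\<Sum>k<length w. g w k))"
    by (rule sum.mono_neutral_left) (use S in \<open>auto simp: in_keys_iff c_def\<close>)
  finally show ?thesis
    by (simp add: c_def g_def)
qed

lemma gradient_pairing_0 [simp]: "gradient_pairing X 0 K = 0"
  by (simp add: gradient_pairing_def cyclic_deriv_def)

lemma gradient_pairing_add: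
  assumes "X \<in> tuples" "K \<in> tuples"
  shows "gradient_pairing X (P + Q) K = gradient_pairing X P K + gradient_pairing X Q K"
proof -
  let ?S = "Poly_Mapping.keys P \<union> Poly_Mapping.keys Q"
  have "Poly_Mapping.keys (P + Q) \<subseteq> ?S"
    by (rule Poly_Mapping.keys_add)
  then show ?thesis
    by (simp add: gradient_pairing_words[OF assms, of ?S] lookup_add distrib_right sum.distrib)
qed

lemma gradient_pairing_scale:
  assumes "X \<in> tuples" "K \<in> tuples"
  shows "gradient_pairing X (Poly_Mapping.map (\<lambda>x. c * x) P) K = c * gradient_pairing X P K"
proof -
  have "Poly_Mapping.lookup (Poly_Mapping.map (\<lambda>x. c * x) P) w = c * Poly_Mapping.lookup P w" for w
    by (simp add: Poly_Mapping.map.rep_eq when_def)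
  moreover from this have "Poly_Mapping.keys (Poly_Mapping.map (\<lambda>x. c * x) P) \<subseteq> Poly_Mapping.keys P"
    by (auto simp: in_keys_iff)
  ultimately show ?thesis
    by (simp add: gradient_pairing_words[OF assms, of "Poly_Mapping.keys P"] sum_distrib_left mult.assoc)
qed

lemma trace_nc_eval_derivative:
  assumes X: "X \<in> tuples" and K: "K \<in> tuples"
  shows "((\<lambda>t. \<tau> (nc_eval (X + t *\<^sub>R K) P)) has_vector_derivative gradient_pairing X P K) (at 0)"
proof -
  have word: "((\<lambda>t. \<tau> (word_eval (X + t *\<^sub>R K) w)) has_vector_derivative
      (\<Sum>k<length w. \<tau> (word_eval X (take k w) o\<^sub>L (K $ (w ! k) o\<^sub>L word_eval X (drop (Suc k) w)))))
      (at 0)" for w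
  proof -
    have "((\<lambda>t. \<tau> (word_eval (X + t *\<^sub>R K) w)) has_vector_derivative
      \<tau> (\<Sum>k<length w. word_eval X (take k w) o\<^sub>L (K $ (w ! k) o\<^sub>L word_eval X (drop (Suc k) w)))) (at 0)"
      by (intro \<tau>_derivative word_eval_derivative word_eval_M tuples_add_scaleR X K M_sum M_comp
          tuplesD)
    also have "\<tau> (\<Sum>k<length w. word_eval X (take k w) o\<^sub>L (K $ (w ! k) o\<^sub>L word_eval X (drop (Suc k) w)))
        = (\<Sum>k<length w. \<tau> (word_eval X (take k w) o\<^sub>L (K $ (w ! k) o\<^sub>L word_eval X (drop (Suc k) w))))"
      by (intro \<tau>_sum M_comp word_eval_M X tuplesD K)
    finally show ?thesis .
  qed
  have eq: "\<tau> (nc_eval (X + t *\<^sub>R K) P) = (\<Sum>w\<in>Poly_Mapping.keys P.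
      Poly_Mapping.lookup P w * \<tau> (word_eval (X + t *\<^sub>R K) w))" for t
    unfolding nc_eval_def
    by (simp only: \<tau>_sum \<tau>_scaleC M_scaleC word_eval_M tuples_add_scaleR X K)
  show ?thesis
    unfolding eq gradient_pairing_words[OF X K finite_keys order_refl]
    by (intro has_vector_derivative_sum has_vector_derivative_mult_right word)
qed

end

section \<open>Mixed traces under independence and freeness\<close>

lemma hull_unital_subalgebra: "unital_subalgebra (unital_subalgebra hull S)"
  by (rule hull_in) (auto simp: unital_subalgebra_def)

lemma hull_unital_star_subalgebra: "unital_star_subalgebra (unital_star_subalgebra hull S)"
  by (rule hull_in) (auto simp: unital_star_subalgebra_def unital_subalgebra_def)

lemma unital_subalgebra_op_prod:
  "unital_subalgebra S \<Longrightarrow> set xs \<subseteq> S \<Longrightarrow> op_prod xs \<in> S"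
  by (induction xs) (auto simp: unital_subalgebra_def)

lemma (in tracial_vna) unital_star_subalgebra: "unital_star_subalgebra M"
  by (simp add: unital_star_subalgebra_def unital_subalgebra_def M_add M_comp M_scaleC M_adjoint)

locale tracial_inclusion = A: tracial_vna A \<alpha> + B: tracial_vna B \<beta>
  for A B :: "'h::complex_hilbert_space op set" and \<alpha> \<beta> :: "'h op \<Rightarrow> complex" +
  assumes A_subset_B: "A \<subseteq> B" and \<alpha>_eq_\<beta>: "a \<in> A \<Longrightarrow> \<alpha> a = \<beta> a"
begin

section \<open>Scalar functions with a cyclic gradient as derivative, and trace polynomials\<close>

lemma A_B: "a \<in> A \<Longrightarrow> a \<in> B"
  using A_subset_B by blast

lemma tuples_A_B: "X \<in> A.tuples \<Longrightarrow> X \<in> B.tuples"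
  using A_subset_B by (auto simp: A.tuples_def B.tuples_def)

text \<open>Derivatives along lines suffice to identify a pairing. The quantifier order is the
  point: one Q for all directions, but Q may depend on Y.\<close>

definition cyclic_differentiable :: "'h op ^ 'n \<Rightarrow> ('h op ^ 'n \<Rightarrow> complex) \<Rightarrow> bool" where
  "cyclic_differentiable Y \<phi> \<longleftrightarrow> (\<exists>Q. \<forall>K\<in>A.tuples.
     ((\<lambda>t. \<phi> (Y + t *\<^sub>R K)) has_vector_derivative B.gradient_pairing Y Q K) (at 0))"

lemma cyclic_differentiable_cong:
  assumes "cyclic_differentiable Y \<phi>" "\<And>X. X \<in> A.tuples \<Longrightarrow> \<phi> X = \<psi> X" "Y \<in> A.tuples"
  shows "cyclic_differentiable Y \<psi>"
proof -
  have "\<phi> (Y + t *\<^sub>R K) = \<psi> (Y + t *\<^sub>R K)" if "K \<in> A.tuples" for t K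
    using assms that by (simp add: A.tuples_add_scaleR)
  then show ?thesis
    using assms(1) by (simp add: cyclic_differentiable_def)
qed

lemma cyclic_differentiable_const [simp]: "cyclic_differentiable Y (\<lambda>_. c)"
  unfolding cyclic_differentiable_def by (rule exI[of _ 0]) simp

lemma cyclic_differentiable_add:
  assumes Y: "Y \<in> A.tuples" and "cyclic_differentiable Y \<phi>" "cyclic_differentiable Y \<psi>"
  shows "cyclic_differentiable Y (\<lambda>X. \<phi> X + \<psi> X)"
proof -
  obtain P Q where
    "\<And>K. K \<in> A.tuples \<Longrightarrow> ((\<lambda>t. \<phi> (Y + t *\<^sub>R K)) has_vector_derivative B.gradient_pairing Y P K) (at 0)"
    "\<And>K. K \<in> A.tuples \<Longrightarrow> ((\<lambda>t. \<psi> (Y + t *\<^sub>R K)) has_vector_derivative B.gradient_pairing Y Q K) (at 0)"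
    using assms(2,3) unfolding cyclic_differentiable_def by metis
  from has_vector_derivative_add[OF this] show ?thesis
    unfolding cyclic_differentiable_def
    by (intro exI[of _ "P + Q"]) (simp add: B.gradient_pairing_add tuples_A_B Y)
qed

text \<open>At the fixed point Y the factors \<phi> Y and \<psi> Y in the product rule are numbers,
  so they can be absorbed as coefficients of a single polynomial.\<close>

lemma cyclic_differentiable_mult:
  assumes Y: "Y \<in> A.tuples" and "cyclic_differentiable Y \<phi>" "cyclic_differentiable Y \<psi>"
  shows "cyclic_differentiable Y (\<lambda>X. \<phi> X * \<psi> X)"
proof -
  obtain P Q where
    "\<And>K. K \<in> A.tuples \<Longrightarrow> ((\<lambda>t. \<phi> (Y + t *\<^sub>R K)) has_vector_derivative B.gradient_pairing Y P K) (at 0)"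
    "\<And>K. K \<in> A.tuples \<Longrightarrow> ((\<lambda>t. \<psi> (Y + t *\<^sub>R K)) has_vector_derivative B.gradient_pairing Y Q K) (at 0)"
    using assms(2,3) unfolding cyclic_differentiable_def by metis
  from has_vector_derivative_mult[OF this] show ?thesis
    unfolding cyclic_differentiable_def
    by (intro exI[of _ "Poly_Mapping.map (\<lambda>x. \<phi> Y * x) Q + Poly_Mapping.map (\<lambda>x. \<psi> Y * x) P"])
      (simp add: B.gradient_pairing_add B.gradient_pairing_scale tuples_A_B Y mult.commute[of _ "\<psi> Y"])
qed

lemma cyclic_differentiable_sum:
  assumes Y: "Y \<in> A.tuples" and "\<And>i. i \<in> I \<Longrightarrow> cyclic_differentiable Y (\<phi> i)"
  shows "cyclic_differentiable Y (\<lambda>X. \<Sum>i\<in>I. \<phi> i X)"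
  using assms(2)
  by (induction I rule: infinite_finite_induct) (simp_all add: cyclic_differentiable_add[OF Y])

lemma cyclic_differentiable_trace_word:
  assumes "Y \<in> A.tuples"
  shows "cyclic_differentiable Y (\<lambda>X. \<beta> (word_eval X w))"
proof -
  have "\<forall>K\<in>A.tuples. ((\<lambda>t. \<beta> (nc_eval (Y + t *\<^sub>R K) (Poly_Mapping.single w 1)))
      has_vector_derivative B.gradient_pairing Y (Poly_Mapping.single w 1) K) (at 0)"
    by (intro ballI B.trace_nc_eval_derivative tuples_A_B assms)
  then show ?thesis
    unfolding cyclic_differentiable_def nc_eval_single op_scaleC_1 by blast
qed

text \<open>Noncommutative polynomials whose coefficients are scalar functions of X; they arise when
  a letter is centred by its own trace. The rule \<open>agree\<close> accommodates identities valid
  only on tuples from A, such as moving a complex scalar past an operator.\<close>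

inductive trace_polynomial :: "'h op ^ 'n \<Rightarrow> ('h op ^ 'n \<Rightarrow> 'h op) \<Rightarrow> bool" for Y where
  word: "trace_polynomial Y (\<lambda>X. word_eval X w)"
| add: "trace_polynomial Y f \<Longrightarrow> trace_polynomial Y g \<Longrightarrow> trace_polynomial Y (\<lambda>X. f X + g X)"
| scale: "cyclic_differentiable Y \<phi> \<Longrightarrow> trace_polynomial Y f \<Longrightarrow>
    trace_polynomial Y (\<lambda>X. op_scaleC (\<phi> X) (f X))"
| agree: "trace_polynomial Y f \<Longrightarrow> (\<And>X. X \<in> A.tuples \<Longrightarrow> f X = g X) \<Longrightarrow> trace_polynomial Y g"

lemma trace_polynomial_mem:
  "trace_polynomial Y f \<Longrightarrow> X \<in> A.tuples \<Longrightarrow> f X \<in> A"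
  by (induction rule: trace_polynomial.induct) (auto simp: A.word_eval_M A.M_add A.M_scaleC)

lemma trace_polynomial_trace:
  assumes "trace_polynomial Y f" "Y \<in> A.tuples"
  shows "cyclic_differentiable Y (\<lambda>X. \<beta> (f X))"
  using assms(1)
proof induction
  case (word w)
  show ?case
    by (rule cyclic_differentiable_trace_word[OF assms(2)])
next
  case (add f g)
  show ?case
    by (rule cyclic_differentiable_cong[OF cyclic_differentiable_add[OF assms(2) add.IH] _ assms(2)])
      (simp add: B.\<tau>_add A_B trace_polynomial_mem[OF add.hyps(1)] trace_polynomial_mem[OF add.hyps(2)])
next
  case (scale \<phi> f)
  show ?case
    by (rule cyclic_differentiable_cong[OF cyclic_differentiable_mult[OF assms(2) scale.hyps(1) scale.IH]
          _ assms(2)])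
      (simp add: B.\<tau>_scaleC A_B trace_polynomial_mem[OF scale.hyps(2)])
next
  case (agree f g)
  show ?case
    by (rule cyclic_differentiable_cong[OF agree.IH _ assms(2)]) (simp add: agree.hyps)
qed

lemma trace_polynomial_comp:
  assumes "trace_polynomial Y f" "trace_polynomial Y g"
  shows "trace_polynomial Y (\<lambda>X. f X o\<^sub>L g X)"
  using assms(1)
proof induction
  case (word w)
  show ?case
    using assms(2)
  proof induction
    case (word v)
    show ?case
      using trace_polynomial.word[of Y "w @ v"] by simp
  next
    case (add f g)
    then show ?case
      using trace_polynomial.add[OF add.IH] by (simp add: comp_add_right)
  next
    case (scale \<phi> f)
    show ?case
      by (rule trace_polynomial.agree[OF trace_polynomial.scale[OF scale.hyps(1) scale.IH]])
        (simp add: op_scaleC_comp_right A.M_linear A.word_eval_M)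
  next
    case (agree f g)
    show ?case
      by (rule trace_polynomial.agree[OF agree.IH]) (simp add: agree.hyps)
  qed
next
  case (add f g)
  then show ?case
    using trace_polynomial.add[OF add.IH] by (simp add: comp_add_left)
next
  case (scale \<phi> f)
  then show ?case
    using trace_polynomial.scale[OF scale.hyps(1) scale.IH] by (simp add: op_scaleC_comp_left)
next
  case (agree f g)
  show ?case
    by (rule trace_polynomial.agree[OF agree.IH]) (simp add: agree.hyps)
qed

text \<open>As in \<open>free_in\<close>, the label \<open>True\<close> marks the constant letters, taken from \<open>S\<close>,
  and \<open>False\<close> the letters with values in \<open>A\<close>.\<close>

definition letter :: "'h op set \<Rightarrow> 'h op ^ 'n \<Rightarrow> bool \<times> ('h op ^ 'n \<Rightarrow> 'h op) \<Rightarrow> bool" where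
  "letter S Y p \<longleftrightarrow>
     (if fst p then \<exists>c\<in>S. snd p = (\<lambda>_. c) else trace_polynomial Y (snd p))"

definition center :: "bool \<times> ('h op ^ 'n \<Rightarrow> 'h op) \<Rightarrow> bool \<times> ('h op ^ 'n \<Rightarrow> 'h op)" where
  "center p = (fst p, \<lambda>X. snd p X + op_scaleC (- \<beta> (snd p X)) id_blinfun)"

lemma fst_center [simp]: "fst (center p) = fst p"
  by (simp add: center_def)

context
  fixes S :: "'h op set" and Y :: "'h op ^ 'n"
  assumes S: "unital_subalgebra S" "S \<subseteq> B" and Y: "Y \<in> A.tuples"
begin

lemma letter_mem:
  assumes "letter S Y p" "X \<in> A.tuples"
  shows "snd p X \<in> (if fst p then S else A)" "snd p X \<in> B"
  using assms S(2) trace_polynomial_mem A_B by (fastforce simp: letter_def split: if_splits)+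

lemma letter_trace: "letter S Y p \<Longrightarrow> cyclic_differentiable Y (\<lambda>X. \<beta> (snd p X))"
  using trace_polynomial_trace[OF _ Y] by (auto simp: letter_def split: if_splits)

text \<open>For a constant letter the subtracted trace is a number and the result remains in S. For
  a letter from A it varies with X, which is why coefficients of trace polynomials may do
  so.\<close>

lemma letter_center:
  assumes "letter S Y p"
  shows "letter S Y (center p)"
proof (cases "fst p")
  case True
  then show ?thesis
    using assms S(1) by (auto simp: letter_def center_def unital_subalgebra_def)
next
  case False
  have "cyclic_differentiable Y (\<lambda>X. - \<beta> (snd p X))"
    using cyclic_differentiable_mult[OF Y cyclic_differentiable_const[of Y "-1"] letter_trace[OF assms]] by simp
  from trace_polynomial.scale[OF this trace_polynomial.word[of Y "[]"]]
  have "trace_polynomial Y (\<lambda>X. op_scaleC (- \<beta> (snd p X)) id_blinfun)"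
    by simp
  then show ?thesis
    using False assms trace_polynomial.add by (simp add: letter_def center_def)
qed

lemma letter_merge:
  assumes "letter S Y p" "letter S Y q" "fst p = fst q"
  shows "letter S Y (fst p, \<lambda>X. snd p X o\<^sub>L snd q X)"
  using assms S(1) trace_polynomial_comp
  by (auto simp: letter_def unital_subalgebra_def split: if_splits)

lemma op_prod_letters_B:
  assumes "\<forall>p\<in>set bs. letter S Y p" "X \<in> A.tuples"
  shows "op_prod (map (\<lambda>p. snd p X) bs) \<in> B"
  by (rule B.M_op_prod) (use assms letter_mem(2) in auto)

text \<open>Two neighbours of the same kind are merged; in an alternating product the letters are
  centred one after the other, each step splitting off a shorter product.\<close>

lemma trace_letters_differentiable:
  assumes free: "\<And>bs. bs \<noteq> [] \<Longrightarrow> successively (\<lambda>p q. fst p \<noteq> fst q) bs \<Longrightarrow>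
      \<forall>(i, b)\<in>set bs. b \<in> (if i then S else A) \<and> \<beta> b = 0 \<Longrightarrow> \<beta> (op_prod (map snd bs)) = 0"
    and "\<forall>p\<in>set bs. letter S Y p"
  shows "cyclic_differentiable Y (\<lambda>X. \<beta> (op_prod (map (\<lambda>p. snd p X) bs)))"
  using assms(2)
proof (induction bs rule: length_induct)
  case (1 bs)
  note IH = 1(1)[rule_format] and letters = 1(2)
  show ?case
  proof (cases "successively (\<lambda>p q. fst p \<noteq> fst q) bs")
    case False
    then obtain us p q vs where bs: "bs = us @ p # q # vs" and pq: "fst p = fst q"
      unfolding successively_conv_nth
      by (metis Cons_nth_drop_Suc Suc_lessD append_take_drop_id)
    let ?r = "(fst p, \<lambda>X. snd p X o\<^sub>L snd q X)"
    have "letter S Y ?r"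
      using letters pq by (intro letter_merge) (auto simp: bs)
    then have "cyclic_differentiable Y (\<lambda>X. \<beta> (op_prod (map (\<lambda>p. snd p X) (us @ ?r # vs))))"
      using letters by (intro IH) (auto simp: bs)
    then show ?thesis
      by (simp add: bs comp_assoc)
  next
    case alt: True
    \<comment> \<open>The prefix is uncentred and the suffix centred. The induction moves the
      boundary from the fully centred product, whose trace freeness annihilates, to the original
      product at \<open>vs = []\<close>.\<close>
    have "cyclic_differentiable Y (\<lambda>X. \<beta> (op_prod (map (\<lambda>p. snd p X) (us @ map center vs))))"
      if "us @ vs = bs" for us vs
      using that
    proof (induction us arbitrary: vs rule: rev_induct)
      case Nil
      then have vs: "vs = bs" by simp
      show ?case
      \<comment> \<open>The empty product is the identity, with constant trace 1, and is excluded
        from the freeness condition.\<close>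
      proof (cases "bs = []")
        case True
        then show ?thesis by (simp add: vs)
      next
        case False
        have "\<beta> (op_prod (map (\<lambda>p. snd p X) (map center bs))) = 0" if X: "X \<in> A.tuples" for X
        proof -
          have mem: "snd p X \<in> B" "snd (center p) X \<in> (if fst p then S else A)" if "p \<in> set bs" for p
            using letter_mem[of p] letter_mem(1)[OF letter_center, of p] letters that X by auto
          have "\<beta> (snd (center p) X) = 0" if "p \<in> set bs" for p
            using mem(1)[OF that] by (simp add: center_def B.\<tau>_add B.\<tau>_scaleC B.M_scaleC)
          moreover have "successively (\<lambda>p q. fst p \<noteq> fst q) (map (\<lambda>p. (fst p, snd (center p) X)) bs)"
            using alt by (simp add: successively_map)
          ultimately have "\<beta> (op_prod (map snd (map (\<lambda>p. (fst p, snd (center p) X)) bs))) = 0"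
            using False mem(2) by (intro free) auto
          then show ?thesis
            by (simp add: comp_def)
        qed
        then show ?thesis
          unfolding vs append_Nil
          by (intro cyclic_differentiable_cong[OF cyclic_differentiable_const[of Y 0] _ Y]) simp
      qed
    next
      case (snoc u us)
      let ?f = "\<lambda>X cs. \<beta> (op_prod (map (\<lambda>p. snd p X) cs))"
      have u: "letter S Y u" and us: "\<forall>p\<in>set us. letter S Y p" and vs: "\<forall>p\<in>set vs. letter S Y p"
        using letters snoc.prems by auto
      have cvs: "\<forall>p\<in>set (map center vs). letter S Y p"
        using vs letter_center by auto
      have 1: "cyclic_differentiable Y (\<lambda>X. ?f X (us @ map center (u # vs)))"
        using snoc.prems by (intro snoc.IH) simp
      \<comment> \<open>Dropping u makes its former neighbours, which are of equal kind, meet. The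
        induction on length applies nevertheless, as it is not confined to alternating
        lists.\<close>
      have 2: "cyclic_differentiable Y (\<lambda>X. ?f X (us @ map center vs))"
        using us cvs snoc.prems by (intro IH) auto
      have eq: "?f X (us @ map center (u # vs)) + \<beta> (snd u X) * ?f X (us @ map center vs)
          = ?f X ((us @ [u]) @ map center vs)" if X: "X \<in> A.tuples" for X
      proof -
        define a where "a = op_prod (map (\<lambda>p. snd p X) us)"
        define d where "d = op_prod (map (\<lambda>p. snd p X) (map center vs))"
        have M: "a \<in> B" "d \<in> B" "snd u X \<in> B"
          unfolding a_def d_def using op_prod_letters_B[OF us X] op_prod_letters_B[OF cvs X]
            letter_mem(2)[OF u X] by simp_all
        have "?f X (us @ map center (u # vs))
            = \<beta> ((a o\<^sub>L (snd u X o\<^sub>L d)) + op_scaleC (- \<beta> (snd u X)) (a o\<^sub>L d))"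
          using B.M_linear[OF M(1)]
          by (simp add: a_def d_def center_def comp_add_left comp_add_right op_scaleC_comp_left
              op_scaleC_comp_right)
        also have "\<dots> = \<beta> (a o\<^sub>L (snd u X o\<^sub>L d)) - \<beta> (snd u X) * \<beta> (a o\<^sub>L d)"
          by (simp add: B.\<tau>_add B.\<tau>_scaleC B.M_comp B.M_scaleC M)
        finally show ?thesis
          by (simp add: a_def d_def)
      qed
      show ?case
        by (rule cyclic_differentiable_cong[OF cyclic_differentiable_add[OF Y 1
              cyclic_differentiable_mult[OF Y letter_trace[OF u] 2]] eq Y])
    qed
    from this[of bs "[]"] show ?thesis
      by simp
  qed
qed

end

end

section \<open>Conditional expectations of cyclic gradients\<close>

lemma append_tuple_nth [simp]:
  "append_tuple Z Y $ Inl i = Y $ i" "append_tuple Z Y $ Inr j = Z $ j"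
  by (simp_all add: append_tuple_def)

lemma vec_sum_eqI:
  assumes "\<And>i. x $ Inl i = y $ Inl i" "\<And>j. x $ Inr j = y $ Inr j"
  shows "x = y"
  using assms unfolding vec_eq_iff by (metis sum.exhaust)

lemma append_tuple_add:
  "append_tuple 0 (K + L) = append_tuple 0 K + append_tuple 0 (L :: 'a::monoid_add ^ 'n)"
  by (rule vec_sum_eqI) simp_all

lemma append_tuple_scaleR:
  "append_tuple 0 (r *\<^sub>R K) = r *\<^sub>R append_tuple 0 (K :: 'a::real_vector ^ 'n)"
  by (rule vec_sum_eqI) simp_all

lemma append_tuple_diff:
  "append_tuple Z X - append_tuple Z Y = append_tuple 0 (X - (Y :: 'a::ab_group_add ^ 'n))"
  by (rule vec_sum_eqI) simp_all

lemma append_tuple_add_scaleR: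
  "append_tuple Z Y + t *\<^sub>R append_tuple 0 K = append_tuple Z (Y + t *\<^sub>R (K :: 'a::real_vector ^ 'n))"
  by (rule vec_sum_eqI) simp_all

lemma sum_UNIV_Plus:
  "(\<Sum>k\<in>(UNIV :: ('n::finite + 'm::finite) set). f k) = (\<Sum>i\<in>UNIV. f (Inl i)) + (\<Sum>j\<in>UNIV. f (Inr j))"
  using sum.Plus[of "UNIV :: 'n set" "UNIV :: 'm set" f] by (simp add: comp_def)

lemma norm_append_tuple_0:
  "norm (append_tuple 0 K) = norm (K :: 'a::real_normed_vector ^ 'n)"
  by (simp add: norm_vec_def L2_set_def sum_UNIV_Plus)

lemma dist_append_tuple:
  "dist (append_tuple Z X) (append_tuple Z Y) = dist X (Y :: 'a::real_normed_vector ^ 'n)"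
  by (simp add: dist_norm append_tuple_diff norm_append_tuple_0)

context tracial_inclusion
begin

text \<open>The word is read as a list of letters: coordinates of X, with values in A, and constants
  from the star algebra generated by the \<open>Z $ j\<close>.\<close>

lemma mixed_trace_free:
  fixes Z :: "'h op ^ 'm" and Y :: "'h op ^ 'n"
  assumes free: "free_in \<beta> (range (\<lambda>j. Z $ j)) A" and Z: "Z \<in> B.tuples" and Y: "Y \<in> A.tuples"
  shows "cyclic_differentiable Y (\<lambda>X. \<beta> (word_eval (append_tuple Z X) w))"
proof -
  define S where "S = unital_star_subalgebra hull (range (\<lambda>j. Z $ j))"
  have S: "unital_subalgebra S"
    using hull_unital_star_subalgebra by (auto simp: S_def unital_star_subalgebra_def)
  have ZS: "Z $ j \<in> S" for j
    unfolding S_def by (rule hull_inc) simp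
  have SB: "S \<subseteq> B"
    unfolding S_def using Z by (intro hull_minimal B.unital_star_subalgebra) (auto simp: B.tuples_def)
  define l :: "'n + 'm \<Rightarrow> bool \<times> ('h op ^ 'n \<Rightarrow> 'h op)"
    where "l k = (case k of Inl i \<Rightarrow> (False, \<lambda>X. X $ i) | Inr j \<Rightarrow> (True, \<lambda>_. Z $ j))" for k
  have "cyclic_differentiable Y (\<lambda>X. \<beta> (op_prod (map (\<lambda>p. snd p X) (map l w))))"
  proof (rule trace_letters_differentiable[OF S SB Y])
    fix bs :: "(bool \<times> 'h op) list"
    assume "bs \<noteq> []" "successively (\<lambda>p q. fst p \<noteq> fst q) bs"
      "\<forall>(i, b)\<in>set bs. b \<in> (if i then S else A) \<and> \<beta> b = 0"
    moreover have "A \<subseteq> unital_star_subalgebra hull A"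
      by (rule hull_subset)
    ultimately show "\<beta> (op_prod (map snd bs)) = 0"
      using free[unfolded free_in_def, rule_format, of bs] by (fastforce simp: S_def split: if_splits)
  next
    have "letter S Y (l k)" for k
    proof (cases k)
      case (Inl i)
      then show ?thesis
        using trace_polynomial.word[of Y "[i]"] by (simp add: letter_def l_def)
    next
      case (Inr j)
      then show ?thesis
        using ZS by (auto simp: letter_def l_def)
    qed
    then show "\<forall>p\<in>set (map l w). letter S Y p"
      by auto
  qed
  moreover have "snd (l k) X = append_tuple Z X $ k" for k X
    by (cases k) (simp_all add: l_def)
  ultimately show ?thesis
    by (simp add: comp_def)
qed

text \<open>The \<open>Z $ j\<close> commute with A, so each word sorts into a word in Z times a
  word in X. Its trace factors, and the Z-factor is constant in X.\<close>

lemma mixed_trace_independent: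
  fixes Z :: "'h op ^ 'm" and Y :: "'h op ^ 'n"
  assumes ind: "independent_in \<beta> (range (\<lambda>j. Z $ j)) A" and Y: "Y \<in> A.tuples"
  shows "cyclic_differentiable Y (\<lambda>X. \<beta> (word_eval (append_tuple Z X) w))"
proof -
  define zs :: "('n + 'm) list \<Rightarrow> 'm list" where "zs w = map projr (filter (Not \<circ> isl) w)" for w
  define ys :: "('n + 'm) list \<Rightarrow> 'n list" where "ys w = map projl (filter isl w)" for w
  have Z_mem: "word_eval Z v \<in> unital_subalgebra hull (range (\<lambda>j. Z $ j))" for v
    by (intro unital_subalgebra_op_prod hull_unital_subalgebra) (auto intro: hull_inc)
  have A_mem: "a \<in> unital_subalgebra hull A" if "a \<in> A" for a
    using that by (rule hull_inc)
  have comm: "word_eval Z v o\<^sub>L a = a o\<^sub>L word_eval Z v"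
    and mult: "\<beta> (word_eval Z v o\<^sub>L a) = \<beta> (word_eval Z v) * \<beta> a" if "a \<in> A" for a v
    using ind Z_mem[of v] A_mem[OF that] unfolding independent_in_def by blast+
  have split: "word_eval (append_tuple Z X) w = word_eval Z (zs w) o\<^sub>L word_eval X (ys w)"
    if X: "X \<in> A.tuples" for X w
  proof (induction w)
    case Nil
    then show ?case by (simp add: zs_def ys_def)
  next
    case (Cons k w)
    show ?case
    proof (cases k)
      case (Inl i)
      have "X $ i o\<^sub>L (word_eval Z (zs w) o\<^sub>L word_eval X (ys w))
          = word_eval Z (zs w) o\<^sub>L (X $ i o\<^sub>L word_eval X (ys w))"
        by (simp only: comp_assoc[symmetric] comm[OF A.tuplesD[OF X]])
      then show ?thesis
        using Inl Cons.IH by (simp add: zs_def ys_def)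
    next
      case (Inr j)
      then show ?thesis
        using Cons.IH by (simp add: zs_def ys_def comp_assoc)
    qed
  qed
  have "cyclic_differentiable Y (\<lambda>X. \<beta> (word_eval Z (zs w)) * \<beta> (word_eval X (ys w)))"
    by (intro cyclic_differentiable_mult Y cyclic_differentiable_const cyclic_differentiable_trace_word)
  then show ?thesis
    by (rule cyclic_differentiable_cong[OF _ _ Y]) (simp add: split mult A.word_eval_M)
qed

text \<open>The derivative of X \<mapsto> \<beta>(P(X, Z)) at Y is obtained twice: from
  \<open>mixed\<close>, as a pairing with Q, and directly, as a pairing of P with (K, 0). Uniqueness
  of derivatives equates the two, and a direction supported in coordinate j isolates the j-th
  entry.\<close>

lemma gradient_expectation:
  fixes Z :: "'h op ^ 'm" and Y :: "'h op ^ 'n"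
  assumes Z: "Z \<in> B.tuples" and Y: "Y \<in> A.tuples"
    and mixed: "\<And>w. cyclic_differentiable Y (\<lambda>X. \<beta> (word_eval (append_tuple Z X) w))"
  obtains Q where "\<And>j K. K \<in> A \<Longrightarrow>
    \<beta> (nc_eval Y (cyclic_deriv j Q) o\<^sub>L K) = \<beta> (nc_eval (append_tuple Z Y) (cyclic_deriv (Inl j) P) o\<^sub>L K)"
proof -
  have app: "append_tuple Z X \<in> B.tuples" if "X \<in> A.tuples" for X :: "'h op ^ 'n"
    using that Z A_B by (auto simp: A.tuples_def B.tuples_def append_tuple_def split: sum.split)
  have "cyclic_differentiable Y (\<lambda>X. \<Sum>w\<in>Poly_Mapping.keys P.
      Poly_Mapping.lookup P w * \<beta> (word_eval (append_tuple Z X) w))"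
    by (intro cyclic_differentiable_sum cyclic_differentiable_mult cyclic_differentiable_const mixed Y)
  then have "cyclic_differentiable Y (\<lambda>X. \<beta> (nc_eval (append_tuple Z X) P))"
    by (rule cyclic_differentiable_cong[OF _ _ Y])
      (simp only: nc_eval_def B.\<tau>_sum B.\<tau>_scaleC B.M_scaleC B.word_eval_M app)
  then obtain Q where Q: "\<And>K. K \<in> A.tuples \<Longrightarrow>
      ((\<lambda>t. \<beta> (nc_eval (append_tuple Z (Y + t *\<^sub>R K)) P)) has_vector_derivative B.gradient_pairing Y Q K) (at 0)"
    unfolding cyclic_differentiable_def by blast
  have pairing: "B.gradient_pairing Y Q K = B.gradient_pairing (append_tuple Z Y) P (append_tuple 0 K)"
    if K: "K \<in> A.tuples" for K
  proof (rule vector_derivative_unique_at[OF Q[OF K]])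
    have "append_tuple 0 K \<in> (B.tuples :: ('h op ^ ('n + 'm)) set)"
      using K A_B by (auto simp: A.tuples_def B.tuples_def append_tuple_def split: sum.split)
    from B.trace_nc_eval_derivative[OF app[OF Y] this]
    show "((\<lambda>t. \<beta> (nc_eval (append_tuple Z (Y + t *\<^sub>R K)) P)) has_vector_derivative
        B.gradient_pairing (append_tuple Z Y) P (append_tuple 0 K)) (at 0)"
      by (simp only: append_tuple_add_scaleR)
  qed
  show ?thesis
  proof
    fix j K assume K: "K \<in> A"
    define L :: "'h op ^ 'n" where "L = axis j K"
    have "L \<in> A.tuples"
      using K by (simp add: L_def A.tuples_def axis_def)
    note * = pairing[OF this]
    have single: "(\<Sum>i\<in>UNIV. \<beta> (G i o\<^sub>L L $ i)) = \<beta> (G j o\<^sub>L K)" for G :: "'n \<Rightarrow> 'h op"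
    proof -
      have "(\<Sum>i\<in>UNIV. \<beta> (G i o\<^sub>L L $ i)) = (\<Sum>i\<in>UNIV. if i = j then \<beta> (G j o\<^sub>L K) else 0)"
        by (rule sum.cong) (simp_all add: L_def axis_def)
      then show ?thesis
        by simp
    qed
    show "\<beta> (nc_eval Y (cyclic_deriv j Q) o\<^sub>L K) = \<beta> (nc_eval (append_tuple Z Y) (cyclic_deriv (Inl j) P) o\<^sub>L K)"
      using * by (simp add: B.gradient_pairing_def sum_UNIV_Plus single)
  qed
qed

text \<open>As g is hermitian, traciality shows that the adjoint of h has the same pairings with A
  as h. Their difference d lies in A and pairs to zero with its own adjoint, so faithfulness gives d
  = 0.\<close>

lemma hermitian_expectation:
  assumes h: "h \<in> A" and g: "g \<in> hermitian_part B"
    and eq: "\<And>K. K \<in> A \<Longrightarrow> \<beta> (h o\<^sub>L K) = \<beta> (g o\<^sub>L K)"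
  shows "h \<in> hermitian_part A"
proof -
  define d where "d = h - op_adjoint h"
  have d: "d \<in> A"
    unfolding d_def by (intro A.M_diff A.M_adjoint h)
  have gB: "g \<in> B"
    using g by (simp add: hermitian_part_def)
  have "\<beta> (op_adjoint h o\<^sub>L K) = \<beta> (h o\<^sub>L K)" if K: "K \<in> A" for K
  proof -
    have K': "op_adjoint K \<in> A"
      using K by (rule A.M_adjoint)
    have "op_adjoint h o\<^sub>L K = op_adjoint (op_adjoint K o\<^sub>L h)"
      by (simp add: op_adjoint_comp op_adjoint_adjoint complex_linear_adjoint A.M_linear h K)
    then have "\<beta> (op_adjoint h o\<^sub>L K) = cnj (\<beta> (op_adjoint K o\<^sub>L h))"
      by (simp add: B.\<tau>_adjoint B.M_comp A_B K' h)
    also have "\<beta> (op_adjoint K o\<^sub>L h) = \<beta> (h o\<^sub>L op_adjoint K)"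
      by (rule B.\<tau>_commute) (simp_all add: A_B K' h)
    also have "cnj (\<beta> (h o\<^sub>L op_adjoint K)) = cnj (\<beta> (g o\<^sub>L op_adjoint K))"
      by (simp add: eq K')
    also have "\<dots> = \<beta> (op_adjoint (g o\<^sub>L op_adjoint K))"
      by (rule B.\<tau>_adjoint[symmetric]) (simp add: B.M_comp A_B K' gB)
    also have "op_adjoint (g o\<^sub>L op_adjoint K) = K o\<^sub>L g"
      using g by (simp add: hermitian_part_def op_adjoint_comp op_adjoint_adjoint
          complex_linear_adjoint A.M_linear B.M_linear K)
    also have "\<beta> (K o\<^sub>L g) = \<beta> (g o\<^sub>L K)"
      by (rule B.\<tau>_commute) (simp_all add: A_B K gB)
    finally show ?thesis
      by (simp add: eq K)
  qed
  then have "\<beta> (d o\<^sub>L op_adjoint d) = 0"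
    using A.M_adjoint[OF d]
    by (simp add: d_def comp_diff_left B.\<tau>_diff B.M_comp A_B A.M_adjoint h)
  then have "\<beta> (op_adjoint d o\<^sub>L d) = 0"
    using B.\<tau>_commute[of d "op_adjoint d"] by (simp add: A_B d A.M_adjoint)
  then have "d = 0"
    using B.\<tau>_faithful[of d] by (simp add: A_B d)
  then show ?thesis
    using h by (simp add: hermitian_part_def d_def)
qed

lemma cyclic_gradient_expectation:
  fixes Z :: "'h op ^ 'm" and Y :: "'h op ^ 'n"
  assumes Z: "Z \<in> B.tuples" and Y: "Y \<in> A.tuples"
    and mixed: "\<And>w. cyclic_differentiable Y (\<lambda>X. \<beta> (word_eval (append_tuple Z X) w))"
    and g: "g \<in> cyclic_gradients (append_tuple Z Y) \<inter> hermitian_tuples B"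
  shows "\<exists>h\<in>cyclic_gradients Y \<inter> hermitian_tuples A.
    \<forall>j. \<forall>K\<in>hermitian_part A. \<alpha> (h $ j o\<^sub>L K) = \<beta> (g $ Inl j o\<^sub>L K)"
proof -
  obtain P where P: "\<And>k. g $ k = nc_eval (append_tuple Z Y) (cyclic_deriv k P)"
    using g by (auto simp: cyclic_gradients_def)
  obtain Q where Q: "\<And>j K. K \<in> A \<Longrightarrow>
      \<beta> (nc_eval Y (cyclic_deriv j Q) o\<^sub>L K) = \<beta> (g $ Inl j o\<^sub>L K)"
    using gradient_expectation[OF Z Y mixed, of P] unfolding P by metis
  define h where "h = (\<chi> j. nc_eval Y (cyclic_deriv j Q))"
  have h_mem: "h $ j \<in> A" for j
    by (simp add: h_def A.nc_eval_M Y)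
  have "h $ j \<in> hermitian_part A" for j
    using h_mem[of j]
  proof (rule hermitian_expectation)
    show "g $ Inl j \<in> hermitian_part B"
      using g by (simp add: hermitian_tuples_def)
  qed (simp add: h_def Q)
  then have "h \<in> cyclic_gradients Y \<inter> hermitian_tuples A"
    by (auto simp: cyclic_gradients_def hermitian_tuples_def h_def)
  moreover have "\<alpha> (h $ j o\<^sub>L K) = \<beta> (g $ Inl j o\<^sub>L K)" if "K \<in> hermitian_part A" for j K
    using that h_mem[of j] by (simp add: \<alpha>_eq_\<beta> A.M_comp A.hermitian_part_M) (simp add: h_def Q A.hermitian_part_M)
  ultimately show ?thesis
    by blast
qed

section \<open>Composition of cyclomorphic functions with the insertion of Z\<close>

lemma hermitian_part_A_B: "hermitian_part A \<subseteq> hermitian_part B"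
  using A_subset_B by (auto simp: hermitian_part_def)

lemma append_tuple_hermitian:
  "Z \<in> hermitian_tuples B \<Longrightarrow> Y \<in> hermitian_tuples A \<Longrightarrow> append_tuple Z Y \<in> hermitian_tuples B"
  using hermitian_part_A_B
  by (auto simp: hermitian_tuples_def append_tuple_def split: sum.split)

lemma zero_hermitian_tuples: "0 \<in> hermitian_tuples B"
  by (simp add: hermitian_tuples_def)

text \<open>\<open>append_tuple Z\<close> is an affine isometry with linear part
  \<open>append_tuple 0\<close>: the difference quotients coincide, and injectivity maps punctured
  neighbourhoods of Y into punctured ones.\<close>

lemma frechet_derivative_comp_append_tuple:
  fixes Z :: "'h op ^ 'm" and Y :: "'h op ^ 'n"
  assumes D: "frechet_derivative_in (hermitian_tuples B) \<omega> f D (append_tuple Z Y)"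
  shows "frechet_derivative_in (hermitian_tuples A) (hermitian_tuples A \<inter> append_tuple Z -` \<omega>)
    (f \<circ> append_tuple Z) (\<lambda>K. D (append_tuple 0 K)) Y"
  unfolding frechet_derivative_in_def
proof (intro conjI ballI allI)
  have herm: "append_tuple 0 K \<in> (hermitian_tuples B :: ('h op ^ ('n + 'm)) set)" if "K \<in> hermitian_tuples A" for K :: "'h op ^ 'n"
    using that by (rule append_tuple_hermitian[OF zero_hermitian_tuples])
  fix K L :: "'h op ^ 'n" assume K: "K \<in> hermitian_tuples A"
  show "D (append_tuple 0 (r *\<^sub>R K)) = r *\<^sub>R D (append_tuple 0 K)" for r
    using D herm[OF K] by (simp add: frechet_derivative_in_def append_tuple_scaleR)
  assume L: "L \<in> hermitian_tuples A"
  show "D (append_tuple 0 (K + L)) = D (append_tuple 0 K) + D (append_tuple 0 L)"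
    using D herm[OF K] herm[OF L] by (simp add: frechet_derivative_in_def append_tuple_add)
next
  obtain C where "\<And>K. K \<in> hermitian_tuples B \<Longrightarrow> norm (D K) \<le> C * norm K"
    using D unfolding frechet_derivative_in_def by blast
  then have "norm (D (append_tuple 0 K)) \<le> C * norm K" if "K \<in> hermitian_tuples A" for K :: "'h op ^ 'n"
    using append_tuple_hermitian[OF zero_hermitian_tuples that] norm_append_tuple_0 by metis
  then show "\<exists>C. \<forall>K\<in>hermitian_tuples A. norm (D (append_tuple 0 K)) \<le> C * norm K"
    by blast
next
  let ?F = "at Y within hermitian_tuples A \<inter> append_tuple Z -` \<omega>"
  have "(append_tuple Z \<longlongrightarrow> append_tuple Z Y) ?F"
    unfolding tendsto_iff dist_append_tuple
    by (rule allI, rule impI, rule eventually_at_topological[THEN iffD2])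
      (metis dist_commute mem_ball open_ball centre_in_ball)
  moreover have "append_tuple Z X \<noteq> append_tuple Z Y" if "X \<noteq> Y" for X
    using that dist_append_tuple[of Z X Y] by auto
  ultimately have "filterlim (append_tuple Z) (at (append_tuple Z Y) within \<omega>) ?F"
    by (auto simp: filterlim_at eventually_at_filter)
  from filterlim_compose[OF _ this] D
  show "((\<lambda>X. ((f \<circ> append_tuple Z) X - (f \<circ> append_tuple Z) Y - D (append_tuple 0 (X - Y)))
      /\<^sub>R norm (X - Y)) \<longlongrightarrow> 0) ?F"
    unfolding frechet_derivative_in_def
    by (fastforce simp: append_tuple_diff norm_append_tuple_0)
qed

lemma cyclomorphic_function_comp_append_tuple:
  fixes Z :: "'h op ^ 'm" and f :: "'h op ^ ('n::finite + 'm) \<Rightarrow> real"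
  assumes Z: "Z \<in> hermitian_tuples B"
    and mixed: "\<And>w (Y :: 'h op ^ 'n). Y \<in> A.tuples \<Longrightarrow>
      cyclic_differentiable Y (\<lambda>X. \<beta> (word_eval (append_tuple Z X) w))"
    and f: "cyclomorphic_function B \<beta> \<omega> f"
  shows "cyclomorphic_function A \<alpha> (hermitian_tuples A \<inter> append_tuple Z -` \<omega>) (f \<circ> append_tuple Z)"
  unfolding cyclomorphic_function_def
proof (intro conjI ballI)
  have "continuous_on (hermitian_tuples A :: ('h op ^ 'n) set) (append_tuple Z)"
    unfolding continuous_on_iff by (auto simp: dist_append_tuple)
  then show "openin (top_of_set (hermitian_tuples A)) (hermitian_tuples A \<inter> append_tuple Z -` \<omega>)"
    by (rule continuous_openin_preimage[where T="hermitian_tuples B"])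
      (use append_tuple_hermitian[OF Z] f in \<open>auto simp: cyclomorphic_function_def\<close>)
next
  fix Y assume "Y \<in> hermitian_tuples A \<inter> append_tuple Z -` \<omega>"
  then have Y: "Y \<in> hermitian_tuples A" and ZY: "append_tuple Z Y \<in> \<omega>"
    by auto
  have Y': "Y \<in> A.tuples" and Z': "Z \<in> B.tuples"
    using Y Z by (auto simp: hermitian_tuples_def A.tuples_def B.tuples_def hermitian_part_def)
  obtain D T where D: "frechet_derivative_in (hermitian_tuples B) \<omega> f D (append_tuple Z Y)"
    and T: "T \<in> L1_closure (hermitian_part B) \<beta> (cyclic_gradients (append_tuple Z Y) \<inter> hermitian_tuples B)"
    and DT: "\<And>K. K \<in> hermitian_tuples B \<Longrightarrow>
      complex_of_real (D K) = (\<Sum>k\<in>UNIV. L1_trace \<beta> (T $ k) (K $ k))"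
    using f ZY unfolding cyclomorphic_function_def by blast
  obtain T' where T': "T' \<in> L1_closure (hermitian_part A) \<alpha> (cyclic_gradients Y \<inter> hermitian_tuples A)"
    and trace: "\<And>j K. K \<in> hermitian_part A \<Longrightarrow> L1_trace \<alpha> (T' $ j) K = L1_trace \<beta> (T $ Inl j) K"
    by (rule L1_closure_transfer[OF A.tracial_vna_axioms B.tracial_vna_axioms hermitian_part_A_B
          Int_lower2 Int_lower2 cyclic_gradient_expectation[OF Z' Y' mixed[OF Y']] T])
      (assumption, rule that)
  \<comment> \<open>The direction (K, 0) pairs the last m entries of T with 0, so only the entries
    transferred to T' contribute.\<close>
  have zero: "L1_trace \<beta> (T $ Inr j) 0 = 0" for j
    by (simp add: L1_trace_def limI)
  have "complex_of_real (D (append_tuple 0 K)) = (\<Sum>j\<in>UNIV. L1_trace \<alpha> (T' $ j) (K $ j))"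
    if K: "K \<in> hermitian_tuples A" for K
  proof -
    have "K $ j \<in> hermitian_part A" for j
      using K by (simp add: hermitian_tuples_def)
    then show ?thesis
      using DT[OF append_tuple_hermitian[OF zero_hermitian_tuples K]]
      by (simp add: sum_UNIV_Plus zero trace)
  qed
  with T' frechet_derivative_comp_append_tuple[OF D]
  show "\<exists>D. frechet_derivative_in (hermitian_tuples A) (hermitian_tuples A \<inter> append_tuple Z -` \<omega>)
        (f \<circ> append_tuple Z) D Y \<and>
      (\<exists>T\<in>L1_closure (hermitian_part A) \<alpha> (cyclic_gradients Y \<inter> hermitian_tuples A).
        \<forall>K\<in>hermitian_tuples A. complex_of_real (D K) = (\<Sum>j\<in>UNIV. L1_trace \<alpha> (T $ j) (K $ j)))"
    by blast
qed

end

theorem theorem5p13: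
  fixes A B :: "'h::complex_hilbert_space op set"
    and \<alpha> \<beta> :: "'h op \<Rightarrow> complex"
    and Z :: "'h op ^ 'm"
  assumes "tracial_von_neumann_algebra A \<alpha>"
    and "tracial_von_neumann_algebra B \<beta>"
    and "A \<subseteq> B"
    and "\<forall>a\<in>A. \<alpha> a = \<beta> a"
    and "Z \<in> hermitian_tuples B"
    and "independent_in \<beta> (range (\<lambda>j. Z $ j)) A \<or> free_in \<beta> (range (\<lambda>j. Z $ j)) A"
  shows "cyclomorphic_map A \<alpha> B \<beta>
           (hermitian_tuples A :: ('h op ^ 'n) set)
           (append_tuple Z :: 'h op ^ 'n \<Rightarrow> 'h op ^ ('n + 'm))"
proof -
  interpret tracial_inclusion A B \<alpha> \<beta>
    using assms by unfold_locales auto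
  have Z: "Z \<in> B.tuples"
    using assms(5) by (auto simp: hermitian_tuples_def B.tuples_def hermitian_part_def)
  have mixed: "cyclic_differentiable Y (\<lambda>X. \<beta> (word_eval (append_tuple Z X) w))"
    if "Y \<in> A.tuples" for w and Y :: "'h op ^ 'n"
    using assms(6) mixed_trace_independent[OF _ that] mixed_trace_free[OF _ Z that] by blast
  \<comment> \<open>The map is affine, so the remainder is identically zero.\<close>
  have "frechet_derivative_in (hermitian_tuples A) (hermitian_tuples A)
      (append_tuple Z :: 'h op ^ 'n \<Rightarrow> 'h op ^ ('n + 'm)) (append_tuple 0) Y" for Y
    unfolding frechet_derivative_in_def
    by (auto simp: append_tuple_add append_tuple_scaleR append_tuple_diff norm_append_tuple_0
        intro!: exI[of _ 1])
  moreover have "append_tuple Z ` (hermitian_tuples A :: ('h op ^ 'n) set) \<subseteq> hermitian_tuples B"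
    using append_tuple_hermitian[OF assms(5)] by auto
  ultimately show ?thesis
    using cyclomorphic_function_comp_append_tuple[OF assms(5) mixed]
    unfolding cyclomorphic_map_def by (auto simp del: vimage_comp)
qed

end
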